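(* Let $P,Q$ be finite sets of value-free constrained linear patterns. If $P$ is pairwise $\mathcal C$-non-overlapping, then (every possible result of) $P\ominus Q$ is a pairwise $\mathcal C$-non-overlapping finite set of value-free constrained linear patterns such that $\mathcal G_{\mathcal C}(P\ominus Q)=\mathcal G_{\mathcal C}(P)\setminus\mathcal G_{\mathcal C}(Q)$.
   Context: Signature and theories: $\mathcal S=\mathcal S_{\mathrm{theory}}\uplus\mathcal S_{\mathrm{term}}$ is a set of sorts and $\Sigma=\Sigma_{\mathrm{theory}}\cup\Sigma_{\mathrm{terms}}$ an $\mathcal S$-sorted first-order signature; $\mathcal V$ a countably infinite set of sorted variables. All argument and result sorts of symbols of $\Sigma_{\mathrm{theory}}$ lie in $\mathcal S_{\mathrm{theory}}$. Each theory sort $\iota$ has a nonempty universe $\mathcal I(\iota)$, each $f\in\Sigma_{\mathrm{theory}}$ an interpretation $\mathcal J(f)$ as a function on the universes, and a set $\mathrm{Val}_\iota\subseteq\Sigma_{\mathrm{theory}}$ of value constants of sort $\iota$ mapped bijectively onto $\mathcal I(\iota)$ by $\mathcal J$; $\mathrm{Val}=\bigcup_\iota\mathrm{Val}_\iota$ and $\Sigma_{\mathrm{terms}}\cap\Sigma_{\mathrm{theory}}\subseteq\mathrm{Val}$. There is a theory sort $\mathsf{bool}$ with values $\mathsf{true},\mathsf{false}$, and $\Sigma_{\mathrm{theory}}$ contains the usual connectives and $=,\neq$ on theory sorts, interpreted as usual; ground theory terms are evaluated by $[\![\cdot]\!]$ via $\mathcal J$. A constraint is a term of $T(\Sigma_{\mathrm{theory}},\mathcal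 V)$ of sort $\mathsf{bool}$. A substitution $\gamma$ respects $\varphi$ if $x\gamma\in\mathrm{Val}$ for all $x\in\mathrm{Var}(\varphi)$ and $[\![\varphi\gamma]\!]=\top$; $\varphi$ is satisfiable if some substitution respects it. Constructors: $\Sigma=\mathcal D\uplus\mathcal C$ with $\mathrm{Val}\subseteq\mathcal C$. Standing assumptions: $\Sigma_{\mathrm{terms}}$ is finite and no $c\in\mathcal C\setminus\mathrm{Val}$ has result sort in $\mathcal S_{\mathrm{theory}}$. A $\mathcal C$-substitution is a sort-preserving substitution with range in $T(\mathcal C,\mathcal V)$. A pattern is $f(t_1,\dots,t_n)$ with $f\in\mathcal D$, $t_i\in T(\mathcal C,\mathcal V)$. Constrained terms: pairs $t\,[\psi]$ of a term and a constraint; linear if $t$ is linear, value-free if $t$ has no symbol of $\mathrm{Val}$, a constrained pattern if $t$ is a pattern. $\mathcal G_{\mathcal C}(t\,[\psi])=\{t\sigma\mid\sigma$ a $\mathcal C$-substitution, $x\sigma$ ground for $x\in\mathrm{Var}(t)$, $\sigma$ respects $\psi\}$; $\mathcal G_{\mathcal C}(P)=\bigcup_{p\in P}\mathcal G_{\mathcal C}(p)$. Two constrained terms (or sets) are $\mathcal C$-non-overlapping if their $\mathcal G_{\mathcal C}$-sets are disjoint; a set is pairwise $\mathcal C$-non-overlapping if any two different elements are. Constrained terms are identified up to $\doteq$ (variable renaming $\delta$ with $t=t'\delta$, same variables shared between term and constraint, and $\exists\vec x.\psi\Leftrightarrow\exists\vec y.\psi'\delta$ valid where $\vec x,\vec y$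 are the constraint variables not occurring in the term); sets are taken modulo $\doteq$, and $\uplus$, $\cup$ are taken modulo $\doteq$. Complements: $\mathrm{Co}(x)=\emptyset$ for variables; for $c:\iota_1\times\cdots\times\iota_n\to\iota\in\mathcal C$, $\mathrm{Co}(c(u_1,\dots,u_n))=\{c'(x_1,\dots,x_m)\mid c'\ne c,\ c'\in\mathcal C$ with result sort $\iota\}\cup\bigcup_i\{c(u_1,\dots,u_{i-1},u'_i,y_{i+1},\dots,y_n)\mid u'_i\in\mathrm{Co}(u_i)\}$ (fresh pairwise distinct $x_j,y_j$). $\mathrm{CoSub}(\sigma)=\{\rho\mid\mathrm{Dom}(\rho)=\mathrm{Dom}(\sigma),\rho\ne\sigma,\forall x\in\mathrm{Dom}(\sigma).\ x\rho\in\mathrm{Co}(x\sigma)\cup\{x\sigma\}\}$. Unifiability: $s\,[\varphi]$, $t\,[\psi]$ are unifiable if $s,t$ have an mgu $\theta$ with $\mathrm{Dom}(\theta)\subseteq\mathrm{Var}(s,t)$, $x\theta\in\mathrm{Val}\cup\mathcal V$ for $x\in\mathrm{Var}(\varphi,\psi)$, and $\varphi\theta\wedge\psi\theta$ satisfiable. Difference of two: for value-free constrained pattern $s\,[\varphi]$ and value-free constrained linear pattern $t\,[\psi]$, take a variant $t'\,[\psi']\doteq t\,[\psi]$ variable-disjoint from $s\,[\varphi]$; if unifiable, with $\sigma$ an mgu of $s,t'$, $s\,[\varphi]\ominus t\,[\psi]=\{s\rho\,[\varphi\sigma]\mid\rho\in\mathrm{CoSub}(\sigma),s\rho\ne s\sigma\}\cup\{s\sigma\,[\varphi\sigma\wedge\neg\psi'\sigma]\mid\text{this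 constraint is satisfiable}\}$; otherwise $\{s\,[\varphi]\}$. Difference of sets (nondeterministic): for finite sets $P,Q$ of value-free constrained linear patterns, if $P=P'\uplus\{s\,[\varphi]\}$, $Q=Q'\uplus\{t\,[\psi]\}$ and $s\,[\varphi]\ominus t\,[\psi]\ne\{s\,[\varphi]\}$ (for some such choice), then $P\ominus Q=(P'\cup(s\,[\varphi]\ominus t\,[\psi]))\ominus(Q'\cup(t\,[\psi]\ominus s\,[\varphi]))$; otherwise $P\ominus Q=P$.
   Formalization: Added: each element of P and Q is ≐-equal to some t[ψ] with Var(ψ) ⊆ Var(t), and the variant t'[ψ'] that is subtracted must have Var(ψ') ⊆ Var(t'); otherwise false, e.g. P={f(x)[true]}, Q={f(y)[y=z]}. *)

theory Defs
  imports Main "HOL-Library.Countable_Set"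
begin

section \<open>Terms and substitutions\<close>

datatype (funs: 'f, vars: 'v) trm = Var 'v | Fun 'f "('f, 'v) trm list"

type_synonym ('f, 'v) sbst = "'v \<Rightarrow> ('f, 'v) trm"

primrec app_subst :: "('f, 'v) trm \<Rightarrow> ('f, 'v) sbst \<Rightarrow> ('f, 'v) trm"  (infixl "\<cdot>" 67) where
  "Var x \<cdot> \<sigma> = \<sigma> x"
| "Fun f ts \<cdot> \<sigma> = Fun f (map (\<lambda>t. t \<cdot> \<sigma>) ts)"

definition dom_subst :: "('f, 'v) sbst \<Rightarrow> 'v set" where
  "dom_subst \<sigma> = {x. \<sigma> x \<noteq> Var x}"

primrec var_list :: "('f, 'v) trm \<Rightarrow> 'v list" where
  "var_list (Var x) = [x]"
| "var_list (Fun f ts) = concat (map var_list ts)"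

definition linear_trm :: "('f, 'v) trm \<Rightarrow> bool" where
  "linear_trm t \<longleftrightarrow> distinct (var_list t)"


text \<open>A pair \<open>(t, \<psi>)\<close> stands for the constrained term \<open>t [\<psi>]\<close>. The variables of \<open>\<psi>\<close> that
  do not occur in \<open>t\<close> are read existentially, both in the ground instances and in the equivalence
  of constrained terms defined below, so negating \<open>\<psi>\<close> amounts to taking a complement only if there
  are no such variables. For a class \<open>p\<close> of equivalent constrained terms, the following predicate says
  that some representative has none.\<close>

definition has_closed_rep :: "(('f, 'v) trm \<times> ('f, 'v) trm) set \<Rightarrow> bool" where
  "has_closed_rep p \<longleftrightarrow> (\<exists>(t, \<psi>)\<in>p. vars \<psi> \<subseteq> vars t)"


section \<open>Signatures with a built-in theory\<close>

text \<open>All universes are subsets of one type \<^typ>\<open>'u\<close>; all arities are recorded by the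
  functions \<open>arg_sorts\<close> and \<open>res_sort\<close>, so a symbol has exactly one declaration.\<close>

record ('s, 'f, 'v, 'u) lc_sig =
  theory_sorts :: "'s set"
  term_sorts :: "'s set"
  theory_syms :: "'f set"
  term_syms :: "'f set"
  arg_sorts :: "'f \<Rightarrow> 's list"
  res_sort :: "'f \<Rightarrow> 's"
  var_sort :: "'v \<Rightarrow> 's"
  universe :: "'s \<Rightarrow> 'u set"
  interp :: "'f \<Rightarrow> 'u list \<Rightarrow> 'u"
  sort_values :: "'s \<Rightarrow> 'f set"
  bool_sort :: 's
  true_sym :: 'f
  false_sym :: 'f
  not_sym :: 'f
  and_sym :: 'f
  or_sym :: 'f
  imp_sym :: 'f
  iff_sym :: 'f
  eq_sym :: "'s \<Rightarrow> 'f"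
  neq_sym :: "'s \<Rightarrow> 'f"
  defined_syms :: "'f set"
  constructors :: "'f set"

definition all_syms :: "('s, 'f, 'v, 'u) lc_sig \<Rightarrow> 'f set" where
  "all_syms L = theory_syms L \<union> term_syms L"

definition all_sorts :: "('s, 'f, 'v, 'u) lc_sig \<Rightarrow> 's set" where
  "all_sorts L = theory_sorts L \<union> term_sorts L"

definition Val :: "('s, 'f, 'v, 'u) lc_sig \<Rightarrow> 'f set" where
  "Val L = (\<Union>\<iota>\<in>theory_sorts L. sort_values L \<iota>)"

definition truth :: "('s, 'f, 'v, 'u) lc_sig \<Rightarrow> bool \<Rightarrow> 'u" where
  "truth L b = interp L (if b then true_sym L else false_sym L) []"

locale lc_signature =
  fixes L :: "('s, 'f, 'v, 'u) lc_sig"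
  assumes sorts_disjoint: "theory_sorts L \<inter> term_sorts L = {}"
    and theory_syms_sorts:
      "f \<in> theory_syms L \<Longrightarrow> set (arg_sorts L f) \<subseteq> theory_sorts L \<and> res_sort L f \<in> theory_sorts L"
    and term_syms_sorts:
      "f \<in> term_syms L \<Longrightarrow> set (arg_sorts L f) \<subseteq> all_sorts L \<and> res_sort L f \<in> all_sorts L"
    \<comment> \<open>every sort has an unlimited supply of variables\<close>
    and vars_sorts: "var_sort L x \<in> all_sorts L"
    and vars_countable: "countable (UNIV :: 'v set)"
    and vars_infinite: "\<iota> \<in> all_sorts L \<Longrightarrow> infinite {x. var_sort L x = \<iota>}"
    and universe_nonempty: "\<iota> \<in> theory_sorts L \<Longrightarrow> universe L \<iota> \<noteq> {}"
    and interp_closed: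
      "f \<in> theory_syms L \<Longrightarrow> list_all2 (\<lambda>u \<iota>. u \<in> universe L \<iota>) us (arg_sorts L f)
        \<Longrightarrow> interp L f us \<in> universe L (res_sort L f)"
    and values_const:
      "\<iota> \<in> theory_sorts L \<Longrightarrow> c \<in> sort_values L \<iota>
        \<Longrightarrow> c \<in> theory_syms L \<and> arg_sorts L c = [] \<and> res_sort L c = \<iota>"
    and values_bij:
      "\<iota> \<in> theory_sorts L \<Longrightarrow> bij_betw (\<lambda>c. interp L c []) (sort_values L \<iota>) (universe L \<iota>)"
    and term_theory_syms: "term_syms L \<inter> theory_syms L \<subseteq> Val L"
    and bool_sort: "bool_sort L \<in> theory_sorts L"
    and bool_values: "sort_values L (bool_sort L) = {true_sym L, false_sym L}"
    and true_false: "true_sym L \<noteq> false_sym L"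
    and not_sym: "not_sym L \<in> theory_syms L" "arg_sorts L (not_sym L) = [bool_sort L]"
      "res_sort L (not_sym L) = bool_sort L"
      "interp L (not_sym L) [truth L a] = truth L (\<not> a)"
    and and_sym: "and_sym L \<in> theory_syms L" "arg_sorts L (and_sym L) = [bool_sort L, bool_sort L]"
      "res_sort L (and_sym L) = bool_sort L"
      "interp L (and_sym L) [truth L a, truth L b] = truth L (a \<and> b)"
    and or_sym: "or_sym L \<in> theory_syms L" "arg_sorts L (or_sym L) = [bool_sort L, bool_sort L]"
      "res_sort L (or_sym L) = bool_sort L"
      "interp L (or_sym L) [truth L a, truth L b] = truth L (a \<or> b)"
    and imp_sym: "imp_sym L \<in> theory_syms L" "arg_sorts L (imp_sym L) = [bool_sort L, bool_sort L]"
      "res_sort L (imp_sym L) = bool_sort L"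
      "interp L (imp_sym L) [truth L a, truth L b] = truth L (a \<longrightarrow> b)"
    and iff_sym: "iff_sym L \<in> theory_syms L" "arg_sorts L (iff_sym L) = [bool_sort L, bool_sort L]"
      "res_sort L (iff_sym L) = bool_sort L"
      "interp L (iff_sym L) [truth L a, truth L b] = truth L (a \<longleftrightarrow> b)"
    and eq_sym: "\<iota> \<in> theory_sorts L \<Longrightarrow> eq_sym L \<iota> \<in> theory_syms L"
      "\<iota> \<in> theory_sorts L \<Longrightarrow> arg_sorts L (eq_sym L \<iota>) = [\<iota>, \<iota>]"
      "\<iota> \<in> theory_sorts L \<Longrightarrow> res_sort L (eq_sym L \<iota>) = bool_sort L"
      "\<iota> \<in> theory_sorts L \<Longrightarrow> u \<in> universe L \<iota> \<Longrightarrow> v \<in> universe L \<iota>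
        \<Longrightarrow> interp L (eq_sym L \<iota>) [u, v] = truth L (u = v)"
    and neq_sym: "\<iota> \<in> theory_sorts L \<Longrightarrow> neq_sym L \<iota> \<in> theory_syms L"
      "\<iota> \<in> theory_sorts L \<Longrightarrow> arg_sorts L (neq_sym L \<iota>) = [\<iota>, \<iota>]"
      "\<iota> \<in> theory_sorts L \<Longrightarrow> res_sort L (neq_sym L \<iota>) = bool_sort L"
      "\<iota> \<in> theory_sorts L \<Longrightarrow> u \<in> universe L \<iota> \<Longrightarrow> v \<in> universe L \<iota>
        \<Longrightarrow> interp L (neq_sym L \<iota>) [u, v] = truth L (u \<noteq> v)"
    and syms_partition: "defined_syms L \<inter> constructors L = {}"
      "defined_syms L \<union> constructors L = all_syms L"
    and values_constructors: "Val L \<subseteq> constructors L"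
    and finite_term_syms: "finite (term_syms L)"
    and constructor_res_sort: "c \<in> constructors L - Val L \<Longrightarrow> res_sort L c \<notin> theory_sorts L"
begin

section \<open>Sorted terms, evaluation, constraints\<close>

inductive has_sort :: "('f, 'v) trm \<Rightarrow> 's \<Rightarrow> bool" where
  "has_sort (Var x) (var_sort L x)"
| "f \<in> all_syms L \<Longrightarrow> list_all2 has_sort ts (arg_sorts L f) \<Longrightarrow> has_sort (Fun f ts) (res_sort L f)"

definition substitution :: "('f, 'v) sbst \<Rightarrow> bool" where
  "substitution \<sigma> \<longleftrightarrow> (\<forall>x. has_sort (\<sigma> x) (var_sort L x))"

definition C_substitution :: "('f, 'v) sbst \<Rightarrow> bool" where
  "C_substitution \<sigma> \<longleftrightarrow> substitution \<sigma> \<and> (\<forall>x. funs (\<sigma> x) \<subseteq> constructors L)"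

primrec eval :: "('v \<Rightarrow> 'u) \<Rightarrow> ('f, 'v) trm \<Rightarrow> 'u" where
  "eval \<alpha> (Var x) = \<alpha> x"
| "eval \<alpha> (Fun f ts) = interp L f (map (eval \<alpha>) ts)"

text \<open>Evaluation of ground theory terms; the valuation is irrelevant for them.\<close>

definition ground_eval :: "('f, 'v) trm \<Rightarrow> 'u" where
  "ground_eval t = eval (\<lambda>_. undefined) t"

definition is_constraint :: "('f, 'v) trm \<Rightarrow> bool" where
  "is_constraint \<phi> \<longleftrightarrow> has_sort \<phi> (bool_sort L) \<and> funs \<phi> \<subseteq> theory_syms L"

definition is_value :: "('f, 'v) trm \<Rightarrow> bool" where
  "is_value t \<longleftrightarrow> (\<exists>c\<in>Val L. t = Fun c [])"

definition respecting :: "('f, 'v) sbst \<Rightarrow> ('f, 'v) trm \<Rightarrow> bool" where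
  "respecting \<gamma> \<phi> \<longleftrightarrow> (\<forall>x\<in>vars \<phi>. is_value (\<gamma> x)) \<and> ground_eval (\<phi> \<cdot> \<gamma>) = truth L True"

definition satisfiable :: "('f, 'v) trm \<Rightarrow> bool" where
  "satisfiable \<phi> \<longleftrightarrow> (\<exists>\<gamma>. substitution \<gamma> \<and> respecting \<gamma> \<phi>)"

abbreviation Conj :: "('f, 'v) trm \<Rightarrow> ('f, 'v) trm \<Rightarrow> ('f, 'v) trm" where
  "Conj \<phi> \<psi> \<equiv> Fun (and_sym L) [\<phi>, \<psi>]"

abbreviation Neg :: "('f, 'v) trm \<Rightarrow> ('f, 'v) trm" where
  "Neg \<phi> \<equiv> Fun (not_sym L) [\<phi>]"


section \<open>Constrained terms\<close>

definition cterms :: "(('f, 'v) trm \<times> ('f, 'v) trm) set" where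
  "cterms = {(t, \<psi>). (\<exists>\<iota>. has_sort t \<iota>) \<and> is_constraint \<psi>}"

definition is_pattern :: "('f, 'v) trm \<Rightarrow> bool" where
  "is_pattern t \<longleftrightarrow> (\<exists>\<iota>. has_sort t \<iota>) \<and>
     (\<exists>f ts. t = Fun f ts \<and> f \<in> defined_syms L \<and> (\<forall>u\<in>set ts. funs u \<subseteq> constructors L))"

definition value_free :: "('f, 'v) trm \<Rightarrow> bool" where
  "value_free t \<longleftrightarrow> funs t \<inter> Val L = {}"

definition GC1 :: "('f, 'v) trm \<times> ('f, 'v) trm \<Rightarrow> ('f, 'v) trm set" where
  "GC1 = (\<lambda>(t, \<psi>). {t \<cdot> \<sigma> | \<sigma>. C_substitution \<sigma> \<and> (\<forall>x\<in>vars t. vars (\<sigma> x) = {}) \<and> respecting \<sigma> \<psi>})"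

definition valuation :: "('v \<Rightarrow> 'u) \<Rightarrow> bool" where
  "valuation \<alpha> \<longleftrightarrow> (\<forall>x. var_sort L x \<in> theory_sorts L \<longrightarrow> \<alpha> x \<in> universe L (var_sort L x))"

text \<open>Truth under \<open>\<alpha>\<close> of the first-order formula obtained from \<open>\<psi>\<close> by existentially
  quantifying the variables in \<open>X\<close>.\<close>

definition holds_ex :: "'v set \<Rightarrow> ('f, 'v) trm \<Rightarrow> ('v \<Rightarrow> 'u) \<Rightarrow> bool" where
  "holds_ex X \<psi> \<alpha> \<longleftrightarrow> (\<exists>\<beta>. valuation \<beta> \<and> (\<forall>x. x \<notin> X \<longrightarrow> \<beta> x = \<alpha> x) \<and> eval \<beta> \<psi> = truth L True)"

definition renaming :: "('v \<Rightarrow> 'v) \<Rightarrow> bool" where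
  "renaming \<delta> \<longleftrightarrow> bij \<delta> \<and> (\<forall>x. var_sort L (\<delta> x) = var_sort L x)"

definition doteq :: "(('f, 'v) trm \<times> ('f, 'v) trm) rel" where
  "doteq = {((t, \<psi>), (t', \<psi>')). (t, \<psi>) \<in> cterms \<and> (t', \<psi>') \<in> cterms \<and>
     (\<exists>\<delta>. renaming \<delta> \<and> t = t' \<cdot> (Var \<circ> \<delta>) \<and>
        vars t \<inter> vars \<psi> = vars (t' \<cdot> (Var \<circ> \<delta>)) \<inter> vars (\<psi>' \<cdot> (Var \<circ> \<delta>)) \<and>
        (\<forall>\<alpha>. valuation \<alpha> \<longrightarrow>
           holds_ex (vars \<psi> - vars t) \<psi> \<alpha> =
           holds_ex (vars (\<psi>' \<cdot> (Var \<circ> \<delta>)) - vars (t' \<cdot> (Var \<circ> \<delta>))) (\<psi>' \<cdot> (Var \<circ> \<delta>)) \<alpha>))}"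

text \<open>Constrained terms are identified up to \<^term>\<open>doteq\<close>. Sets of constrained terms are therefore
  sets of \<^term>\<open>doteq\<close>-classes, on which equality, union and disjoint union have their plain meaning.\<close>

definition lin_vf_cpattern :: "(('f, 'v) trm \<times> ('f, 'v) trm) set \<Rightarrow> bool" where
  "lin_vf_cpattern p \<longleftrightarrow> p \<in> cterms // doteq \<and>
     (\<forall>(t, \<psi>)\<in>p. is_pattern t \<and> linear_trm t \<and> value_free t)"

definition GC :: "(('f, 'v) trm \<times> ('f, 'v) trm) set set \<Rightarrow> ('f, 'v) trm set" where
  "GC P = (\<Union>p\<in>P. \<Union>c\<in>p. GC1 c)"

definition pairwise_non_overlapping :: "(('f, 'v) trm \<times> ('f, 'v) trm) set set \<Rightarrow> bool" where
  "pairwise_non_overlapping P \<longleftrightarrow> pairwise (\<lambda>p q. GC {p} \<inter> GC {q} = {}) P"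

section \<open>Complements\<close>

text \<open>\<open>X\<close> is the set of variables in use, which the fresh variables have to avoid. All choices of
  fresh variables are included; they are identified later by passing to \<^term>\<open>doteq\<close>-classes.\<close>

function Co :: "'v set \<Rightarrow> ('f, 'v) trm \<Rightarrow> ('f, 'v) trm set" where
  "Co X (Var x) = {}"
| "Co X (Fun c us) =
     {Fun c' (map Var xs) | c' xs. c' \<noteq> c \<and> c' \<in> constructors L \<and> res_sort L c' = res_sort L c \<and>
        map (var_sort L) xs = arg_sorts L c' \<and> distinct xs \<and> set xs \<inter> X = {}} \<union>
     (\<Union>i\<in>{..<length us}. {Fun c (take i us @ u' # map Var ys) | u' ys. u' \<in> Co X (us ! i) \<and>
        map (var_sort L) ys = drop (Suc i) (arg_sorts L c) \<and> distinct ys \<and>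
        set ys \<inter> (X \<union> vars u') = {}})"
  by pat_completeness auto
termination
  by (relation "measure (\<lambda>(X, t). size t)")
    (auto simp: less_Suc_eq_le intro: size_list_estimation' nth_mem)

definition CoSub :: "'v set \<Rightarrow> ('f, 'v) sbst \<Rightarrow> ('f, 'v) sbst set" where
  "CoSub X \<sigma> = {\<rho>. dom_subst \<rho> = dom_subst \<sigma> \<and> \<rho> \<noteq> \<sigma> \<and>
     (\<forall>x\<in>dom_subst \<sigma>. \<rho> x \<in> Co X (\<sigma> x) \<union> {\<sigma> x}) \<and>
     (\<forall>x\<in>dom_subst \<sigma>. \<forall>y\<in>dom_subst \<sigma>. x \<noteq> y \<longrightarrow> vars (\<rho> x) \<inter> vars (\<rho> y) \<subseteq> X)}"


section \<open>Differences\<close>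

definition is_mgu :: "('f, 'v) sbst \<Rightarrow> ('f, 'v) trm \<Rightarrow> ('f, 'v) trm \<Rightarrow> bool" where
  "is_mgu \<sigma> s t \<longleftrightarrow> substitution \<sigma> \<and> s \<cdot> \<sigma> = t \<cdot> \<sigma> \<and>
     (\<forall>\<tau>. substitution \<tau> \<and> s \<cdot> \<tau> = t \<cdot> \<tau> \<longrightarrow> (\<exists>\<delta>. substitution \<delta> \<and> (\<forall>x. \<tau> x = \<sigma> x \<cdot> \<delta>))) \<and>
     dom_subst \<sigma> \<subseteq> vars s \<union> vars t"

definition unifiable ::
  "('f, 'v) trm \<times> ('f, 'v) trm \<Rightarrow> ('f, 'v) trm \<times> ('f, 'v) trm \<Rightarrow> bool" where
  "unifiable = (\<lambda>(s, \<phi>) (t, \<psi>). \<exists>\<theta>. is_mgu \<theta> s t \<and>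
     (\<forall>x\<in>vars \<phi> \<union> vars \<psi>. is_value (\<theta> x) \<or> (\<exists>y. \<theta> x = Var y)) \<and>
     satisfiable (Conj (\<phi> \<cdot> \<theta>) (\<psi> \<cdot> \<theta>)))"

definition diff_pieces :: "('f, 'v) sbst \<Rightarrow>
    ('f, 'v) trm \<times> ('f, 'v) trm \<Rightarrow> ('f, 'v) trm \<times> ('f, 'v) trm \<Rightarrow> (('f, 'v) trm \<times> ('f, 'v) trm) set" where
  "diff_pieces \<sigma> = (\<lambda>(s, \<phi>) (t, \<psi>).
     (let X = vars s \<union> vars \<phi> \<union> vars t \<union> vars \<psi> \<union> (\<Union>x\<in>dom_subst \<sigma>. vars (\<sigma> x)) in
       {(s \<cdot> \<rho>, \<phi> \<cdot> \<sigma>) | \<rho>. \<rho> \<in> CoSub X \<sigma> \<and> s \<cdot> \<rho> \<noteq> s \<cdot> \<sigma>} \<union>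
       {c. c = (s \<cdot> \<sigma>, Conj (\<phi> \<cdot> \<sigma>) (Neg (\<psi> \<cdot> \<sigma>))) \<and> satisfiable (snd c)}))"

text \<open>\<open>diff_two p q D\<close>: \<open>D\<close> is a possible value of the difference of \<open>p\<close> and \<open>q\<close>, depending on the
  chosen representatives and the chosen mgu. The representative of the subtrahend, whose constraint
  gets negated, has to be free of implicitly quantified variables.\<close>

definition diff_two :: "(('f, 'v) trm \<times> ('f, 'v) trm) set \<Rightarrow> (('f, 'v) trm \<times> ('f, 'v) trm) set \<Rightarrow>
    (('f, 'v) trm \<times> ('f, 'v) trm) set set \<Rightarrow> bool" where
  "diff_two p q D \<longleftrightarrow> (\<exists>s \<phi> t \<psi>. (s, \<phi>) \<in> p \<and> (t, \<psi>) \<in> q \<and>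
     (vars s \<union> vars \<phi>) \<inter> (vars t \<union> vars \<psi>) = {} \<and> vars \<psi> \<subseteq> vars t \<and>
     (if unifiable (s, \<phi>) (t, \<psi>)
      then \<exists>\<sigma>. is_mgu \<sigma> s t \<and> D = diff_pieces \<sigma> (s, \<phi>) (t, \<psi>) // doteq
      else D = {p}))"

text \<open>\<open>diff_sets P Q R\<close>: \<open>R\<close> is a possible result of the nondeterministic computation of the
  difference of \<open>P\<close> and \<open>Q\<close>.\<close>

inductive diff_sets :: "(('f, 'v) trm \<times> ('f, 'v) trm) set set \<Rightarrow>
    (('f, 'v) trm \<times> ('f, 'v) trm) set set \<Rightarrow> (('f, 'v) trm \<times> ('f, 'v) trm) set set \<Rightarrow> bool" where
  step: "p \<notin> P' \<Longrightarrow> q \<notin> Q' \<Longrightarrow> diff_two p q D \<Longrightarrow> D \<noteq> {p} \<Longrightarrow> diff_two q p E \<Longrightarrow>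
    diff_sets (P' \<union> D) (Q' \<union> E) R \<Longrightarrow> diff_sets (P' \<union> {p}) (Q' \<union> {q}) R"
| stop: "\<nexists>p q D. p \<in> P \<and> q \<in> Q \<and> diff_two p q D \<and> D \<noteq> {p} \<Longrightarrow> diff_sets P Q P"

end

end

theory Submission
  imports Defs "HOL-Library.FuncSet"
begin

text \<open>Two variable-disjoint linear patterns with a common instance have an explicit most general
  unifier, and every other one differs from it by an injective renaming of its range. Hence, for any
  most general unifier \<open>\<sigma>\<close>, the term \<open>s\<sigma>\<close> is linear, and since value-free constructor terms of theory
  sort are variables, \<open>\<sigma>\<close> maps the variables of the constraints to variables.

  The ground constructor terms that are not instances of a linear term \<open>u\<close> are exactly those that are
  instances of a member of \<open>Co(u)\<close>. So the terms \<open>s\<rho>\<close> with \<open>\<rho> \<in> CoSub(\<sigma>)\<close> cover the instances of \<open>s\<close>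
  that are not instances of \<open>t\<close>, and \<open>s\<sigma> [\<phi>\<sigma> \<and> \<not>\<psi>\<sigma>]\<close> covers those that match \<open>t\<close> but violate \<open>\<psi>\<close>.
  Two pieces with a common instance agree up to the choice of fresh variables, hence are
  equivalent; as only finitely many shapes occur, the difference of two is finite.

  In a step of the difference of sets, \<open>G(P')\<close> and \<open>G(p)\<close> are disjoint, so that
  \<open>(G(P') \<union> (G(p) - G(q))) - (G(Q') \<union> (G(q) - G(p)))\<close> equals
  \<open>(G(P') \<union> G(p)) - (G(Q') \<union> G(q))\<close>. If no step is possible, all \<open>G(p) \<inter> G(q)\<close> are empty.\<close>

section \<open>Terms and substitutions\<close>

text \<open>The delicate point is negation. Constraint variables outside the term are existentially
  quantified, so negating \<psi> describes a complement only if the subtrahend has no such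
  variables. In the difference of sets every piece may become a subtrahend later, so having a closed
  representative must be an invariant of the recursion. For an arbitrary representative this is
  expressed by a quantifier-free equivalent \<chi> of its constraint (\<open>closure_of\<close>),
  and \<chi>\<sigma> then serves the pieces. All split pieces s\<rho> can carry one constraint
  \<phi>\<sigma>, because \<rho> and \<sigma> agree on the variables common to s and \<phi>:
  variables have no complement. Complements contain every choice of fresh variables, so neither
  finiteness nor non-overlap holds before passing to classes. Skeletons forget the names of fresh
  variables, and linearity turns equality of skeletons into equivalence. When no step is possible,
  it remains to see that some difference of p and q exists at all, which again rests on a closed
  representative.\<close>

lemma set_var_list [simp]: "set (var_list t) = vars t"
  by (induction t) auto

lemma finite_vars [simp]: "finite (vars t)"
  by (metis List.finite_set set_var_list)

lemma vars_subst: "vars (t \<cdot> \<sigma>) = (\<Union>x\<in>vars t. vars (\<sigma> x))"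
  by (induction t) auto

lemma funs_subst: "funs (t \<cdot> \<sigma>) = funs t \<union> (\<Union>x\<in>vars t. funs (\<sigma> x))"
  by (induction t) auto

lemma subst_cong: "(\<And>x. x \<in> vars t \<Longrightarrow> \<sigma> x = \<tau> x) \<Longrightarrow> t \<cdot> \<sigma> = t \<cdot> \<tau>"
  by (induction t) auto

lemma subst_eq_iff: "t \<cdot> \<sigma> = t \<cdot> \<tau> \<longleftrightarrow> (\<forall>x\<in>vars t. \<sigma> x = \<tau> x)"
  by (induction t) auto

lemma subst_subst: "t \<cdot> \<sigma> \<cdot> \<tau> = t \<cdot> (\<lambda>x. \<sigma> x \<cdot> \<tau>)"
  by (induction t) auto

lemma subst_Var [simp]: "t \<cdot> Var = t"
  by (induction t) (auto simp: map_idI)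

lemma subst_ident: "(\<And>x. x \<in> vars t \<Longrightarrow> \<sigma> x = Var x) \<Longrightarrow> t \<cdot> \<sigma> = t"
  using subst_cong[of t \<sigma> Var] by simp

text \<open>\<open>k\<close> is determined on \<open>A\<close> by the value of \<open>h\<close>, as
  seen by passing to the element that \<open>inv_into\<close> selects in each fibre. Later
  \<open>h\<close> lists skeletons and \<open>k\<close> yields equivalence classes of
  pieces.\<close>

lemma finite_image_factor:
  assumes "finite (h ` A)" and "\<And>a b. a \<in> A \<Longrightarrow> b \<in> A \<Longrightarrow> h a = h b \<Longrightarrow> k a = k b"
  shows "finite (k ` A)"
proof -
  have "k a = k (inv_into A h (h a))" if "a \<in> A" for a
    by (rule assms(2)) (use that in \<open>simp_all add: inv_into_into f_inv_into_f\<close>)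
  then have "k ` A \<subseteq> (\<lambda>y. k (inv_into A h y)) ` (h ` A)" by blast
  then show ?thesis using assms(1) by (meson finite_imageI finite_subset)
qed

text \<open>Merges functions with pairwise disjoint domains, with \<open>d\<close> as default.
  Linearity is exploited through it: matchers or unifiers of separate subterms combine without
  conflict.\<close>

lemma glue:
  assumes "\<And>i j x. i \<in> I \<Longrightarrow> j \<in> I \<Longrightarrow> x \<in> V i \<Longrightarrow> x \<in> V j \<Longrightarrow> i = j"
  obtains h where "\<And>i x. i \<in> I \<Longrightarrow> x \<in> V i \<Longrightarrow> h x = f i x"
    and "\<And>x. x \<notin> (\<Union>i\<in>I. V i) \<Longrightarrow> h x = d x"
proof
  let ?h = "\<lambda>x. if x \<in> (\<Union>i\<in>I. V i) then f (THE i. i \<in> I \<and> x \<in> V i) x else d x"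
  show "?h x = f i x" if "i \<in> I" "x \<in> V i" for i x
  proof -
    have "(THE i. i \<in> I \<and> x \<in> V i) = i"
    proof (rule the_equality)
      show "j = i" if "j \<in> I \<and> x \<in> V j" for j
        using that \<open>i \<in> I\<close> \<open>x \<in> V i\<close> assms by blast
    qed (use that in simp)
    moreover have "x \<in> (\<Union>i\<in>I. V i)" by (rule UN_I) fact+
    ultimately show ?thesis by simp
  qed
  show "?h x = d x" if "x \<notin> (\<Union>i\<in>I. V i)" for x
    using that by simp
qed

section \<open>Linear terms and their instances\<close>

lemma linear_Var [simp]: "linear_trm (Var x)"
  by (simp add: linear_trm_def)

text \<open>Disjointness is required between positions rather than between members, so that a list
  repeated at two positions is covered too: it must then be empty.\<close>

lemma distinct_concat_iff:
  "distinct (concat xss) \<longleftrightarrow> (\<forall>i<length xss. distinct (xss ! i)) \<and>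
     (\<forall>i<length xss. \<forall>j<length xss. i \<noteq> j \<longrightarrow> set (xss ! i) \<inter> set (xss ! j) = {})"
proof (induction xss)
  case (Cons xs xss)
  have "distinct (concat (xs # xss)) \<longleftrightarrow>
      distinct xs \<and> distinct (concat xss) \<and> (\<forall>i<length xss. set xs \<inter> set (xss ! i) = {})"
  proof -
    have "set xs \<inter> set (concat xss) = {} \<longleftrightarrow> (\<forall>i<length xss. set xs \<inter> set (xss ! i) = {})"
      unfolding set_concat set_conv_nth[of xss] by fast
    then show ?thesis by simp
  qed
  also have "\<dots> \<longleftrightarrow> (\<forall>i<length (xs # xss). distinct ((xs # xss) ! i)) \<and>
     (\<forall>i<length (xs # xss). \<forall>j<length (xs # xss). i \<noteq> j \<longrightarrow>
        set ((xs # xss) ! i) \<inter> set ((xs # xss) ! j) = {})"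
    unfolding Cons.IH by (simp add: All_less_Suc2 all_conj_distrib Int_commute) (rule iffI; simp)
  finally show ?case .
qed simp

lemma linear_Fun:
  "linear_trm (Fun f ts) \<longleftrightarrow> (\<forall>i<length ts. linear_trm (ts ! i)) \<and>
     (\<forall>i<length ts. \<forall>j<length ts. i \<noteq> j \<longrightarrow> vars (ts ! i) \<inter> vars (ts ! j) = {})"
  by (simp add: linear_trm_def distinct_concat_iff)

lemma vars_nth: "i < length ts \<Longrightarrow> vars (ts ! i) \<subseteq> vars (Fun f ts)"
  by (force simp: in_set_conv_nth)

lemma vars_Fun_nth: "vars (Fun f ts) = (\<Union>i<length ts. vars (ts ! i))"
  by (force simp: in_set_conv_nth)

lemma linear_subst:
  assumes "linear_trm t" and "\<And>x. x \<in> vars t \<Longrightarrow> linear_trm (\<sigma> x)"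
    and "\<And>x y. x \<in> vars t \<Longrightarrow> y \<in> vars t \<Longrightarrow> x \<noteq> y \<Longrightarrow> vars (\<sigma> x) \<inter> vars (\<sigma> y) = {}"
  shows "linear_trm (t \<cdot> \<sigma>)"
  using assms
proof (induction t)
  case (Fun f ts)
  have lin: "linear_trm (ts ! i \<cdot> \<sigma>)" if "i < length ts" for i
  proof (rule Fun.IH)
    show "ts ! i \<in> set ts" using that by simp
    show "linear_trm (ts ! i)" using Fun.prems(1) that by (simp add: linear_Fun)
  qed (use Fun.prems(2,3) that vars_nth[OF that, of f] in blast)+
  have "vars (ts ! i \<cdot> \<sigma>) \<inter> vars (ts ! j \<cdot> \<sigma>) = {}"
    if ij: "i < length ts" "j < length ts" "i \<noteq> j" for i j
  proof -
    have "vars (\<sigma> x) \<inter> vars (\<sigma> y) = {}" if "x \<in> vars (ts ! i)" "y \<in> vars (ts ! j)" for x y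
    proof (rule Fun.prems(3))
      show "x \<noteq> y" using Fun.prems(1) ij that by (auto simp: linear_Fun)
    qed (use that ij vars_nth[of _ ts f] in blast)+
    then show ?thesis by (auto simp: vars_subst)
  qed
  with lin show ?case by (simp add: linear_Fun)
qed simp

text \<open>This and \<open>linear_subst_D2\<close> invert \<open>linear_subst\<close>. Applied to a
  unified term, they make the range terms of the unifier linear and variable-disjoint.\<close>

lemma linear_subst_D1: "linear_trm (t \<cdot> \<sigma>) \<Longrightarrow> x \<in> vars t \<Longrightarrow> linear_trm (\<sigma> x)"
proof (induction t)
  case (Fun f ts)
  from Fun.prems(2) obtain i where "i < length ts" "x \<in> vars (ts ! i)"
    by (auto simp: in_set_conv_nth)
  with Fun.IH[of "ts ! i"] Fun.prems(1) show ?case by (simp add: linear_Fun)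
qed simp

lemma linear_subst_D2:
  "linear_trm (t \<cdot> \<sigma>) \<Longrightarrow> x \<in> vars t \<Longrightarrow> y \<in> vars t \<Longrightarrow> x \<noteq> y \<Longrightarrow> vars (\<sigma> x) \<inter> vars (\<sigma> y) = {}"
proof (induction t)
  case (Fun f ts)
  from Fun.prems(2,3) obtain i j where ij: "i < length ts" "x \<in> vars (ts ! i)"
    "j < length ts" "y \<in> vars (ts ! j)"
    by (auto simp: in_set_conv_nth)
  show ?case
  proof (cases "i = j")
    case True
    with Fun.IH[of "ts ! i"] Fun.prems(1,4) ij show ?thesis by (simp add: linear_Fun)
  next
    case False
    with Fun.prems(1) ij have "vars (ts ! i \<cdot> \<sigma>) \<inter> vars (ts ! j \<cdot> \<sigma>) = {}"
      by (simp add: linear_Fun)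
    with ij show ?thesis by (auto simp: vars_subst)
  qed
qed simp

text \<open>The arguments have disjoint variables, so their matchers can be glued; for a nonlinear
  term such as f(x,x), matching argument by argument would not be enough.\<close>

lemma linear_instance:
  assumes "linear_trm (Fun f us)" and len: "length gs = length us"
    and inst: "\<And>i. i < length us \<Longrightarrow> \<exists>\<gamma>. gs ! i = us ! i \<cdot> \<gamma>"
  shows "\<exists>\<gamma>. Fun f gs = Fun f us \<cdot> \<gamma>"
proof -
  from inst obtain \<gamma> where \<gamma>: "\<And>i. i < length us \<Longrightarrow> gs ! i = us ! i \<cdot> \<gamma> i" by metis
  have disj: "i = j" if "i < length us" "j < length us" "x \<in> vars (us ! i)" "x \<in> vars (us ! j)" for i j x
    using assms(1) that unfolding linear_Fun by (metis disjoint_iff)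
  obtain h where h: "\<And>i x. i \<in> {..<length us} \<Longrightarrow> x \<in> vars (us ! i) \<Longrightarrow> h x = \<gamma> i x"
    by (rule glue[where I = "{..<length us}" and V = "\<lambda>i. vars (us ! i)" and f = \<gamma> and d = Var])
      (use disj in auto)
  have "gs = map (\<lambda>u. u \<cdot> h) us"
    by (rule nth_equalityI) (use len \<gamma> h in \<open>auto intro!: subst_cong\<close>)
  then have "Fun f gs = Fun f us \<cdot> h" by simp
  then show ?thesis by (rule exI[where x = h])
qed

text \<open>Linearity of \<open>s \<cdot> \<rho>\<close> makes the range terms of \<rho>
  variable-disjoint, so the matchers found for single variables of \<open>s\<close> merge into
  one.\<close>

lemma subst_instance:
  assumes "linear_trm (s \<cdot> \<rho>)" and inst: "\<And>x. x \<in> vars s \<Longrightarrow> \<exists>\<delta>. \<gamma> x = \<rho> x \<cdot> \<delta>"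
  obtains \<delta> where "\<And>x. x \<in> vars s \<Longrightarrow> \<gamma> x = \<rho> x \<cdot> \<delta>" "\<And>x. x \<notin> vars (s \<cdot> \<rho>) \<Longrightarrow> \<delta> x = Var x"
proof -
  from inst obtain d where d: "\<And>x. x \<in> vars s \<Longrightarrow> \<gamma> x = \<rho> x \<cdot> d x" by metis
  obtain h where h: "\<And>x y. x \<in> vars s \<Longrightarrow> y \<in> vars (\<rho> x) \<Longrightarrow> h y = d x y"
    "\<And>x. x \<notin> (\<Union>y\<in>vars s. vars (\<rho> y)) \<Longrightarrow> h x = Var x"
    by (rule glue[where I = "vars s" and V = "\<lambda>x. vars (\<rho> x)" and f = d and d = Var])
      (use linear_subst_D2[OF assms(1)] in blast)+
  show thesis
  proof (rule that)
    show "\<gamma> x = \<rho> x \<cdot> h" if "x \<in> vars s" for x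
      using d[OF that] subst_cong[of "\<rho> x" h "d x"] h(1)[OF that] by simp
    show "h x = Var x" if "x \<notin> vars (s \<cdot> \<rho>)" for x
      using that h(2) by (simp add: vars_subst)
  qed
qed

text \<open>Equality of the images under \<^term>\<open>map_trm id g\<close> says that two terms agree up to their
  variables, and that corresponding variables have the same colour under \<open>g\<close>.\<close>

lemma map_trm_eq_instance:
  "linear_trm t \<Longrightarrow> map_trm id g t = map_trm id g u \<Longrightarrow> \<exists>\<gamma>. u = t \<cdot> \<gamma>"
proof (induction t arbitrary: u)
  case (Var x)
  show ?case by (rule exI[of _ "\<lambda>_. u"]) simp
next
  case (Fun f ts)
  from Fun.prems(2) obtain us where u: "u = Fun f us"
    and eq: "map (map_trm id g) ts = map (map_trm id g) us"
    by (cases u) (auto simp: id_def)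
  from eq have len: "length us = length ts" by (metis length_map)
  have "\<exists>\<gamma>. us ! i = ts ! i \<cdot> \<gamma>" if i: "i < length ts" for i
  proof (rule Fun.IH)
    show "ts ! i \<in> set ts" using i by simp
    show "linear_trm (ts ! i)" using i Fun.prems(1) by (simp add: linear_Fun)
    show "map_trm id g (ts ! i) = map_trm id g (us ! i)"
      using arg_cong[OF eq, of "\<lambda>l. l ! i"] i len by simp
  qed
  with Fun.prems(1) len show ?case unfolding u by (intro linear_instance) auto
qed

text \<open>Only a variable has the coloured shape of a variable, so an instance of the same shape
  can only rename variables within their colours.\<close>

lemma map_trm_subst_eqD:
  "map_trm id g t = map_trm id g (t \<cdot> \<gamma>) \<Longrightarrow> x \<in> vars t \<Longrightarrow> \<exists>y. \<gamma> x = Var y \<and> g y = g x"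
proof (induction t)
  case (Var z)
  then show ?case by (cases "\<gamma> z") auto
next
  case (Fun f ts)
  from Fun.prems(2) obtain t where t: "t \<in> set ts" "x \<in> vars t" by auto
  from Fun.prems(1) t(1) have "map_trm id g t = map_trm id g (t \<cdot> \<gamma>)"
    by (simp add: o_def id_def)
  with Fun.IH t show ?case by blast
qed

lemma map_trm_subst_cong:
  "(\<And>x. x \<in> vars t \<Longrightarrow> map_trm id g (\<sigma> x) = map_trm id g (\<tau> x)) \<Longrightarrow>
    map_trm id g (t \<cdot> \<sigma>) = map_trm id g (t \<cdot> \<tau>)"
  by (induction t) auto

section \<open>Sorts and evaluation\<close>

context lc_signature
begin

lemma has_sort_Var [simp]: "has_sort (Var x) \<iota> \<longleftrightarrow> \<iota> = var_sort L x"
  by (auto intro: has_sort.intros elim: has_sort.cases)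

lemma has_sort_Fun:
  "has_sort (Fun f ts) \<iota> \<longleftrightarrow> f \<in> all_syms L \<and> \<iota> = res_sort L f \<and>
     length ts = length (arg_sorts L f) \<and>
     (\<forall>i<length ts. has_sort (ts ! i) (arg_sorts L f ! i))" (is "?l \<longleftrightarrow> ?r")
proof
  assume ?l
  then show ?r by (cases rule: has_sort.cases) (auto simp: list_all2_conv_all_nth)
next
  assume ?r
  then show ?l using has_sort.intros(2)[of f ts] by (simp add: list_all2_conv_all_nth)
qed

lemma has_sort_subst:
  "has_sort t \<iota> \<Longrightarrow> (\<And>x. x \<in> vars t \<Longrightarrow> has_sort (\<sigma> x) (var_sort L x)) \<Longrightarrow> has_sort (t \<cdot> \<sigma>) \<iota>"
proof (induction t arbitrary: \<iota>)
  case (Fun f ts)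
  have "has_sort (ts ! i \<cdot> \<sigma>) (arg_sorts L f ! i)" if i: "i < length ts" for i
  proof (rule Fun.IH)
    show "ts ! i \<in> set ts" using i by simp
    show "has_sort (ts ! i) (arg_sorts L f ! i)" using i Fun.prems(1) by (simp add: has_sort_Fun)
    show "has_sort (\<sigma> x) (var_sort L x)" if "x \<in> vars (ts ! i)" for x
      using Fun.prems(2) that vars_nth[OF i] by blast
  qed
  with Fun.prems(1) show ?case by (simp add: has_sort_Fun)
qed simp

text \<open>The head symbol fixes the sorts of its arguments, so correct sorting of an instance
  descends to the terms replacing the variables. \<open>piece_complete\<close> recovers the sorts of
  a matcher in this way.\<close>

lemma has_sort_subst_D:
  "has_sort t \<iota> \<Longrightarrow> has_sort (t \<cdot> \<sigma>) \<iota> \<Longrightarrow> x \<in> vars t \<Longrightarrow> has_sort (\<sigma> x) (var_sort L x)"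
proof (induction t arbitrary: \<iota>)
  case (Fun f ts)
  from Fun.prems(3) obtain i where i: "i < length ts" "x \<in> vars (ts ! i)"
    by (auto simp: in_set_conv_nth)
  with Fun.IH[of "ts ! i" "arg_sorts L f ! i"] Fun.prems(1,2) show ?case
    by (simp add: has_sort_Fun)
qed simp

lemma theory_term_vars:
  "has_sort t \<iota> \<Longrightarrow> \<iota> \<in> theory_sorts L \<Longrightarrow> funs t \<subseteq> theory_syms L \<Longrightarrow> x \<in> vars t \<Longrightarrow>
    var_sort L x \<in> theory_sorts L"
proof (induction t arbitrary: \<iota>)
  case (Fun f ts)
  from Fun.prems(4) obtain i where i: "i < length ts" "x \<in> vars (ts ! i)"
    by (auto simp: in_set_conv_nth)
  show ?case
  proof (rule Fun.IH)
    show "ts ! i \<in> set ts" using i by simp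
    show "has_sort (ts ! i) (arg_sorts L f ! i)" using i Fun.prems(1) by (simp add: has_sort_Fun)
    have "f \<in> theory_syms L" "length ts = length (arg_sorts L f)"
      using Fun.prems(1,3) by (simp_all add: has_sort_Fun)
    then show "arg_sorts L f ! i \<in> theory_sorts L"
      using theory_syms_sorts[of f] nth_mem[of i "arg_sorts L f"] i by auto
    show "funs (ts ! i) \<subseteq> theory_syms L"
      using Fun.prems(3) nth_mem[OF i(1)] by auto
  qed fact
qed simp

lemma constraint_vars: "is_constraint \<phi> \<Longrightarrow> x \<in> vars \<phi> \<Longrightarrow> var_sort L x \<in> theory_sorts L"
  unfolding is_constraint_def using theory_term_vars bool_sort by blast

section \<open>Evaluation of theory terms and truth of constraints\<close>

lemma eval_cong: "(\<And>x. x \<in> vars t \<Longrightarrow> \<alpha> x = \<beta> x) \<Longrightarrow> eval \<alpha> t = eval \<beta> t"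
proof (induction t)
  case (Fun f ts)
  then have "map (eval \<alpha>) ts = map (eval \<beta>) ts" by auto
  then show ?case by (simp only: eval.simps)
qed simp

lemma eval_subst: "eval \<alpha> (t \<cdot> \<sigma>) = eval (\<lambda>x. eval \<alpha> (\<sigma> x)) t"
proof (induction t)
  case (Fun f ts)
  then have "map (\<lambda>t. eval \<alpha> (t \<cdot> \<sigma>)) ts = map (eval (\<lambda>x. eval \<alpha> (\<sigma> x))) ts" by auto
  then show ?case by (simp only: app_subst.simps eval.simps map_map o_def)
qed simp

lemma ground_eval_subst: "ground_eval (t \<cdot> \<sigma>) = eval (\<lambda>x. ground_eval (\<sigma> x)) t"
  by (simp add: ground_eval_def eval_subst)

lemma eval_universe:
  "has_sort t \<iota> \<Longrightarrow> funs t \<subseteq> theory_syms L \<Longrightarrow>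
    (\<And>x. x \<in> vars t \<Longrightarrow> \<alpha> x \<in> universe L (var_sort L x)) \<Longrightarrow> eval \<alpha> t \<in> universe L \<iota>"
proof (induction t arbitrary: \<iota>)
  case (Fun f ts)
  have "eval \<alpha> (ts ! i) \<in> universe L (arg_sorts L f ! i)" if i: "i < length ts" for i
  proof (rule Fun.IH)
    show "ts ! i \<in> set ts" using i by simp
    show "has_sort (ts ! i) (arg_sorts L f ! i)" using i Fun.prems(1) by (simp add: has_sort_Fun)
    show "funs (ts ! i) \<subseteq> theory_syms L"
      using Fun.prems(2) nth_mem[OF i(1)] by auto
    show "\<alpha> x \<in> universe L (var_sort L x)" if "x \<in> vars (ts ! i)" for x
      using Fun.prems(3) that vars_nth[OF i] by blast
  qed
  then have "list_all2 (\<lambda>u \<iota>. u \<in> universe L \<iota>) (map (eval \<alpha>) ts) (arg_sorts L f)"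
    using Fun.prems(1) by (simp add: has_sort_Fun list_all2_conv_all_nth)
  then show ?case
    using interp_closed[of f "map (eval \<alpha>) ts"] Fun.prems(1,2) by (simp add: has_sort_Fun)
qed simp

lemma truth_neq: "truth L True \<noteq> truth L False"
  using bij_betw_imp_inj_on[OF values_bij[OF bool_sort]] true_false
  by (auto simp: truth_def bool_values inj_on_def)

text \<open>A local form of \<open>valuation\<close>: values outside \<open>V\<close> are
  unconstrained, so valuations of different variable sets can be combined freely. It is applied to
  constraint variables, which are all of theory sort.\<close>

definition val_on :: "'v set \<Rightarrow> ('v \<Rightarrow> 'u) \<Rightarrow> bool" where
  "val_on V \<alpha> \<longleftrightarrow> (\<forall>x\<in>V. \<alpha> x \<in> universe L (var_sort L x))"

text \<open>The interpretations of the connectives are specified on the elements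
  \<open>truth L b\<close> only. The universe of the bool sort contains nothing else, since the two
  value constants are mapped onto it.\<close>

lemma eval_constraint:
  assumes "is_constraint \<phi>" and "val_on (vars \<phi>) \<alpha>"
  obtains b where "eval \<alpha> \<phi> = truth L b"
proof -
  have "eval \<alpha> \<phi> \<in> universe L (bool_sort L)"
    using assms eval_universe[of \<phi> "bool_sort L" \<alpha>] by (auto simp: is_constraint_def val_on_def)
  also have "\<dots> = (\<lambda>c. interp L c []) ` {true_sym L, false_sym L}"
    using bij_betw_imp_surj_on[OF values_bij[OF bool_sort]] bool_values by simp
  finally have "eval \<alpha> \<phi> = truth L True \<or> eval \<alpha> \<phi> = truth L False"
    by (auto simp: truth_def)
  then show thesis using that by blast
qed

lemma eval_Conj:
  assumes "is_constraint \<phi>" "is_constraint \<psi>" "val_on (vars \<phi> \<union> vars \<psi>) \<alpha>"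
  shows "eval \<alpha> (Conj \<phi> \<psi>) = truth L True \<longleftrightarrow> eval \<alpha> \<phi> = truth L True \<and> eval \<alpha> \<psi> = truth L True"
proof -
  from assms have "val_on (vars \<phi>) \<alpha>" "val_on (vars \<psi>) \<alpha>" by (simp_all add: val_on_def)
  with assms obtain a b where "eval \<alpha> \<phi> = truth L a" "eval \<alpha> \<psi> = truth L b"
    by (metis eval_constraint)
  then show ?thesis using and_sym(4)[of a b] truth_neq by (cases a; cases b) auto
qed

lemma eval_Neg:
  assumes "is_constraint \<phi>" "val_on (vars \<phi>) \<alpha>"
  shows "eval \<alpha> (Neg \<phi>) = truth L True \<longleftrightarrow> eval \<alpha> \<phi> \<noteq> truth L True"
proof -
  from assms obtain a where "eval \<alpha> \<phi> = truth L a" by (metis eval_constraint)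
  then show ?thesis using not_sym(4)[of a] truth_neq by (cases a) auto
qed

lemma is_constraint_Conj: "is_constraint \<phi> \<Longrightarrow> is_constraint \<psi> \<Longrightarrow> is_constraint (Conj \<phi> \<psi>)"
  unfolding is_constraint_def has_sort_Fun
  by (auto simp: and_sym all_syms_def less_Suc_eq)

lemma is_constraint_Neg: "is_constraint \<phi> \<Longrightarrow> is_constraint (Neg \<phi>)"
  unfolding is_constraint_def has_sort_Fun
  by (auto simp: not_sym all_syms_def)

lemma is_constraint_subst:
  assumes "is_constraint \<phi>" "\<And>x. x \<in> vars \<phi> \<Longrightarrow> \<exists>y. \<sigma> x = Var y \<and> var_sort L y = var_sort L x"
  shows "is_constraint (\<phi> \<cdot> \<sigma>)"
proof -
  have "has_sort (\<phi> \<cdot> \<sigma>) (bool_sort L)"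
  proof (rule has_sort_subst)
    show "has_sort \<phi> (bool_sort L)" using assms(1) by (simp add: is_constraint_def)
    show "has_sort (\<sigma> x) (var_sort L x)" if "x \<in> vars \<phi>" for x
      using assms(2)[OF that] by auto
  qed
  moreover have "funs (\<sigma> x) = {}" if "x \<in> vars \<phi>" for x
    using assms(2)[OF that] by auto
  ultimately show ?thesis
    using assms(1) by (simp add: is_constraint_def funs_subst)
qed

section \<open>Values, ground terms of theory sort, satisfiability\<close>

lemma value_sort: "c \<in> Val L \<Longrightarrow> res_sort L c \<in> theory_sorts L \<and> c \<in> sort_values L (res_sort L c) \<and>
    arg_sorts L c = [] \<and> c \<in> theory_syms L"
  using values_const by (auto simp: Val_def)

text \<open>Values are the only constructors with a theory result sort. Hence a ground constructor
  instance of a constraint variable is automatically a value, as respecting a constraint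
  demands.\<close>

lemma ground_theory_term:
  assumes "has_sort g \<iota>" "\<iota> \<in> theory_sorts L" "vars g = {}" "funs g \<subseteq> constructors L"
  obtains c where "c \<in> sort_values L \<iota>" "g = Fun c []"
proof (cases g)
  case (Var x)
  with assms show ?thesis by simp
next
  case (Fun c ts)
  with assms have c: "c \<in> constructors L" "res_sort L c = \<iota>" "length ts = length (arg_sorts L c)"
    by (simp_all add: has_sort_Fun)
  with constructor_res_sort assms(2) have "c \<in> Val L" by blast
  from value_sort[OF this] c have "c \<in> sort_values L \<iota>" "ts = []" by auto
  with Fun that show ?thesis by simp
qed

lemma ground_eval_universe:
  assumes "has_sort g \<iota>" "\<iota> \<in> theory_sorts L" "vars g = {}" "funs g \<subseteq> constructors L"
  shows "ground_eval g \<in> universe L \<iota>"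
proof -
  from assms obtain c where c: "c \<in> sort_values L \<iota>" "g = Fun c []" by (rule ground_theory_term)
  with values_bij[OF assms(2)] show ?thesis
    by (auto simp: ground_eval_def bij_betw_def)
qed

lemma ground_theory_term_eqI:
  assumes "has_sort g \<iota>" "\<iota> \<in> theory_sorts L" "vars g = {}" "funs g \<subseteq> constructors L"
    and "has_sort h \<iota>" "vars h = {}" "funs h \<subseteq> constructors L"
    and "ground_eval g = ground_eval h"
  shows "g = h"
proof -
  from assms obtain c d where cd: "c \<in> sort_values L \<iota>" "g = Fun c []" "d \<in> sort_values L \<iota>" "h = Fun d []"
    by (metis ground_theory_term)
  with assms(8) bij_betw_imp_inj_on[OF values_bij[OF assms(2)]] show ?thesis
    by (auto simp: ground_eval_def inj_on_def)
qed

lemma is_value_ground_term: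
  assumes "is_value g" "has_sort g \<iota>"
  shows "vars g = {}" "funs g \<subseteq> constructors L" "\<iota> \<in> theory_sorts L"
  using assms value_sort values_constructors
  by (auto simp: is_value_def has_sort_Fun)

lemma value_term_exists:
  assumes "\<iota> \<in> theory_sorts L" "u \<in> universe L \<iota>"
  obtains g where "is_value g" "has_sort g \<iota>" "ground_eval g = u"
proof -
  from bij_betw_imp_surj_on[OF values_bij[OF assms(1)]] assms(2)
  obtain c where c: "c \<in> sort_values L \<iota>" "interp L c [] = u" by (metis imageE)
  show thesis
  proof (rule that)
    show "is_value (Fun c [])" using c(1) assms(1) by (auto simp: is_value_def Val_def)
    show "has_sort (Fun c []) \<iota>"
      using values_const[OF assms(1) c(1)] by (simp add: has_sort_Fun all_syms_def)
    show "ground_eval (Fun c []) = u" using c(2) by (simp add: ground_eval_def)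
  qed
qed

text \<open>Every element of a universe is named by a value constant, so substitutions by values and
  valuations of the constraint variables are interchangeable.\<close>

lemma satisfiable_iff:
  assumes "is_constraint \<phi>"
  shows "satisfiable \<phi> \<longleftrightarrow> (\<exists>\<beta>. val_on (vars \<phi>) \<beta> \<and> eval \<beta> \<phi> = truth L True)"
proof
  assume "satisfiable \<phi>"
  then obtain \<gamma> where \<gamma>: "substitution \<gamma>" "respecting \<gamma> \<phi>" unfolding satisfiable_def by blast
  have "val_on (vars \<phi>) (\<lambda>x. ground_eval (\<gamma> x))"
    unfolding val_on_def
  proof
    fix x assume "x \<in> vars \<phi>"
    with \<gamma> have v: "is_value (\<gamma> x)" "has_sort (\<gamma> x) (var_sort L x)"
      by (auto simp: respecting_def substitution_def)
    from is_value_ground_term[OF this] v(2) show "ground_eval (\<gamma> x) \<in> universe L (var_sort L x)"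
      by (intro ground_eval_universe)
  qed
  with \<gamma>(2) show "\<exists>\<beta>. val_on (vars \<phi>) \<beta> \<and> eval \<beta> \<phi> = truth L True"
    by (auto simp: respecting_def ground_eval_subst)
next
  assume "\<exists>\<beta>. val_on (vars \<phi>) \<beta> \<and> eval \<beta> \<phi> = truth L True"
  then obtain \<beta> where \<beta>: "val_on (vars \<phi>) \<beta>" "eval \<beta> \<phi> = truth L True" by blast
  have "\<forall>x\<in>vars \<phi>. \<exists>g. is_value g \<and> has_sort g (var_sort L x) \<and> ground_eval g = \<beta> x"
    using \<beta>(1) constraint_vars[OF assms] unfolding val_on_def by (metis value_term_exists)
  then obtain h where h: "\<And>x. x \<in> vars \<phi> \<Longrightarrow> is_value (h x) \<and> has_sort (h x) (var_sort L x) \<and> ground_eval (h x) = \<beta> x"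
    by metis
  let ?\<gamma> = "\<lambda>x. if x \<in> vars \<phi> then h x else Var x"
  have "eval (\<lambda>x. ground_eval (?\<gamma> x)) \<phi> = eval \<beta> \<phi>"
    by (rule eval_cong) (simp add: h)
  then have "substitution ?\<gamma> \<and> respecting ?\<gamma> \<phi>"
    using h \<beta>(2) by (simp add: substitution_def respecting_def ground_eval_subst)
  then show "satisfiable \<phi>" unfolding satisfiable_def by blast
qed

definition gc_subst :: "'v set \<Rightarrow> ('f, 'v) sbst \<Rightarrow> bool" where
  "gc_subst V \<sigma> \<longleftrightarrow>
     (\<forall>x\<in>V. has_sort (\<sigma> x) (var_sort L x) \<and> funs (\<sigma> x) \<subseteq> constructors L \<and> vars (\<sigma> x) = {})"

definition solves :: "('f, 'v) trm \<Rightarrow> ('f, 'v) trm \<Rightarrow> ('f, 'v) sbst \<Rightarrow> ('v \<Rightarrow> 'u) \<Rightarrow> bool" where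
  "solves t \<psi> \<sigma> \<beta> \<longleftrightarrow> val_on (vars \<psi>) \<beta> \<and> (\<forall>x\<in>vars t \<inter> vars \<psi>. \<beta> x = ground_eval (\<sigma> x)) \<and>
     eval \<beta> \<psi> = truth L True"

text \<open>Splits a substitution respecting \<open>\<psi>\<close> into its part on the variables of \<open>t\<close> and a valuation of the
  constraint, so that no conditions on irrelevant variables remain.\<close>

lemma GC1_iff:
  assumes "is_constraint \<psi>"
  shows "g \<in> GC1 (t, \<psi>) \<longleftrightarrow> (\<exists>\<sigma> \<beta>. g = t \<cdot> \<sigma> \<and> gc_subst (vars t) \<sigma> \<and> solves t \<psi> \<sigma> \<beta>)"
proof
  assume "g \<in> GC1 (t, \<psi>)"
  then obtain \<sigma> where \<sigma>: "g = t \<cdot> \<sigma>" "C_substitution \<sigma>" "\<forall>x\<in>vars t. vars (\<sigma> x) = {}" "respecting \<sigma> \<psi>"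
    by (auto simp: GC1_def)
  have "val_on (vars \<psi>) (\<lambda>x. ground_eval (\<sigma> x))"
    unfolding val_on_def
  proof
    fix x assume "x \<in> vars \<psi>"
    with \<sigma> have v: "is_value (\<sigma> x)" "has_sort (\<sigma> x) (var_sort L x)"
      by (auto simp: respecting_def substitution_def C_substitution_def)
    from is_value_ground_term[OF this] v(2) show "ground_eval (\<sigma> x) \<in> universe L (var_sort L x)"
      by (intro ground_eval_universe)
  qed
  with \<sigma> have "gc_subst (vars t) \<sigma>" "solves t \<psi> \<sigma> (\<lambda>x. ground_eval (\<sigma> x))"
    by (simp_all add: gc_subst_def solves_def C_substitution_def substitution_def respecting_def
        ground_eval_subst)
  with \<sigma>(1) show "\<exists>\<sigma> \<beta>. g = t \<cdot> \<sigma> \<and> gc_subst (vars t) \<sigma> \<and> solves t \<psi> \<sigma> \<beta>" by blast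
next
  assume "\<exists>\<sigma> \<beta>. g = t \<cdot> \<sigma> \<and> gc_subst (vars t) \<sigma> \<and> solves t \<psi> \<sigma> \<beta>"
  then obtain \<sigma> \<beta> where g: "g = t \<cdot> \<sigma>" and \<sigma>: "gc_subst (vars t) \<sigma>" and \<beta>: "val_on (vars \<psi>) \<beta>"
    "\<And>x. x \<in> vars t \<Longrightarrow> x \<in> vars \<psi> \<Longrightarrow> \<beta> x = ground_eval (\<sigma> x)" "eval \<beta> \<psi> = truth L True"
    by (auto simp: solves_def)
  have "\<forall>x\<in>vars \<psi>. \<exists>g. is_value g \<and> has_sort g (var_sort L x) \<and> ground_eval g = \<beta> x"
    using \<beta>(1) constraint_vars[OF assms] unfolding val_on_def by (metis value_term_exists)
  then obtain h where h: "\<And>x. x \<in> vars \<psi> \<Longrightarrow> is_value (h x) \<and> has_sort (h x) (var_sort L x) \<and> ground_eval (h x) = \<beta> x"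
    by metis
  let ?\<gamma> = "\<lambda>x. if x \<in> vars \<psi> then h x else if x \<in> vars t then \<sigma> x else Var x"
  \<comment> \<open>On a shared variable the value naming \<open>\<beta> x\<close> is
    \<open>\<sigma> x\<close> itself, because ground constructor terms of theory sort are determined
    by their evaluation. Hence the patched substitution does not change
    \<open>t \<cdot> \<sigma>\<close>.\<close>
  have hs: "h x = \<sigma> x" if x: "x \<in> vars t" "x \<in> vars \<psi>" for x
  proof (rule ground_theory_term_eqI)
    show "ground_eval (h x) = ground_eval (\<sigma> x)" using h x \<beta>(2) by simp
    show "var_sort L x \<in> theory_sorts L" by (rule constraint_vars[OF assms x(2)])
    show "vars (h x) = {}" "funs (h x) \<subseteq> constructors L" "has_sort (h x) (var_sort L x)"
      using h[OF x(2)] is_value_ground_term[of "h x"] by blast+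
  qed (use x \<sigma> in \<open>simp_all add: gc_subst_def\<close>)
  then have eq: "?\<gamma> x = \<sigma> x" if "x \<in> vars t" for x using that by simp
  have "g = t \<cdot> ?\<gamma>" unfolding g by (rule subst_cong) (simp add: eq)
  moreover have "C_substitution ?\<gamma>"
  proof -
    have "has_sort (?\<gamma> x) (var_sort L x) \<and> funs (?\<gamma> x) \<subseteq> constructors L" for x
      using \<sigma> h[of x] is_value_ground_term[of "h x" "var_sort L x"] by (simp add: gc_subst_def)
    then show ?thesis unfolding C_substitution_def substitution_def by blast
  qed
  moreover have "\<forall>x\<in>vars t. vars (?\<gamma> x) = {}" using \<sigma> eq unfolding gc_subst_def by metis
  moreover have "respecting ?\<gamma> \<psi>"
  proof -
    have "eval (\<lambda>x. ground_eval (?\<gamma> x)) \<psi> = eval \<beta> \<psi>"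
      by (rule eval_cong) (simp add: h)
    then show ?thesis using h \<beta>(3) by (simp add: respecting_def ground_eval_subst)
  qed
  ultimately show "g \<in> GC1 (t, \<psi>)" unfolding GC1_def by blast
qed

section \<open>Equivalence of constrained terms\<close>

text \<open>\<open>holds_ex\<close> for the constraint variables outside \<open>t\<close>, in local
  form: \<alpha> matters only on the shared variables and the witness only on
  \<open>vars \<psi>\<close>.\<close>

definition holds :: "('f, 'v) trm \<Rightarrow> ('f, 'v) trm \<Rightarrow> ('v \<Rightarrow> 'u) \<Rightarrow> bool" where
  "holds t \<psi> \<alpha> \<longleftrightarrow> (\<exists>\<beta>. val_on (vars \<psi>) \<beta> \<and> (\<forall>x\<in>vars t \<inter> vars \<psi>. \<beta> x = \<alpha> x) \<and>
     eval \<beta> \<psi> = truth L True)"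

lemma holds_ex_iff:
  assumes "is_constraint \<psi>" "valuation \<alpha>"
  shows "holds_ex (vars \<psi> - vars t) \<psi> \<alpha> \<longleftrightarrow> holds t \<psi> \<alpha>"
proof
  assume "holds_ex (vars \<psi> - vars t) \<psi> \<alpha>"
  then show "holds t \<psi> \<alpha>"
    unfolding holds_ex_def holds_def val_on_def valuation_def
    using constraint_vars[OF assms(1)] by (metis DiffE IntE)
next
  assume "holds t \<psi> \<alpha>"
  then obtain \<beta> where \<beta>: "val_on (vars \<psi>) \<beta>" "\<And>x. x \<in> vars t \<Longrightarrow> x \<in> vars \<psi> \<Longrightarrow> \<beta> x = \<alpha> x"
    "eval \<beta> \<psi> = truth L True" unfolding holds_def by blast
  let ?\<beta> = "\<lambda>x. if x \<in> vars \<psi> then \<beta> x else \<alpha> x"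
  have "eval ?\<beta> \<psi> = eval \<beta> \<psi>" by (rule eval_cong) simp
  with \<beta> assms(2) have "valuation ?\<beta> \<and> (\<forall>x. x \<notin> vars \<psi> - vars t \<longrightarrow> ?\<beta> x = \<alpha> x) \<and> eval ?\<beta> \<psi> = truth L True"
    by (auto simp: valuation_def val_on_def)
  then show "holds_ex (vars \<psi> - vars t) \<psi> \<alpha>" unfolding holds_ex_def by blast
qed

lemma vars_rename: "vars (t \<cdot> (Var \<circ> \<delta>)) = \<delta> ` vars t"
  by (auto simp: vars_subst)

lemma renaming_inv: "renaming \<delta> \<Longrightarrow> renaming (inv \<delta>)"
  unfolding renaming_def by (metis bij_imp_bij_inv bij_inv_eq_iff)

lemma is_constraint_rename: "is_constraint \<psi> \<Longrightarrow> renaming \<delta> \<Longrightarrow> is_constraint (\<psi> \<cdot> (Var \<circ> \<delta>))"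
  by (rule is_constraint_subst) (auto simp: renaming_def)

lemma has_sort_rename: "has_sort t \<iota> \<Longrightarrow> renaming \<delta> \<Longrightarrow> has_sort (t \<cdot> (Var \<circ> \<delta>)) \<iota>"
  by (rule has_sort_subst) (auto simp: renaming_def)

lemma holds_rename:
  assumes \<delta>: "renaming \<delta>"
  shows "holds (t \<cdot> (Var \<circ> \<delta>)) (\<psi> \<cdot> (Var \<circ> \<delta>)) \<alpha> \<longleftrightarrow> holds t \<psi> (\<alpha> \<circ> \<delta>)"
proof -
  from \<delta> have inj: "inj \<delta>" and srt: "\<And>x. var_sort L (\<delta> x) = var_sort L x"
    by (auto simp: renaming_def bij_def)
  have ev: "eval \<beta> (\<psi> \<cdot> (Var \<circ> \<delta>)) = eval (\<beta> \<circ> \<delta>) \<psi>" for \<beta>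
    by (simp add: eval_subst o_def)
  have vars: "vars (t \<cdot> (Var \<circ> \<delta>)) \<inter> vars (\<psi> \<cdot> (Var \<circ> \<delta>)) = \<delta> ` (vars t \<inter> vars \<psi>)"
    by (simp add: vars_rename image_Int[OF inj])
  have val: "val_on (vars (\<psi> \<cdot> (Var \<circ> \<delta>))) \<beta> \<longleftrightarrow> val_on (vars \<psi>) (\<beta> \<circ> \<delta>)" for \<beta>
    by (simp add: val_on_def vars_rename srt)
  show ?thesis
  proof
    assume "holds t \<psi> (\<alpha> \<circ> \<delta>)"
    then obtain \<beta> where \<beta>: "val_on (vars \<psi>) \<beta>" "\<forall>x\<in>vars t \<inter> vars \<psi>. \<beta> x = \<alpha> (\<delta> x)"
      "eval \<beta> \<psi> = truth L True" unfolding holds_def by auto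
    have "\<beta> \<circ> inv \<delta> \<circ> \<delta> = \<beta>" using inj by (auto simp: fun_eq_iff)
    with \<beta> show "holds (t \<cdot> (Var \<circ> \<delta>)) (\<psi> \<cdot> (Var \<circ> \<delta>)) \<alpha>"
      unfolding holds_def ev vars val using inj by (intro exI[of _ "\<beta> \<circ> inv \<delta>"]) auto
  qed (auto simp: holds_def ev vars val)
qed

text \<open>The working form of \<open>doteq\<close>: instead of renaming the second constraint, the
  valuation is pulled back along \<delta>, which \<open>holds_rename\<close> justifies.\<close>

lemma doteq_iff:
  "((t, \<psi>), (t', \<psi>')) \<in> doteq \<longleftrightarrow> (t, \<psi>) \<in> cterms \<and> (t', \<psi>') \<in> cterms \<and>
     (\<exists>\<delta>. renaming \<delta> \<and> t = t' \<cdot> (Var \<circ> \<delta>) \<and> vars t \<inter> vars \<psi> = \<delta> ` (vars t' \<inter> vars \<psi>') \<and>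
        (\<forall>\<alpha>. valuation \<alpha> \<longrightarrow> holds t \<psi> \<alpha> = holds t' \<psi>' (\<alpha> \<circ> \<delta>)))"
proof -
  have *: "(vars t \<inter> vars \<psi> = vars (t' \<cdot> (Var \<circ> \<delta>)) \<inter> vars (\<psi>' \<cdot> (Var \<circ> \<delta>)) \<and>
        (\<forall>\<alpha>. valuation \<alpha> \<longrightarrow>
           holds_ex (vars \<psi> - vars t) \<psi> \<alpha> =
           holds_ex (vars (\<psi>' \<cdot> (Var \<circ> \<delta>)) - vars (t' \<cdot> (Var \<circ> \<delta>))) (\<psi>' \<cdot> (Var \<circ> \<delta>)) \<alpha>)) \<longleftrightarrow>
     (vars t \<inter> vars \<psi> = \<delta> ` (vars t' \<inter> vars \<psi>') \<and>
        (\<forall>\<alpha>. valuation \<alpha> \<longrightarrow> holds t \<psi> \<alpha> = holds t' \<psi>' (\<alpha> \<circ> \<delta>)))" (is "?A \<delta> \<longleftrightarrow> ?B \<delta>")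
    if c: "is_constraint \<psi>" "is_constraint \<psi>'" and \<delta>: "renaming \<delta>" for \<delta>
  proof -
    have "inj \<delta>" using \<delta> by (auto simp: renaming_def bij_def)
    moreover have "holds_ex (vars (\<psi>' \<cdot> (Var \<circ> \<delta>)) - vars (t' \<cdot> (Var \<circ> \<delta>))) (\<psi>' \<cdot> (Var \<circ> \<delta>)) \<alpha>
        = holds t' \<psi>' (\<alpha> \<circ> \<delta>)" if "valuation \<alpha>" for \<alpha>
      unfolding holds_ex_iff[OF is_constraint_rename[OF c(2) \<delta>] that] by (rule holds_rename[OF \<delta>])
    ultimately show ?thesis
      using holds_ex_iff[OF c(1)] by (simp add: vars_rename image_Int)
  qed
  show ?thesis
    unfolding doteq_def mem_Collect_eq prod.case
  proof (intro conj_cong[OF refl] ex_cong1)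
    fix \<delta> assume "(t, \<psi>) \<in> cterms" "(t', \<psi>') \<in> cterms" "renaming \<delta>"
    then show "?A \<delta> \<longleftrightarrow> ?B \<delta>" by (intro *) (simp_all add: cterms_def)
  qed
qed

text \<open>\<open>doteq\<close> compares constraints under global valuations, while a ground
  instance supplies values for a few variables only; nonempty universes fill in the rest.\<close>

lemma valuation_extension:
  assumes "val_on V \<beta>"
  obtains \<alpha> where "valuation \<alpha>" "\<And>x. x \<in> V \<Longrightarrow> \<alpha> x = \<beta> x"
proof
  let ?\<alpha> = "\<lambda>x. if x \<in> V then \<beta> x else SOME u. u \<in> universe L (var_sort L x)"
  show "valuation ?\<alpha>"
    using assms universe_nonempty by (auto simp: valuation_def val_on_def some_in_eq)
  show "?\<alpha> x = \<beta> x" if "x \<in> V" for x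
    using that by simp
qed

lemma valuation_rename: "valuation \<alpha> \<Longrightarrow> renaming \<delta> \<Longrightarrow> valuation (\<alpha> \<circ> \<delta>)"
  unfolding valuation_def renaming_def o_def by metis

lemma doteq_refl:
  assumes "c \<in> cterms" shows "(c, c) \<in> doteq"
proof (cases c)
  case (Pair t \<psi>)
  have "t \<cdot> (Var \<circ> id) = t" by (rule subst_ident) simp
  with assms show ?thesis
    unfolding Pair doteq_iff by (auto simp: renaming_def intro!: exI[of _ id])
qed

lemma doteq_sym:
  assumes "(c, d) \<in> doteq" shows "(d, c) \<in> doteq"
proof (cases c; cases d)
  fix t \<psi> t' \<psi>' assume cd: "c = (t, \<psi>)" "d = (t', \<psi>')"
  from assms[unfolded cd doteq_iff] obtain \<delta> where ct: "(t, \<psi>) \<in> cterms" "(t', \<psi>') \<in> cterms"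
    and \<delta>: "renaming \<delta>" and t: "t = t' \<cdot> (Var \<circ> \<delta>)" and v: "vars t \<inter> vars \<psi> = \<delta> ` (vars t' \<inter> vars \<psi>')"
    and h: "\<And>\<alpha>. valuation \<alpha> \<Longrightarrow> holds t \<psi> \<alpha> = holds t' \<psi>' (\<alpha> \<circ> \<delta>)" by blast
  from \<delta> have b: "bij \<delta>" by (simp add: renaming_def)
  then have inv1: "inv \<delta> (\<delta> x) = x" for x by (simp add: bij_is_inj)
  have t': "t' = t \<cdot> (Var \<circ> inv \<delta>)"
    unfolding t subst_subst by (rule sym, rule subst_ident) (simp add: inv1)
  have v': "vars t' \<inter> vars \<psi>' = inv \<delta> ` (vars t \<inter> vars \<psi>)"
    unfolding v image_image by (simp add: inv1)
  have h': "holds t' \<psi>' \<alpha> = holds t \<psi> (\<alpha> \<circ> inv \<delta>)" if "valuation \<alpha>" for \<alpha>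
  proof -
    have "\<alpha> \<circ> inv \<delta> \<circ> \<delta> = \<alpha>" by (simp add: fun_eq_iff inv1)
    with h[OF valuation_rename[OF that renaming_inv[OF \<delta>]]] show ?thesis by simp
  qed
  show ?thesis
    unfolding cd doteq_iff using ct renaming_inv[OF \<delta>] t' v' h' by blast
qed

lemma doteq_trans:
  assumes "(c, d) \<in> doteq" "(d, e) \<in> doteq" shows "(c, e) \<in> doteq"
proof (cases c; cases d; cases e)
  fix t \<psi> t' \<psi>' t'' \<psi>'' assume cd: "c = (t, \<psi>)" "d = (t', \<psi>')" "e = (t'', \<psi>'')"
  from assms(1)[unfolded cd doteq_iff] obtain \<delta> where ct: "(t, \<psi>) \<in> cterms"
    and \<delta>: "renaming \<delta>" "t = t' \<cdot> (Var \<circ> \<delta>)" "vars t \<inter> vars \<psi> = \<delta> ` (vars t' \<inter> vars \<psi>')"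
    "\<And>\<alpha>. valuation \<alpha> \<Longrightarrow> holds t \<psi> \<alpha> = holds t' \<psi>' (\<alpha> \<circ> \<delta>)" by blast
  from assms(2)[unfolded cd doteq_iff] obtain \<epsilon> where ct': "(t'', \<psi>'') \<in> cterms"
    and \<epsilon>: "renaming \<epsilon>" "t' = t'' \<cdot> (Var \<circ> \<epsilon>)" "vars t' \<inter> vars \<psi>' = \<epsilon> ` (vars t'' \<inter> vars \<psi>'')"
    "\<And>\<alpha>. valuation \<alpha> \<Longrightarrow> holds t' \<psi>' \<alpha> = holds t'' \<psi>'' (\<alpha> \<circ> \<epsilon>)" by blast
  have "renaming (\<delta> \<circ> \<epsilon>)" using \<delta>(1) \<epsilon>(1) by (auto simp: renaming_def bij_comp)
  moreover have "t = t'' \<cdot> (Var \<circ> (\<delta> \<circ> \<epsilon>))"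
    unfolding \<delta>(2) \<epsilon>(2) subst_subst by (rule subst_cong) simp
  moreover have "vars t \<inter> vars \<psi> = (\<delta> \<circ> \<epsilon>) ` (vars t'' \<inter> vars \<psi>'')"
    unfolding \<delta>(3) \<epsilon>(3) by (simp add: image_comp)
  moreover have "holds t \<psi> \<alpha> = holds t'' \<psi>'' (\<alpha> \<circ> (\<delta> \<circ> \<epsilon>))" if "valuation \<alpha>" for \<alpha>
    using \<delta>(4)[OF that] \<epsilon>(4)[OF valuation_rename[OF that \<delta>(1)]] by (simp add: comp_assoc)
  ultimately show ?thesis
    unfolding cd doteq_iff using ct ct' by blast
qed

lemma doteq_cterms: "(c, d) \<in> doteq \<Longrightarrow> c \<in> cterms \<and> d \<in> cterms"
  by (cases c; cases d) (simp add: doteq_iff)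

lemma equiv_doteq: "equiv cterms doteq"
proof (rule equivI)
  show "doteq \<subseteq> cterms \<times> cterms" using doteq_cterms by fast
  show "refl_on cterms doteq" by (rule refl_onI) (rule doteq_refl)
  show "sym doteq" by (rule symI) (rule doteq_sym)
  show "trans doteq" by (rule transI) (rule doteq_trans)
qed

text \<open>Since t is t' renamed by \<delta>, an instance of t under \<sigma> is the instance of t'
  under \<open>\<sigma> \<circ> \<delta>\<close>. The values of the quantified variables of \<psi>'
  are not transported but obtained anew from the equivalence of the two formulas.\<close>

lemma GC1_doteq_subset:
  assumes "(c, d) \<in> doteq" shows "GC1 c \<subseteq> GC1 d"
proof (cases c; cases d)
  fix t \<psi> t' \<psi>' assume cd: "c = (t, \<psi>)" "d = (t', \<psi>')"
  from assms[unfolded cd doteq_iff] obtain \<delta> where ct: "(t, \<psi>) \<in> cterms" "(t', \<psi>') \<in> cterms"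
    and \<delta>: "renaming \<delta>" and t: "t = t' \<cdot> (Var \<circ> \<delta>)" and v: "vars t \<inter> vars \<psi> = \<delta> ` (vars t' \<inter> vars \<psi>')"
    and h: "\<And>\<alpha>. valuation \<alpha> \<Longrightarrow> holds t \<psi> \<alpha> = holds t' \<psi>' (\<alpha> \<circ> \<delta>)" by blast
  from ct have con: "is_constraint \<psi>" "is_constraint \<psi>'" by (simp_all add: cterms_def)
  have "g \<in> GC1 (t', \<psi>')" if "g \<in> GC1 (t, \<psi>)" for g
  proof -
    from that obtain \<sigma> \<beta> where g: "g = t \<cdot> \<sigma>" and \<sigma>: "gc_subst (vars t) \<sigma>" and \<beta>: "solves t \<psi> \<sigma> \<beta>"
      unfolding GC1_iff[OF con(1)] by blast
    from \<beta> have "val_on (vars \<psi>) \<beta>" by (simp add: solves_def)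
    then obtain \<alpha> where \<alpha>: "valuation \<alpha>" "\<And>x. x \<in> vars \<psi> \<Longrightarrow> \<alpha> x = \<beta> x"
      by (rule valuation_extension) blast
    have "holds t \<psi> \<alpha>" using \<beta> \<alpha>(2) by (auto simp: solves_def holds_def intro!: exI[of _ \<beta>])
    with h[OF \<alpha>(1)] obtain \<beta>' where \<beta>': "val_on (vars \<psi>') \<beta>'"
      "\<And>x. x \<in> vars t' \<inter> vars \<psi>' \<Longrightarrow> \<beta>' x = \<alpha> (\<delta> x)" "eval \<beta>' \<psi>' = truth L True"
      unfolding holds_def by auto
    have "g = t' \<cdot> (\<sigma> \<circ> \<delta>)" unfolding g t subst_subst by (rule subst_cong) simp
    moreover have "gc_subst (vars t') (\<sigma> \<circ> \<delta>)"
      using \<sigma> \<delta> unfolding t vars_rename by (auto simp: gc_subst_def renaming_def)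
    moreover have "\<beta>' x = ground_eval (\<sigma> (\<delta> x))" if x: "x \<in> vars t' \<inter> vars \<psi>'" for x
    proof -
      from x have \<delta>x: "\<delta> x \<in> vars t \<inter> vars \<psi>" unfolding v by (rule imageI)
      then have "\<alpha> (\<delta> x) = \<beta> (\<delta> x)" using \<alpha>(2) by simp
      also have "\<dots> = ground_eval (\<sigma> (\<delta> x))" using \<delta>x \<beta> by (simp add: solves_def)
      finally show ?thesis using \<beta>'(2)[OF x] by simp
    qed
    ultimately show ?thesis
      unfolding GC1_iff[OF con(2)] using \<beta>'(1,3)
      by (intro exI[of _ "\<sigma> \<circ> \<delta>"] exI[of _ \<beta>']) (simp add: solves_def)
  qed
  then show ?thesis unfolding cd by blast
qed

section \<open>Ground instances and pattern properties of equivalence classes\<close>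

lemma GC1_doteq: "(c, d) \<in> doteq \<Longrightarrow> GC1 c = GC1 d"
  using GC1_doteq_subset doteq_sym by blast

text \<open>All representatives have the same ground instances, so any one of them computes
  \<open>GC\<close> of the class.\<close>

lemma GC_class:
  assumes "p \<in> cterms // doteq" "c \<in> p"
  shows "GC {p} = GC1 c"
proof -
  have "GC1 d = GC1 c" if "d \<in> p" for d
  proof (rule GC1_doteq, rule in_quotient_imp_in_rel[OF equiv_doteq assms(1)])
    show "{d, c} \<subseteq> p" using assms(2) that by blast
  qed
  then have "(\<Union>d\<in>p. GC1 d) = (\<Union>d\<in>p. GC1 c)" by (rule SUP_cong[OF refl])
  also have "\<dots> = GC1 c" by (rule SUP_const) (use assms(2) in blast)
  finally show ?thesis by (simp add: GC_def)
qed

lemma GC_doteq_class: "c \<in> cterms \<Longrightarrow> GC {doteq `` {c}} = GC1 c"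
  by (rule GC_class[OF quotientI equiv_class_self[OF equiv_doteq]])

lemma GC_Union: "GC P = (\<Union>p\<in>P. GC {p})"
  by (simp add: GC_def)

lemma GC_quotient: "A \<subseteq> cterms \<Longrightarrow> GC (A // doteq) = (\<Union>c\<in>A. GC1 c)"
proof (subst GC_Union)
  assume A: "A \<subseteq> cterms"
  have "(\<Union>p\<in>A // doteq. GC {p}) = (\<Union>c\<in>A. GC {doteq `` {c}})"
    by (simp add: quotient_def)
  also have "\<dots> = (\<Union>c\<in>A. GC1 c)"
    by (rule SUP_cong[OF refl]) (use A GC_doteq_class in blast)
  finally show "(\<Union>p\<in>A // doteq. GC {p}) = (\<Union>c\<in>A. GC1 c)" .
qed

lemma is_pattern_subst:
  assumes "is_pattern t" "\<And>x. x \<in> vars t \<Longrightarrow> has_sort (\<sigma> x) (var_sort L x)"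
    "\<And>x. x \<in> vars t \<Longrightarrow> funs (\<sigma> x) \<subseteq> constructors L"
  shows "is_pattern (t \<cdot> \<sigma>)"
proof -
  from assms(1) obtain \<iota> f ts where t: "has_sort t \<iota>" "t = Fun f ts" "f \<in> defined_syms L"
    "\<forall>u\<in>set ts. funs u \<subseteq> constructors L" unfolding is_pattern_def by blast
  have "has_sort (t \<cdot> \<sigma>) \<iota>" by (rule has_sort_subst[OF t(1) assms(2)])
  moreover have "funs (u \<cdot> \<sigma>) \<subseteq> constructors L" if u: "u \<in> set ts" for u
    using t(4) u assms(3) unfolding funs_subst t(2) by fastforce
  ultimately show ?thesis using t(2,3) unfolding is_pattern_def by auto
qed

text \<open>The predicate speaks about all representatives, but their terms are injective variable
  renamings of each other, which preserves the pattern shape, linearity and the symbols.\<close>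

lemma lin_vf_cpattern_class:
  assumes ct: "(t, \<psi>) \<in> cterms" and t: "is_pattern t" "linear_trm t" "value_free t"
  shows "lin_vf_cpattern (doteq `` {(t, \<psi>)})"
proof -
  have "is_pattern t' \<and> linear_trm t' \<and> value_free t'" if "((t, \<psi>), (t', \<psi>')) \<in> doteq" for t' \<psi>'
  proof -
    from doteq_sym[OF that] obtain \<delta> where \<delta>: "renaming \<delta>" and t': "t' = t \<cdot> (Var \<circ> \<delta>)"
      unfolding doteq_iff by blast
    from \<delta> have "inj \<delta>" by (auto simp: renaming_def bij_def)
    then have "linear_trm t'" unfolding t' by (intro linear_subst t) (auto simp: inj_eq)
    moreover have "is_pattern t'"
      unfolding t' by (rule is_pattern_subst[OF t(1)]) (use \<delta> in \<open>auto simp: renaming_def\<close>)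
    moreover have "funs t' = funs t" unfolding t' by (simp add: funs_subst)
    ultimately show ?thesis using t(3) by (simp add: value_free_def)
  qed
  then show ?thesis
    unfolding lin_vf_cpattern_def using quotientI[OF ct] by auto
qed

section \<open>Eliminating the implicitly quantified variables\<close>

lemma holds_closed:
  assumes "is_constraint \<psi>" "vars \<psi> \<subseteq> vars t" "valuation \<alpha>"
  shows "holds t \<psi> \<alpha> \<longleftrightarrow> eval \<alpha> \<psi> = truth L True"
proof
  assume "holds t \<psi> \<alpha>"
  then obtain \<beta> where \<beta>: "\<forall>x\<in>vars t \<inter> vars \<psi>. \<beta> x = \<alpha> x" "eval \<beta> \<psi> = truth L True"
    unfolding holds_def by blast
  have "eval \<alpha> \<psi> = eval \<beta> \<psi>" by (rule eval_cong) (use \<beta>(1) assms(2) in auto)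
  with \<beta>(2) show "eval \<alpha> \<psi> = truth L True" by simp
next
  assume "eval \<alpha> \<psi> = truth L True"
  moreover have "val_on (vars \<psi>) \<alpha>"
    using assms(3) constraint_vars[OF assms(1)] by (auto simp: valuation_def val_on_def)
  ultimately show "holds t \<psi> \<alpha>" unfolding holds_def by blast
qed

text \<open>\<open>\<chi>\<close> is a quantifier-free equivalent of \<open>\<psi>\<close> with its variables outside \<open>t\<close> existentially
  quantified. Only some constrained terms have one, namely those with a closed representative.\<close>

definition closure_of :: "('f, 'v) trm \<Rightarrow> ('f, 'v) trm \<Rightarrow> ('f, 'v) trm \<Rightarrow> bool" where
  "closure_of t \<psi> \<chi> \<longleftrightarrow> is_constraint \<chi> \<and> vars \<chi> = vars t \<inter> vars \<psi> \<and>
     (\<forall>\<alpha>. valuation \<alpha> \<longrightarrow> holds t \<psi> \<alpha> = (eval \<alpha> \<chi> = truth L True))"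

text \<open>Replacing \<psi> by its closure gives an equivalent pair. Equivalence also compares the
  variables shared with the term, which is why \<open>closure_of\<close> prescribes the variables of
  \<chi> exactly.\<close>

lemma has_closed_rep_class:
  assumes ct: "(t, \<psi>) \<in> cterms" and cl: "closure_of t \<psi> \<chi>"
  shows "has_closed_rep (doteq `` {(t, \<psi>)})"
proof -
  from ct cl have ct': "(t, \<chi>) \<in> cterms" by (auto simp: cterms_def closure_of_def)
  have "t = t \<cdot> (Var \<circ> id)" by (rule sym, rule subst_ident) simp
  moreover have "holds t \<psi> \<alpha> = holds t \<chi> (\<alpha> \<circ> id)" if "valuation \<alpha>" for \<alpha>
    using cl that holds_closed[of \<chi> t \<alpha>] by (auto simp: closure_of_def)
  moreover have "renaming id" by (simp add: renaming_def)
  moreover have "vars t \<inter> vars \<psi> = id ` (vars t \<inter> vars \<chi>)"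
    using cl by (auto simp: closure_of_def)
  ultimately have "((t, \<psi>), (t, \<chi>)) \<in> doteq" unfolding doteq_iff using ct ct' by blast
  moreover have "vars \<chi> \<subseteq> vars t" using cl by (simp add: closure_of_def)
  ultimately show ?thesis unfolding has_closed_rep_def by auto
qed

text \<open>The constraint of a closed representative, renamed to the variables of the given one, is
  the desired quantifier-free equivalent.\<close>

lemma closure_exists:
  assumes "p \<in> cterms // doteq" "has_closed_rep p" "(s, \<phi>) \<in> p"
  shows "\<exists>\<chi>. closure_of s \<phi> \<chi>"
proof -
  from assms(2) obtain t \<psi> where t: "(t, \<psi>) \<in> p" "vars \<psi> \<subseteq> vars t"
    unfolding has_closed_rep_def by blast
  have "((s, \<phi>), (t, \<psi>)) \<in> doteq"
    by (rule in_quotient_imp_in_rel[OF equiv_doteq assms(1)]) (use assms(3) t in simp)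
  then obtain \<delta> where ct: "(t, \<psi>) \<in> cterms" and \<delta>: "renaming \<delta>"
    and v: "vars s \<inter> vars \<phi> = \<delta> ` (vars t \<inter> vars \<psi>)"
    and h: "\<And>\<alpha>. valuation \<alpha> \<Longrightarrow> holds s \<phi> \<alpha> = holds t \<psi> (\<alpha> \<circ> \<delta>)"
    unfolding doteq_iff by blast
  from ct have con: "is_constraint \<psi>" by (simp add: cterms_def)
  have "closure_of s \<phi> (\<psi> \<cdot> (Var \<circ> \<delta>))"
    unfolding closure_of_def
  proof (intro conjI allI impI)
    show "is_constraint (\<psi> \<cdot> (Var \<circ> \<delta>))" by (rule is_constraint_rename[OF con \<delta>])
    show "vars (\<psi> \<cdot> (Var \<circ> \<delta>)) = vars s \<inter> vars \<phi>"
      unfolding v vars_rename using t(2) by (simp add: Int_absorb1)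
    fix \<alpha> assume \<alpha>: "valuation \<alpha>"
    show "holds s \<phi> \<alpha> = (eval \<alpha> (\<psi> \<cdot> (Var \<circ> \<delta>)) = truth L True)"
      unfolding h[OF \<alpha>] holds_closed[OF con t(2) valuation_rename[OF \<alpha> \<delta>]]
      by (simp add: eval_subst o_def)
  qed
  then show ?thesis by blast
qed

lemma valuation_universe: "valuation \<alpha> \<Longrightarrow> is_constraint \<chi> \<Longrightarrow> val_on (vars \<chi>) \<alpha>"
  using constraint_vars unfolding valuation_def val_on_def by blast

text \<open>As \<open>B\<close> mentions variables of \<open>r\<close> only, it can be moved out of
  the existential quantifier over the remaining variables of \<open>A\<close>.\<close>

lemma closure_Conj:
  assumes A: "is_constraint A" and cl: "closure_of r A \<chi>" and B: "is_constraint B" "vars B \<subseteq> vars r"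
  shows "closure_of r (Conj A B) (Conj \<chi> B)"
proof -
  from cl have \<chi>: "is_constraint \<chi>" "vars \<chi> = vars r \<inter> vars A"
    and h: "\<And>\<alpha>. valuation \<alpha> \<Longrightarrow> holds r A \<alpha> = (eval \<alpha> \<chi> = truth L True)"
    unfolding closure_of_def by blast+
  have holds: "holds r (Conj A B) \<alpha> \<longleftrightarrow> holds r A \<alpha> \<and> eval \<alpha> B = truth L True" if \<alpha>: "valuation \<alpha>" for \<alpha>
  proof
    assume "holds r (Conj A B) \<alpha>"
    then obtain \<beta> where "val_on (vars (Conj A B)) \<beta>" "\<forall>x\<in>vars r \<inter> vars (Conj A B). \<beta> x = \<alpha> x"
      "eval \<beta> (Conj A B) = truth L True" unfolding holds_def by (elim exE conjE)
    then have \<beta>: "val_on (vars A \<union> vars B) \<beta>" "\<forall>x\<in>vars r \<inter> (vars A \<union> vars B). \<beta> x = \<alpha> x"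
      "eval \<beta> A = truth L True" "eval \<beta> B = truth L True" using eval_Conj[OF A B(1), of \<beta>] by simp_all
    have "eval \<alpha> B = eval \<beta> B" by (rule eval_cong) (use \<beta>(2) B(2) in auto)
    moreover have "holds r A \<alpha>" using \<beta> unfolding holds_def val_on_def by blast
    ultimately show "holds r A \<alpha> \<and> eval \<alpha> B = truth L True" using \<beta>(4) by simp
  next
    assume hA: "holds r A \<alpha> \<and> eval \<alpha> B = truth L True"
    then obtain \<beta> where \<beta>: "val_on (vars A) \<beta>" "\<forall>x\<in>vars r \<inter> vars A. \<beta> x = \<alpha> x"
      "eval \<beta> A = truth L True" unfolding holds_def by blast
    \<comment> \<open>Common variables of \<open>A\<close> and \<open>B\<close> are variables of
      \<open>r\<close>, where \<alpha> and \<beta> agree, so the merge changes neither truth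
      value.\<close>
    let ?\<beta> = "\<lambda>y. if y \<in> vars B then \<alpha> y else \<beta> y"
    have "eval ?\<beta> A = eval \<beta> A" by (rule eval_cong) (use \<beta>(2) B(2) in auto)
    moreover have "eval ?\<beta> B = eval \<alpha> B" by (rule eval_cong) simp
    moreover have val: "val_on (vars A \<union> vars B) ?\<beta>"
      using \<beta>(1) valuation_universe[OF \<alpha> B(1)] unfolding val_on_def by auto
    ultimately have "eval ?\<beta> (Conj A B) = truth L True"
      using eval_Conj[OF A B(1) val] hA \<beta>(3) by simp
    moreover have "val_on (vars (Conj A B)) ?\<beta>" using val by simp
    moreover have "\<forall>x\<in>vars r \<inter> vars (Conj A B). ?\<beta> x = \<alpha> x" using \<beta>(2) by auto
    ultimately show "holds r (Conj A B) \<alpha>" unfolding holds_def by blast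
  qed
  show ?thesis
    unfolding closure_of_def
  proof (intro conjI allI impI)
    show "is_constraint (Conj \<chi> B)" by (rule is_constraint_Conj[OF \<chi>(1) B(1)])
    show "vars (Conj \<chi> B) = vars r \<inter> vars (Conj A B)" using \<chi>(2) B(2) by auto
    fix \<alpha> assume \<alpha>: "valuation \<alpha>"
    have "val_on (vars \<chi> \<union> vars B) \<alpha>"
      using valuation_universe[OF \<alpha> \<chi>(1)] valuation_universe[OF \<alpha> B(1)] unfolding val_on_def by blast
    from eval_Conj[OF \<chi>(1) B(1) this]
    show "holds r (Conj A B) \<alpha> = (eval \<alpha> (Conj \<chi> B) = truth L True)"
      unfolding holds[OF \<alpha>] h[OF \<alpha>] by (simp only:)
  qed
qed

lemma GC1_instance: "is_constraint \<chi> \<Longrightarrow> g \<in> GC1 (u, \<chi>) \<Longrightarrow> \<exists>\<delta>. g = u \<cdot> \<delta>"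
  by (simp only: GC1_iff) blast

section \<open>Renamings and fresh variables\<close>

text \<open>\<open>renaming\<close> demands a bijection of all variables; a finite sort-preserving
  injection is extended to one by composing transpositions.\<close>

lemma renaming_extension:
  assumes "finite A" "inj_on f A" "\<And>x. x \<in> A \<Longrightarrow> var_sort L (f x) = var_sort L x"
  obtains \<delta> where "renaming \<delta>" "\<And>x. x \<in> A \<Longrightarrow> \<delta> x = f x"
proof -
  from assms have "\<exists>\<delta>. renaming \<delta> \<and> (\<forall>x\<in>A. \<delta> x = f x)"
  proof (induction A)
    case empty
    have "renaming id" by (simp add: renaming_def)
    then show ?case by blast
  next
    case (insert a A)
    then obtain \<delta> where \<delta>: "renaming \<delta>" "\<And>x. x \<in> A \<Longrightarrow> \<delta> x = f x" by auto
    \<comment> \<open>Exchanging \<open>\<delta> a\<close> and \<open>f a\<close> sends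
      \<open>a\<close> to its target. For \<open>x\<close> in \<open>A\<close>, the image
      \<open>\<delta> x = f x\<close> differs from both, by injectivity of \<delta> and of
      \<open>f\<close>, and so stays put. Sorts are kept since both exchanged variables have the
      sort of \<open>a\<close>.\<close>
    let ?\<tau> = "\<lambda>y. if y = \<delta> a then f a else if y = f a then \<delta> a else y"
    have "?\<tau> \<circ> ?\<tau> = id" by (auto simp: fun_eq_iff)
    then have b\<tau>: "bij ?\<tau>" by (rule o_bij) fact
    have b: "bij \<delta>" using \<delta>(1) by (simp add: renaming_def)
    have s: "var_sort L (\<delta> a) = var_sort L (f a)"
      using \<delta>(1) insert.prems(2) by (simp add: renaming_def)
    have "var_sort L (?\<tau> y) = var_sort L y" for y
      using s by simp
    then have "renaming (?\<tau> \<circ> \<delta>)"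
      using \<delta>(1) bij_comp[OF b b\<tau>] by (simp add: renaming_def)
    moreover have "(?\<tau> \<circ> \<delta>) x = f x" if x: "x \<in> insert a A" for x
    proof (cases "x = a")
      case False
      with x have xA: "x \<in> A" by simp
      have "\<delta> x \<noteq> \<delta> a" using bij_is_inj[OF b] False by (simp add: inj_eq)
      moreover have "f x \<noteq> f a" using insert.prems(1) insert.hyps(2) xA False by (auto simp: inj_on_def)
      ultimately show ?thesis using \<delta>(2)[OF xA] by simp
    qed simp
    ultimately show ?case by blast
  qed
  then show thesis using that by blast
qed

lemma fresh_var:
  assumes "\<iota> \<in> all_sorts L" "finite Y"
  obtains x where "var_sort L x = \<iota>" "x \<notin> Y"
  using infinite_super[of "{x. var_sort L x = \<iota>}" Y] vars_infinite[OF assms(1)] assms(2) by blast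

lemma fresh_vars:
  assumes "set ss \<subseteq> all_sorts L" "finite Y"
  shows "\<exists>xs. map (var_sort L) xs = ss \<and> distinct xs \<and> set xs \<inter> Y = {}"
  using assms(1)
proof (induction ss)
  case (Cons \<iota> ss)
  then obtain xs where xs: "map (var_sort L) xs = ss" "distinct xs" "set xs \<inter> Y = {}" by auto
  obtain x where "var_sort L x = \<iota>" "x \<notin> Y \<union> set xs"
    by (rule fresh_var[of \<iota> "Y \<union> set xs"]) (use Cons.prems assms(2) in auto)
  with xs show ?case by (intro exI[of _ "x # xs"]) auto
qed simp

text \<open>Supplies the variable-disjoint variant that \<open>diff_two\<close> requires.\<close>

lemma fresh_renaming:
  assumes "finite A" "finite Y"
  obtains \<delta> where "renaming \<delta>" "\<delta> ` A \<inter> Y = {}"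
proof -
  from assms(1) have "\<exists>f. inj_on f A \<and> (\<forall>x\<in>A. var_sort L (f x) = var_sort L x) \<and> f ` A \<inter> Y = {}"
  proof (induction A)
    case (insert a A)
    then obtain f where f: "inj_on f A" "\<And>x. x \<in> A \<Longrightarrow> var_sort L (f x) = var_sort L x" "f ` A \<inter> Y = {}"
      by blast
    obtain z where z: "var_sort L z = var_sort L a" "z \<notin> Y \<union> f ` A"
      by (rule fresh_var[of "var_sort L a" "Y \<union> f ` A"]) (use vars_sorts assms(2) insert.hyps(1) in auto)
    let ?f = "f(a := z)"
    have im: "?f ` A = f ` A" using insert.hyps(2) by auto
    have "inj_on ?f (insert a A)"
      using f(1) z(2) insert.hyps(2) by (auto simp: inj_on_def)
    moreover have "?f ` insert a A \<inter> Y = {}" using f(3) z(2) im by auto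
    moreover have "\<forall>x\<in>insert a A. var_sort L (?f x) = var_sort L x" using f(2) z(1) by auto
    ultimately show ?case by blast
  qed simp
  then obtain f where f: "inj_on f A" "\<And>x. x \<in> A \<Longrightarrow> var_sort L (f x) = var_sort L x" "f ` A \<inter> Y = {}"
    by blast
  obtain \<delta> where "renaming \<delta>" "\<And>x. x \<in> A \<Longrightarrow> \<delta> x = f x"
    by (rule renaming_extension[OF assms(1) f(1,2)]) blast+
  with f(3) that show thesis by (metis image_cong)
qed

text \<open>Fresh variables outside \<open>X\<close> matter only through their sorts, which is all that is kept of them.\<close>

definition skel :: "'v set \<Rightarrow> ('f, 'v) trm \<Rightarrow> ('f, 'v + 's) trm" where
  "skel X = map_trm id (\<lambda>v. if v \<in> X then Inl v else Inr (var_sort L v))"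

text \<open>Equal skeletons make \<open>u\<close> a renaming of \<open>t\<close> that fixes the
  variables in \<open>X\<close> and, by linearity of \<open>u\<close>, is injective. Extended by the
  identity on all of \<open>X\<close>, it leaves \<chi> unchanged, so both terms can keep the same
  constraint.\<close>

lemma skel_eq_doteq:
  assumes lin: "linear_trm t" "linear_trm u" and ct: "(t, \<chi>) \<in> cterms"
    and X: "finite X" "vars \<chi> \<subseteq> X" and eq: "skel X t = skel X u"
  shows "((t, \<chi>), (u, \<chi>)) \<in> doteq"
proof -
  let ?g = "\<lambda>v. if v \<in> X then Inl v else Inr (var_sort L v)"
  from map_trm_eq_instance[OF lin(1) eq[unfolded skel_def]] obtain \<gamma> where u: "u = t \<cdot> \<gamma>" by blast
  have "\<forall>x\<in>vars t. \<exists>y. \<gamma> x = Var y \<and> ?g y = ?g x"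
    using map_trm_subst_eqD[OF eq[unfolded skel_def u]] by blast
  then obtain f where f: "\<And>x. x \<in> vars t \<Longrightarrow> \<gamma> x = Var (f x)" "\<And>x. x \<in> vars t \<Longrightarrow> ?g (f x) = ?g x"
    by metis
  have fX: "f x = x" if "x \<in> vars t" "x \<in> X" for x
    using f(2)[OF that(1)] that(2) by (simp split: if_splits)
  have fnX: "f x \<notin> X \<and> var_sort L (f x) = var_sort L x" if "x \<in> vars t" "x \<notin> X" for x
    using f(2)[OF that(1)] that(2) by (simp split: if_splits)
  have finj: "f x \<noteq> f y" if "x \<in> vars t" "y \<in> vars t" "x \<noteq> y" for x y
    using linear_subst_D2[OF lin(2)[unfolded u] that] f(1)[OF that(1)] f(1)[OF that(2)] by auto
  let ?f = "\<lambda>x. if x \<in> X then x else f x"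
  obtain \<delta> where \<delta>: "renaming \<delta>" "\<And>x. x \<in> vars t \<union> X \<Longrightarrow> \<delta> x = ?f x"
  proof (rule renaming_extension[of "vars t \<union> X" ?f])
    show "inj_on ?f (vars t \<union> X)"
    proof (rule inj_onI)
      fix x y assume "x \<in> vars t \<union> X" "y \<in> vars t \<union> X" "?f x = ?f y"
      then show "x = y" using fnX[of x] fnX[of y] finj[of x y] by (auto split: if_splits)
    qed
    show "var_sort L (?f x) = var_sort L x" if "x \<in> vars t \<union> X" for x
      using that fnX[of x] by auto
  qed (use X in auto)
  have u\<delta>: "u = t \<cdot> (Var \<circ> \<delta>)"
    unfolding u by (rule subst_cong) (simp add: f(1) \<delta>(2) fX)
  have \<chi>\<delta>: "\<chi> \<cdot> (Var \<circ> \<delta>) = \<chi>" by (rule subst_ident) (use \<delta>(2) X(2) in auto)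
  have inj: "inj \<delta>" using \<delta>(1) by (simp add: renaming_def bij_is_inj)
  have ctu: "(u, \<chi>) \<in> cterms"
    using ct has_sort_rename[OF _ \<delta>(1)] unfolding u\<delta> cterms_def by auto
  have "vars u \<inter> vars \<chi> = \<delta> ` (vars t \<inter> vars \<chi>)"
    using arg_cong[OF \<chi>\<delta>, of vars] unfolding u\<delta> vars_rename by (simp add: image_Int[OF inj])
  moreover have "holds u \<chi> \<alpha> = holds t \<chi> (\<alpha> \<circ> \<delta>)" for \<alpha>
    using holds_rename[OF \<delta>(1), of t \<chi> \<alpha>] unfolding u\<delta> \<chi>\<delta> .
  ultimately have "((u, \<chi>), (t, \<chi>)) \<in> doteq"
    unfolding doteq_iff using ct ctu \<delta>(1) u\<delta> by blast
  then show ?thesis by (rule doteq_sym)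
qed

section \<open>Complements\<close>

lemma skel_Var: "skel X (Var x) = Var (if x \<in> X then Inl x else Inr (var_sort L x))"
  by (simp add: skel_def)

lemma skel_Fun: "skel X (Fun f ts) = Fun f (map (skel X) ts)"
  by (simp add: skel_def)

lemma funs_arg: "u \<in> set us \<Longrightarrow> funs u \<subseteq> funs (Fun c us)"
  by auto

lemma vars_Fun_Int_subset: "(\<And>w. w \<in> set ts \<Longrightarrow> vars w \<inter> Y \<subseteq> Z) \<Longrightarrow> vars (Fun c ts) \<inter> Y \<subseteq> Z"
  by auto

lemma Co_Fun_cases:
  assumes "u' \<in> Co X (Fun c us)"
  obtains (new) c' xs where "u' = Fun c' (map Var xs)" "c' \<noteq> c" "c' \<in> constructors L"
      "res_sort L c' = res_sort L c" "map (var_sort L) xs = arg_sorts L c'" "distinct xs" "set xs \<inter> X = {}"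
  | (arg) i v ys where "i < length us" "v \<in> Co X (us ! i)" "u' = Fun c (take i us @ v # map Var ys)"
      "map (var_sort L) ys = drop (Suc i) (arg_sorts L c)" "distinct ys" "set ys \<inter> (X \<union> vars v) = {}"
  using assms by (simp only: Co.simps Un_iff UN_iff mem_Collect_eq lessThan_iff) blast

lemma Co_Fun_new:
  "c' \<noteq> c \<Longrightarrow> c' \<in> constructors L \<Longrightarrow> res_sort L c' = res_sort L c \<Longrightarrow>
    map (var_sort L) xs = arg_sorts L c' \<Longrightarrow> distinct xs \<Longrightarrow> set xs \<inter> X = {} \<Longrightarrow>
    Fun c' (map Var xs) \<in> Co X (Fun c us)"
  by (simp only: Co.simps Un_iff mem_Collect_eq) blast

lemma Co_Fun_arg:
  assumes "i < length us" "v \<in> Co X (us ! i)" "map (var_sort L) ys = drop (Suc i) (arg_sorts L c)"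
    "distinct ys" "set ys \<inter> (X \<union> vars v) = {}"
  shows "Fun c (take i us @ v # map Var ys) \<in> Co X (Fun c us)"
  by (simp only: Co.simps Un_iff UN_iff mem_Collect_eq lessThan_iff) (use assms in blast)

lemma nth_replaced:
  "i < length us \<Longrightarrow> (take i us @ v # vs) ! i = v"
  "i < length us \<Longrightarrow> k < i \<Longrightarrow> (take i us @ v # vs) ! k = us ! k"
  by (simp_all add: nth_append)

text \<open>Either the heads clash or, by induction, the arguments at the distinguished position do.
  The two substitutions are independent, so a common instance is excluded even after renaming
  apart.\<close>

lemma Co_no_instance: "u' \<in> Co X u \<Longrightarrow> u' \<cdot> \<gamma> \<noteq> u \<cdot> \<delta>"
proof (induction u arbitrary: u')
  case (Fun c us)
  from Fun.prems show ?case
  proof (cases rule: Co_Fun_cases)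
    case (arg i v ys)
    have "v \<cdot> \<gamma> \<noteq> us ! i \<cdot> \<delta>" using Fun.IH[OF nth_mem[OF arg(1)] arg(2)] .
    moreover have "map (\<lambda>t. t \<cdot> \<gamma>) (take i us @ v # map Var ys) ! i = v \<cdot> \<gamma>"
      using arg(1) by (simp add: nth_append)
    moreover have "map (\<lambda>t. t \<cdot> \<delta>) us ! i = us ! i \<cdot> \<delta>" using arg(1) by simp
    ultimately have "map (\<lambda>t. t \<cdot> \<gamma>) (take i us @ v # map Var ys) \<noteq> map (\<lambda>t. t \<cdot> \<delta>) us"
      by metis
    then show ?thesis unfolding arg(3) by (simp only: app_subst.simps trm.inject simp_thms)
  qed simp
qed simp

lemma skel_fresh: "set xs \<inter> X = {} \<Longrightarrow> map (skel X) (map Var xs) = map (Var \<circ> Inr) (map (var_sort L) xs)"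
  by (auto simp: skel_Var)

text \<open>A common instance reveals how a complement member was formed: by a new head, which is
  then the same, or at some position, which is then the same. Fresh variables contribute their sorts
  only.\<close>

lemma Co_skel_eq:
  "u1 \<in> Co X u \<Longrightarrow> u2 \<in> Co X u \<Longrightarrow> u1 \<cdot> \<gamma> = u2 \<cdot> \<delta> \<Longrightarrow> skel X u1 = skel X u2"
proof (induction u arbitrary: u1 u2)
  case (Fun c us)
  from Fun.prems(1) show ?case
  proof (cases rule: Co_Fun_cases)
    case 1: (new c1 xs)
    from Fun.prems(2) show ?thesis
    proof (cases rule: Co_Fun_cases)
      case 2: (new c2 ys)
      from Fun.prems(3) have "c1 = c2" unfolding 1(1) 2(1) by simp
      then show ?thesis
        unfolding 1(1) 2(1) skel_Fun skel_fresh[OF 1(7)] skel_fresh[OF 2(7)] 1(5) 2(5) by simp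
    next
      case (arg i v ys)
      with Fun.prems(3) 1(1,2) show ?thesis by simp
    qed
  next
    case 1: (arg i v xs)
    from Fun.prems(2) show ?thesis
    proof (cases rule: Co_Fun_cases)
      case (new c' ys)
      with Fun.prems(3) 1(3) show ?thesis by simp
    next
      case 2: (arg j w ys)
      from Fun.prems(3) have eq: "map (\<lambda>t. t \<cdot> \<gamma>) (take i us @ v # map Var xs) =
          map (\<lambda>t. t \<cdot> \<delta>) (take j us @ w # map Var ys)"
        unfolding 1(3) 2(3) by (simp only: app_subst.simps trm.inject simp_thms)
      have nth: "(take i us @ v # map Var xs) ! k \<cdot> \<gamma> = (take j us @ w # map Var ys) ! k \<cdot> \<delta>"
        if "k \<le> i" "k \<le> j" for k
      proof -
        have "k < length (take i us @ v # map Var xs)" "k < length (take j us @ w # map Var ys)"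
          using that 1(1) 2(1) by simp_all
        then show ?thesis using arg_cong[OF eq, of "\<lambda>l. l ! k"] by (simp only: nth_map)
      qed
      \<comment> \<open>For i < j, position i holds a member of \<open>Co X (us ! i)\<close> on one
        side and \<open>us ! i\<close> itself on the other, and these have no common
        instance.\<close>
      have "\<not> i < j"
        using nth[of i] Co_no_instance[OF 1(2)] 1(1) 2(1) nth_replaced by (metis less_imp_le order_refl)
      moreover have "\<not> j < i"
        using nth[of j] Co_no_instance[OF 2(2)] 1(1) 2(1) nth_replaced by (metis less_imp_le order_refl)
      ultimately have ij: "i = j" by simp
      have "v \<cdot> \<gamma> = w \<cdot> \<delta>" using nth[of i] 1(1) unfolding ij by (simp only: nth_replaced order_refl)
      then have "skel X v = skel X w"
        using Fun.IH[OF nth_mem[OF 1(1)] 1(2)] 2(2) unfolding ij by blast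
      moreover have "map (skel X) (map Var xs) = map (skel X) (map Var ys)"
        using 1(4,6) 2(4,6) ij skel_fresh[of xs X] skel_fresh[of ys X] by (simp add: Int_Un_distrib)
      ultimately show ?thesis unfolding 1(3) 2(3) skel_Fun ij by simp
    qed
  qed
qed simp

lemma theory_sorted_is_Var:
  assumes "has_sort u \<iota>" "\<iota> \<in> theory_sorts L" "funs u \<subseteq> constructors L - Val L"
  obtains y where "u = Var y"
proof (cases u)
  case (Fun f ts)
  with assms have "res_sort L f \<in> theory_sorts L" "f \<in> constructors L - Val L"
    by (simp_all add: has_sort_Fun)
  then show thesis using constructor_res_sort by blast
qed (rule that)

text \<open>The clause about \<open>X\<close> records that a complement member has no old variables
  beyond those of \<open>u\<close>; together with the freshness condition of \<open>CoSub\<close> it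
  keeps \<open>s \<cdot> \<rho>\<close> linear.\<close>

lemma Co_wf:
  "u' \<in> Co X u \<Longrightarrow> has_sort u \<iota> \<Longrightarrow> linear_trm u \<Longrightarrow> funs u \<subseteq> constructors L - Val L \<Longrightarrow>
    vars u \<subseteq> X \<Longrightarrow>
    has_sort u' \<iota> \<and> linear_trm u' \<and> funs u' \<subseteq> constructors L - Val L \<and> vars u' \<inter> X \<subseteq> vars u"
proof (induction u arbitrary: u' \<iota>)
  case (Fun c us)
  from Fun.prems have c: "c \<in> constructors L - Val L" "\<iota> = res_sort L c"
    and len: "length us = length (arg_sorts L c)" by (auto simp: has_sort_Fun)
  from Fun.prems(1) show ?case
  proof (cases rule: Co_Fun_cases)
    case (new c' xs)
    \<comment> \<open>As a constructor outside \<open>Val L\<close>, \<open>c\<close> has no theory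
      result sort; \<open>c'\<close> shares this result sort, hence is no value.\<close>
    have "c' \<notin> Val L" using value_sort[of c'] constructor_res_sort[of c] c(1) new(4) by auto
    moreover have "has_sort u' \<iota>"
    proof -
      have "length xs = length (arg_sorts L c')" using new(5) by (metis length_map)
      moreover have "var_sort L (xs ! i) = arg_sorts L c' ! i" if "i < length xs" for i
        using that arg_cong[OF new(5), of "\<lambda>l. l ! i"] by simp
      ultimately show ?thesis
        unfolding new(1) has_sort_Fun using new(3,4) c(2) syms_partition(2) by auto
    qed
    moreover have "linear_trm u'"
      unfolding new(1) linear_trm_def using new(6) by (simp add: o_def)
    ultimately show ?thesis using new by auto
  next
    case (arg i v ys)
    have us: "us = take i us @ us ! i # drop (Suc i) us" by (rule id_take_nth_drop[OF arg(1)])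
    have ui: "us ! i \<in> set us" using arg(1) by simp
    have srt: "has_sort (us ! k) (arg_sorts L c ! k)" if "k < length us" for k
      using Fun.prems(2) that by (simp add: has_sort_Fun)
    have v: "has_sort v (arg_sorts L c ! i) \<and> linear_trm v \<and> funs v \<subseteq> constructors L - Val L \<and>
        vars v \<inter> X \<subseteq> vars (us ! i)"
    proof (rule Fun.IH[OF ui arg(2) srt[OF arg(1)]])
      show "linear_trm (us ! i)" using Fun.prems(3) arg(1) by (simp add: linear_Fun)
      show "funs (us ! i) \<subseteq> constructors L - Val L" using Fun.prems(4) ui by auto
      show "vars (us ! i) \<subseteq> X" using Fun.prems(5) ui by auto
    qed
    have "length ys = length us - Suc i" using arg(4) len by (metis length_drop length_map)
    then have len': "length (take i us @ v # map Var ys) = length (arg_sorts L c)"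
      using arg(1) len by simp
    have "has_sort ((take i us @ v # map Var ys) ! k) (arg_sorts L c ! k)" if k: "k < length us" for k
    proof (cases k i rule: linorder_cases)
      case less
      then show ?thesis using srt[OF k] arg(1) by (simp add: nth_append)
    next
      case equal
      then show ?thesis using v arg(1) by (simp add: nth_append)
    next
      case greater
      define m where "m = k - Suc i"
      have km: "k = Suc (i + m)" using greater by (simp add: m_def)
      have "m < length ys" using \<open>length ys = length us - Suc i\<close> k km by simp
      then have "var_sort L (ys ! m) = arg_sorts L c ! k"
        using arg_cong[OF arg(4), of "\<lambda>l. l ! m"] k len km by simp
      then show ?thesis using arg(1) km \<open>m < length ys\<close> by (simp add: nth_append)
    qed
    then have "has_sort u' \<iota>"
      unfolding arg(3) has_sort_Fun len' using len Fun.prems(2) by (simp add: has_sort_Fun)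
    moreover have "linear_trm u'"
    proof -
      \<comment> \<open>Arguments after position \<open>i\<close> give way to the fresh
        \<open>ys\<close>, so only the prefix, \<open>v\<close> and \<open>ys\<close> have to be
        compared. Old variables of \<open>v\<close> stem from \<open>us ! i\<close>, which is
        disjoint from the prefix.\<close>
      have "distinct (concat (map var_list (take i us)) @ var_list (us ! i) @ concat (map var_list (drop (Suc i) us)))"
        using Fun.prems(3) us by (metis (no_types, lifting) concat.simps(2) concat_append linear_trm_def list.simps(9) map_append var_list.simps(2))
      then have d: "distinct (concat (map var_list (take i us)))"
        "set (concat (map var_list (take i us))) \<inter> vars (us ! i) = {}" by auto
      have X: "set (concat (map var_list (take i us))) \<subseteq> X"
        using Fun.prems(5) by (auto dest: in_set_takeD)
      have "distinct (concat (map var_list (take i us)) @ var_list v @ ys)"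
      proof -
        have "set (concat (map var_list (take i us))) \<inter> (vars v \<union> set ys) = {}"
          using X v d(2) arg(6) by blast
        then show ?thesis using d(1) v arg(5,6) unfolding linear_trm_def distinct_append set_append set_var_list by blast
      qed
      then show ?thesis unfolding arg(3) linear_trm_def by (simp add: o_def)
    qed
    moreover have "funs u' \<subseteq> constructors L - Val L"
    proof -
      have "funs u \<subseteq> constructors L - Val L" if "u \<in> set (take i us @ v # map Var ys)" for u
      proof -
        from that consider "u \<in> set us" | "u = v" | y where "u = Var y" by (auto dest: in_set_takeD)
        then show ?thesis
        proof cases
          case 1
          show ?thesis by (rule subset_trans[OF funs_arg[OF 1] Fun.prems(4)])
        next
          case 2
          then show ?thesis using v by blast
        qed simp
      qed
      moreover have "funs (Fun c ts) \<subseteq> A" if "c \<in> A" "\<And>u. u \<in> set ts \<Longrightarrow> funs u \<subseteq> A" for ts and A :: "'f set"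
        using that by auto
      ultimately show ?thesis unfolding arg(3) using c(1) by blast
    qed
    moreover have "vars u' \<inter> X \<subseteq> vars (Fun c us)"
    proof -
      have "vars u \<inter> X \<subseteq> vars (Fun c us)" if "u \<in> set (take i us @ v # map Var ys)" for u
      proof -
        from that consider "u \<in> set us" | "u = v" | y where "u = Var y" "y \<in> set ys"
          by (auto dest: in_set_takeD)
        then show ?thesis
        proof cases
          case 1
          then show ?thesis by auto
        next
          case 2
          then show ?thesis using v vars_nth[OF arg(1), of c] by blast
        next
          case 3
          then show ?thesis using arg(6) by auto
        qed
      qed
      then show ?thesis unfolding arg(3) by (rule vars_Fun_Int_subset)
    qed
    ultimately show ?thesis by blast
  qed
qed simp

text \<open>Since \<open>c\<close> has no theory result sort, a new head of the same sort is no
  theory symbol and lies in the finite set \<open>term_syms L\<close>. The choice of fresh variables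
  disappears in the skeleton.\<close>

lemma finite_skel_Co:
  "funs u \<subseteq> constructors L - Val L \<Longrightarrow> finite (skel X ` Co X u)"
proof (induction u)
  case (Fun c us)
  let ?A = "(\<lambda>c'. Fun c' (map (Var \<circ> Inr) (arg_sorts L c'))) ` term_syms L"
  let ?h = "\<lambda>i S. Fun c (map (skel X) (take i us) @ S # map (Var \<circ> Inr) (drop (Suc i) (arg_sorts L c)))"
  let ?B = "\<Union>i<length us. ?h i ` (skel X ` Co X (us ! i))"
  have c: "c \<in> constructors L - Val L" using Fun.prems by simp
  have "skel X u' \<in> ?A \<union> ?B" if "u' \<in> Co X (Fun c us)" for u'
    using that
  proof (cases rule: Co_Fun_cases)
    case (new c' xs)
    have "c' \<notin> theory_syms L"
      using theory_syms_sorts[of c'] constructor_res_sort[OF c] new(4) by auto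
    then have "c' \<in> term_syms L"
      using new(3) syms_partition(2) by (auto simp: all_syms_def)
    moreover have "skel X u' = Fun c' (map (Var \<circ> Inr) (arg_sorts L c'))"
      unfolding new(1) skel_Fun skel_fresh[OF new(7)] new(5) ..
    ultimately show ?thesis by blast
  next
    case (arg i v ys)
    have "set ys \<inter> X = {}" using arg(6) by blast
    then have "skel X u' = ?h i (skel X v)"
      unfolding arg(3) skel_Fun by (simp only: map_append list.map skel_fresh arg(4))
    then show ?thesis using arg(1,2) by blast
  qed
  then have "skel X ` Co X (Fun c us) \<subseteq> ?A \<union> ?B" by (rule image_subsetI)
  moreover have "finite (skel X ` Co X (us ! i))" if "i < length us" for i
    using Fun.IH[OF nth_mem[OF that]] funs_arg[OF nth_mem[OF that], of c] Fun.prems by blast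
  then have "finite (?A \<union> ?B)" using finite_term_syms by simp
  ultimately show ?case by (rule finite_subset)
qed simp

lemma arg_sorts_all_sorts: "f \<in> all_syms L \<Longrightarrow> set (arg_sorts L f) \<subseteq> all_sorts L"
  using theory_syms_sorts[of f] term_syms_sorts[of f] by (auto simp: all_syms_def all_sorts_def)

text \<open>The member is found by following the first place where \<open>g\<close> leaves the shape
  of \<open>u\<close>. \<open>Y\<close> holds variables already spent elsewhere, which may recur
  only if they are in \<open>X\<close>; \<open>choose_complements\<close> relies on this.\<close>

lemma Co_complete:
  assumes "finite X" "finite Y"
  shows "has_sort u \<iota> \<Longrightarrow> linear_trm u \<Longrightarrow> funs u \<subseteq> constructors L - Val L \<Longrightarrow> vars u \<subseteq> X \<Longrightarrow>
    has_sort g \<iota> \<Longrightarrow> funs g \<subseteq> constructors L \<Longrightarrow> vars g = {} \<Longrightarrow> \<nexists>\<gamma>. g = u \<cdot> \<gamma> \<Longrightarrow>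
    \<exists>u'\<in>Co X u. vars u' \<inter> Y \<subseteq> X \<and> (\<exists>\<gamma>. g = u' \<cdot> \<gamma>)"
proof (induction u arbitrary: g \<iota>)
  case (Var x)
  have "g = Var x \<cdot> (\<lambda>_. g)" by simp
  with Var.prems(8) show ?case by blast
next
  case (Fun c us)
  obtain d gs where g: "g = Fun d gs" using Fun.prems(7) by (cases g) auto
  have d: "d \<in> constructors L" "d \<in> all_syms L" "res_sort L d = \<iota>" "length gs = length (arg_sorts L d)"
    using Fun.prems(5,6) by (auto simp: g has_sort_Fun)
  have c: "res_sort L c = \<iota>" "length us = length (arg_sorts L c)" "c \<in> all_syms L"
    using Fun.prems(1) by (auto simp: has_sort_Fun)
  show ?case
  proof (cases "d = c")
    case False
    obtain xs where xs: "map (var_sort L) xs = arg_sorts L d" "distinct xs" "set xs \<inter> (X \<union> Y) = {}"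
      using fresh_vars[OF arg_sorts_all_sorts[OF d(2)], of "X \<union> Y"] assms by auto
    let ?u = "Fun d (map Var xs)"
    have "?u \<in> Co X (Fun c us)"
      by (rule Co_Fun_new) (use False d c xs in auto)
    moreover have "vars ?u \<inter> Y \<subseteq> X" using xs(3) by auto
    moreover have "\<exists>\<gamma>. Fun d gs = ?u \<cdot> \<gamma>"
    proof (rule linear_instance)
      show "linear_trm ?u" using xs(2) by (simp add: linear_trm_def o_def)
      show "length gs = length (map Var xs)" using d(4) xs(1) by (metis length_map)
      show "\<exists>\<gamma>. gs ! i = map Var xs ! i \<cdot> \<gamma>" if "i < length (map Var xs)" for i
        by (rule exI[where x = "\<lambda>_. gs ! i"]) (use that in simp)
    qed
    ultimately show ?thesis unfolding g by blast
  next
    case True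
    have len: "length gs = length us" using c(2) d(4) True by simp
    let ?bad = "\<lambda>i. i < length us \<and> (\<nexists>\<gamma>. gs ! i = us ! i \<cdot> \<gamma>)"
    have "\<exists>i. ?bad i"
    proof (rule ccontr)
      assume "\<nexists>i. ?bad i"
      then have "\<exists>\<gamma>. Fun c gs = Fun c us \<cdot> \<gamma>"
        using linear_instance[OF Fun.prems(2) len] by blast
      then show False using Fun.prems(8) unfolding g True by blast
    qed
    \<comment> \<open>The least failing position is taken because \<open>Co\<close> retains the
      arguments before it, so those must match the arguments of \<open>g\<close>.\<close>
    define i where "i = (LEAST i. ?bad i)"
    have i: "i < length us" "\<nexists>\<gamma>. gs ! i = us ! i \<cdot> \<gamma>"
      using LeastI_ex[OF \<open>\<exists>i. ?bad i\<close>] unfolding i_def[symmetric] by blast+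
    have before: "\<exists>\<gamma>. gs ! k = us ! k \<cdot> \<gamma>" if "k < i" for k
      using not_less_Least[of k ?bad] that i(1) unfolding i_def[symmetric] by auto
    have ui: "us ! i \<in> set us" and gi: "gs ! i \<in> set gs" using i(1) len by simp_all
    have "\<exists>v\<in>Co X (us ! i). vars v \<inter> Y \<subseteq> X \<and> (\<exists>\<gamma>. gs ! i = v \<cdot> \<gamma>)"
    proof (rule Fun.IH[OF ui])
      show "has_sort (us ! i) (arg_sorts L c ! i)" using Fun.prems(1) i(1) by (simp add: has_sort_Fun)
      show "linear_trm (us ! i)" using Fun.prems(2) i(1) by (simp add: linear_Fun)
      show "funs (us ! i) \<subseteq> constructors L - Val L" using Fun.prems(3) ui by auto
      show "vars (us ! i) \<subseteq> X" using Fun.prems(4) ui by auto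
      show "has_sort (gs ! i) (arg_sorts L c ! i)"
        using Fun.prems(5) i(1) len unfolding g True by (simp add: has_sort_Fun)
      show "funs (gs ! i) \<subseteq> constructors L" using Fun.prems(6) gi unfolding g by auto
      show "vars (gs ! i) = {}" using Fun.prems(7) gi unfolding g by auto
    qed (rule i(2))
    then obtain v where v: "v \<in> Co X (us ! i)" "vars v \<inter> Y \<subseteq> X" "\<exists>\<gamma>. gs ! i = v \<cdot> \<gamma>" by blast
    have "set (drop (Suc i) (arg_sorts L c)) \<subseteq> all_sorts L"
      using arg_sorts_all_sorts[OF c(3)] set_drop_subset[of "Suc i" "arg_sorts L c"] by blast
    then obtain ys where ys: "map (var_sort L) ys = drop (Suc i) (arg_sorts L c)" "distinct ys"
      "set ys \<inter> (X \<union> Y \<union> vars v) = {}"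
      using fresh_vars[of "drop (Suc i) (arg_sorts L c)" "X \<union> Y \<union> vars v"] assms by auto
    let ?us = "take i us @ v # map Var ys"
    have u: "Fun c ?us \<in> Co X (Fun c us)"
      by (rule Co_Fun_arg[OF i(1) v(1) ys(1,2)]) (use ys(3) in blast)
    have "length ys = length us - Suc i" using ys(1) c(2) by (metis length_drop length_map)
    then have len': "length gs = length ?us" using i(1) len by simp
    have "\<exists>\<gamma>. Fun c gs = Fun c ?us \<cdot> \<gamma>"
    proof (rule linear_instance[OF _ len'])
      show "linear_trm (Fun c ?us)" using Co_wf[OF u Fun.prems(1-4)] by blast
      show "\<exists>\<gamma>. gs ! k = ?us ! k \<cdot> \<gamma>" if k: "k < length ?us" for k
      proof (cases k i rule: linorder_cases)
        case less
        then have "?us ! k = us ! k" by (rule nth_replaced(2)[OF i(1)])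
        with before[OF less] show ?thesis by simp
      next
        case equal
        have "?us ! k = v" unfolding equal by (rule nth_replaced(1)[OF i(1)])
        with v(3) equal show ?thesis by simp
      next
        case greater
        define m where "m = k - Suc i"
        have km: "k = Suc (i + m)" using greater by (simp add: m_def)
        have "?us ! k = Var (ys ! m)" using k i(1) km by (simp add: nth_append)
        then show ?thesis by (intro exI[where x = "\<lambda>_. gs ! k"]) simp
      qed
    qed
    moreover have "vars (Fun c ?us) \<inter> Y \<subseteq> X"
    proof -
      have "vars w \<inter> Y \<subseteq> X" if "w \<in> set ?us" for w
      proof -
        from that consider "w \<in> set us" | "w = v" | y where "w = Var y" "y \<in> set ys"
          by (auto dest: in_set_takeD)
        then show ?thesis
        proof cases
          case 1
          then show ?thesis using Fun.prems(4) by auto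
        next
          case 2
          then show ?thesis using v(2) by blast
        next
          case 3
          then show ?thesis using ys(3) by auto
        qed
      qed
      then show ?thesis by (rule vars_Fun_Int_subset)
    qed
    ultimately show ?thesis unfolding g True using u by blast
  qed
qed

section \<open>Most general unifiers of linear terms\<close>

text \<open>Generality in the form \<open>\<tau> = \<tau> \<circ> \<theta>\<close> for every unifier \<open>\<tau>\<close>, sorted or not, is what glues
  unifiers of the arguments together to one of the whole terms; it also makes \<open>\<theta>\<close> idempotent.\<close>

definition smgu :: "'f set \<Rightarrow> ('f, 'v) trm \<Rightarrow> ('f, 'v) trm \<Rightarrow> ('f, 'v) sbst \<Rightarrow> bool" where
  "smgu F s t \<theta> \<longleftrightarrow> s \<cdot> \<theta> = t \<cdot> \<theta> \<and> (\<forall>\<tau>. s \<cdot> \<tau> = t \<cdot> \<tau> \<longrightarrow> (\<forall>x. \<tau> x = \<theta> x \<cdot> \<tau>)) \<and>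
     dom_subst \<theta> \<subseteq> vars s \<union> vars t \<and> linear_trm (s \<cdot> \<theta>) \<and>
     (\<forall>x\<in>vars s \<union> vars t. vars (\<theta> x) \<subseteq> vars s \<union> vars t \<and> funs (\<theta> x) \<subseteq> F \<and>
        has_sort (\<theta> x) (var_sort L x))"

lemma smgu_Var_left:
  assumes "linear_trm t" "x \<notin> vars t" "has_sort t (var_sort L x)" "funs t \<subseteq> F"
  shows "smgu F (Var x) t (Var(x := t))"
proof -
  have t: "t \<cdot> Var(x := t) = t" by (rule subst_ident) (use assms(2) in auto)
  have "\<forall>y. \<tau> y = (Var(x := t)) y \<cdot> \<tau>" if "Var x \<cdot> \<tau> = t \<cdot> \<tau>" for \<tau>
    using that by simp
  moreover have "dom_subst (Var(x := t)) \<subseteq> {x}" by (auto simp: dom_subst_def)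
  ultimately show ?thesis
    unfolding smgu_def using t assms by auto
qed

lemma smgu_Var_right:
  assumes "linear_trm s" "x \<notin> vars s" "has_sort s (var_sort L x)" "funs s \<subseteq> F"
  shows "smgu F s (Var x) (Var(x := s))"
proof -
  have s: "s \<cdot> Var(x := s) = s" by (rule subst_ident) (use assms(2) in auto)
  have "\<forall>y. \<tau> y = (Var(x := s)) y \<cdot> \<tau>" if "s \<cdot> \<tau> = Var x \<cdot> \<tau>" for \<tau>
    using that by simp
  moreover have "dom_subst (Var(x := s)) \<subseteq> {x}" by (auto simp: dom_subst_def)
  ultimately show ?thesis
    unfolding smgu_def using s assms by auto
qed

text \<open>Distinct argument pairs share no variables, so solving one leaves the others untouched:
  the unifiers of the arguments are put side by side, without the compositions of general
  unification.\<close>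

lemma smgu_Fun:
  assumes lin: "linear_trm (Fun f ss)" "linear_trm (Fun f ts)"
    and disj: "vars (Fun f ss) \<inter> vars (Fun f ts) = {}"
    and len: "length ss = length ts"
    and args: "\<And>i. i < length ts \<Longrightarrow> smgu F (ss ! i) (ts ! i) (\<Theta> i)"
  obtains \<theta> where "smgu F (Fun f ss) (Fun f ts) \<theta>"
proof -
  let ?V = "\<lambda>i. vars (ss ! i) \<union> vars (ts ! i)"
  have sub: "?V i \<subseteq> vars (Fun f ss) \<union> vars (Fun f ts)" if "i < length ts" for i
    using vars_nth[of i ss f] vars_nth[of i ts f] that len by auto
  have V: "i = j" if ij: "i < length ts" "j < length ts" and x: "x \<in> ?V i" "x \<in> ?V j" for i j x
  proof (rule ccontr)
    assume "i \<noteq> j"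
    then have "vars (ss ! i) \<inter> vars (ss ! j) = {}" "vars (ts ! i) \<inter> vars (ts ! j) = {}"
      using lin ij len by (simp_all add: linear_Fun)
    moreover have st: "vars (ss ! k) \<inter> vars (ts ! l) = {}" if "k < length ts" "l < length ts" for k l
    proof -
      have "vars (ss ! k) \<subseteq> vars (Fun f ss)" by (rule vars_nth) (use that len in simp)
      moreover have "vars (ts ! l) \<subseteq> vars (Fun f ts)" by (rule vars_nth) (rule that(2))
      ultimately show ?thesis using disj by blast
    qed
    ultimately show False using x st[OF ij] st[OF ij(2,1)] by blast
  qed
  have V': "i = j" if "i \<in> {..<length ts}" "j \<in> {..<length ts}" "x \<in> ?V i" "x \<in> ?V j" for i j x
    by (rule V[OF _ _ that(3,4)]) (use that(1,2) in \<open>simp_all only: lessThan_iff\<close>)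
  obtain \<theta> where \<theta>: "\<And>i x. i \<in> {..<length ts} \<Longrightarrow> x \<in> ?V i \<Longrightarrow> \<theta> x = \<Theta> i x"
    "\<And>x. x \<notin> (\<Union>i\<in>{..<length ts}. ?V i) \<Longrightarrow> \<theta> x = Var x"
    by (rule glue[where I = "{..<length ts}" and V = ?V and f = \<Theta> and d = Var])
      (erule (3) V', rule that)
  have ss: "ss ! i \<cdot> \<theta> = ss ! i \<cdot> \<Theta> i" and ts: "ts ! i \<cdot> \<theta> = ts ! i \<cdot> \<Theta> i" if "i < length ts" for i
    by (rule subst_cong; use \<theta>(1)[of i] that in simp)+
  have all: "(\<Union>i\<in>{..<length ts}. ?V i) = vars (Fun f ss) \<union> vars (Fun f ts)"
    unfolding vars_Fun_nth len by blast
  have "Fun f ss \<cdot> \<theta> = Fun f ts \<cdot> \<theta>"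
  proof -
    have "map (\<lambda>t. t \<cdot> \<theta>) ss = map (\<lambda>t. t \<cdot> \<theta>) ts"
    proof (rule nth_equalityI)
      fix i assume "i < length (map (\<lambda>t. t \<cdot> \<theta>) ss)"
      then have i: "i < length ts" using len by simp
      have "ss ! i \<cdot> \<Theta> i = ts ! i \<cdot> \<Theta> i" using args[OF i] unfolding smgu_def by (rule conjunct1)
      then show "map (\<lambda>t. t \<cdot> \<theta>) ss ! i = map (\<lambda>t. t \<cdot> \<theta>) ts ! i"
        using i len ss[OF i] ts[OF i] by simp
    qed (simp add: len)
    then show ?thesis by (simp only: app_subst.simps)
  qed
  moreover have "\<tau> x = \<theta> x \<cdot> \<tau>" if "Fun f ss \<cdot> \<tau> = Fun f ts \<cdot> \<tau>" for \<tau> x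
  proof (cases "x \<in> (\<Union>i\<in>{..<length ts}. ?V i)")
    case True
    then obtain i where i: "i < length ts" "x \<in> ?V i" by blast
    from that have "map (\<lambda>t. t \<cdot> \<tau>) ss = map (\<lambda>t. t \<cdot> \<tau>) ts"
      by (simp only: app_subst.simps trm.inject simp_thms)
    from arg_cong[OF this, of "\<lambda>l. l ! i"] i(1) len have "ss ! i \<cdot> \<tau> = ts ! i \<cdot> \<tau>" by (simp only: nth_map)
    then have "\<tau> x = \<Theta> i x \<cdot> \<tau>" using args[OF i(1)] unfolding smgu_def by blast
    moreover have "\<theta> x = \<Theta> i x" using \<theta>(1)[of i x] i by blast
    ultimately show ?thesis by (simp only:)
  next
    case False
    show ?thesis using \<theta>(2)[OF False] by (simp only: app_subst.simps)
  qed
  moreover have "dom_subst \<theta> \<subseteq> vars (Fun f ss) \<union> vars (Fun f ts)"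
    unfolding dom_subst_def all[symmetric] using \<theta>(2) by blast
  moreover have comp: "vars (\<theta> x) \<subseteq> ?V i \<and> funs (\<theta> x) \<subseteq> F \<and> has_sort (\<theta> x) (var_sort L x)"
    if i: "i < length ts" "x \<in> ?V i" for i x
  proof -
    have "\<theta> x = \<Theta> i x" using \<theta>(1)[of i x] i by blast
    then show ?thesis using args[OF i(1)] i(2) unfolding smgu_def by (simp only:)
  qed
  moreover have "linear_trm (Fun f ss \<cdot> \<theta>)"
  proof -
    have vi: "vars (ss ! i \<cdot> \<theta>) \<subseteq> ?V i" if "i < length ts" for i
      using comp[OF that] unfolding vars_subst by blast
    have "linear_trm (ss ! i \<cdot> \<theta>)" if "i < length ts" for i
      using args[OF that] unfolding ss[OF that] smgu_def by blast
    moreover have "vars (ss ! i \<cdot> \<theta>) \<inter> vars (ss ! j \<cdot> \<theta>) = {}"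
      if "i < length ts" "j < length ts" "i \<noteq> j" for i j
      using vi[OF that(1)] vi[OF that(2)] V[OF that(1,2)] that(3) by blast
    ultimately show ?thesis by (simp add: linear_Fun len)
  qed
  moreover have "\<forall>x\<in>vars (Fun f ss) \<union> vars (Fun f ts). vars (\<theta> x) \<subseteq> vars (Fun f ss) \<union> vars (Fun f ts) \<and>
      funs (\<theta> x) \<subseteq> F \<and> has_sort (\<theta> x) (var_sort L x)"
  proof
    fix x assume "x \<in> vars (Fun f ss) \<union> vars (Fun f ts)"
    then obtain i where i: "i < length ts" "x \<in> ?V i" unfolding all[symmetric] by blast
    show "vars (\<theta> x) \<subseteq> vars (Fun f ss) \<union> vars (Fun f ts) \<and>
      funs (\<theta> x) \<subseteq> F \<and> has_sort (\<theta> x) (var_sort L x)"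
      using comp[OF i] sub[OF i(1)] by blast
  qed
  ultimately have "smgu F (Fun f ss) (Fun f ts) \<theta>" unfolding smgu_def by blast
  then show thesis by (rule that)
qed

text \<open>The given unifier \<tau> excludes a clash of symbols, and disjointness of the variables
  excludes an occurs-check failure.\<close>

lemma smgu_exists:
  "linear_trm s \<Longrightarrow> linear_trm t \<Longrightarrow> vars s \<inter> vars t = {} \<Longrightarrow> has_sort s \<iota> \<Longrightarrow> has_sort t \<iota> \<Longrightarrow>
    funs s \<union> funs t \<subseteq> F \<Longrightarrow> s \<cdot> \<tau> = t \<cdot> \<tau> \<Longrightarrow> \<exists>\<theta>. smgu F s t \<theta>"
proof (induction s arbitrary: t \<iota>)
  case (Var x)
  then have "smgu F (Var x) t (Var(x := t))" by (intro smgu_Var_left) auto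
  then show ?case by (rule exI[where x = "Var(x := t)"])
next
  case (Fun f ss)
  show ?case
  proof (cases t)
    case (Var y)
    have "smgu F (Fun f ss) (Var y) (Var(y := Fun f ss))"
    proof (rule smgu_Var_right)
      show "y \<notin> vars (Fun f ss)" using Fun.prems(3) unfolding Var by auto
      show "has_sort (Fun f ss) (var_sort L y)" using Fun.prems(4,5) unfolding Var has_sort_Var by simp
    qed (use Fun.prems in auto)
    then show ?thesis unfolding Var by (rule exI[where x = "Var(y := Fun f ss)"])
  next
    case t: (Fun g ts)
    from Fun.prems(7) have fg: "g = f" and eq: "map (\<lambda>t. t \<cdot> \<tau>) ss = map (\<lambda>t. t \<cdot> \<tau>) ts"
      unfolding t by (simp_all only: app_subst.simps trm.inject)
    note t = t[unfolded fg]
    have len: "length ss = length ts" using eq by (metis length_map)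
    have "\<exists>\<theta>. smgu F (ss ! i) (ts ! i) \<theta>" if i: "i < length ts" for i
    proof -
      from i len have i': "i < length ss" by simp
      show ?thesis
      proof (rule Fun.IH[OF nth_mem[OF i']])
        show "linear_trm (ss ! i)" "linear_trm (ts ! i)"
          using Fun.prems(1,2) i i' unfolding t by (simp_all add: linear_Fun)
        show "vars (ss ! i) \<inter> vars (ts ! i) = {}"
          using Fun.prems(3) vars_nth[OF i, of f] vars_nth[OF i', of f] unfolding t by blast
        show "has_sort (ss ! i) (arg_sorts L f ! i)" "has_sort (ts ! i) (arg_sorts L f ! i)"
          using Fun.prems(4,5) i i' unfolding t has_sort_Fun by blast+
        show "funs (ss ! i) \<union> funs (ts ! i) \<subseteq> F"
          using Fun.prems(6) funs_arg[OF nth_mem[OF i], of f] funs_arg[OF nth_mem[OF i'], of f]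
          unfolding t by blast
        show "ss ! i \<cdot> \<tau> = ts ! i \<cdot> \<tau>"
          using arg_cong[OF eq, of "\<lambda>l. l ! i"] i i' by (simp only: nth_map)
      qed
    qed
    then obtain \<Theta> where \<Theta>: "\<And>i. i < length ts \<Longrightarrow> smgu F (ss ! i) (ts ! i) (\<Theta> i)" by metis
    obtain \<theta> where "smgu F (Fun f ss) (Fun f ts) \<theta>"
      by (rule smgu_Fun[OF Fun.prems(1) Fun.prems(2)[unfolded t] Fun.prems(3)[unfolded t] len \<Theta>])
    then show ?thesis unfolding t by (rule exI[where x = \<theta>])
  qed
qed

lemma smgu_is_mgu:
  assumes "smgu F s t \<theta>" shows "is_mgu \<theta> s t"
proof -
  have "has_sort (\<theta> x) (var_sort L x)" for x
  proof (cases "x \<in> vars s \<union> vars t")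
    case True
    then show ?thesis using assms unfolding smgu_def by blast
  next
    case False
    then have "\<theta> x = Var x" using assms unfolding smgu_def dom_subst_def by blast
    then show ?thesis by (simp only: has_sort_Var)
  qed
  then have "substitution \<theta>" unfolding substitution_def by blast
  then show ?thesis using assms unfolding smgu_def is_mgu_def by blast
qed

text \<open>The roots are defined symbols, while the range of the unifier is to consist of
  value-free constructor terms. So the root is peeled off and \<open>smgu_exists\<close> is applied
  to the arguments.\<close>

lemma pattern_smgu_exists:
  assumes s: "is_pattern s" "linear_trm s" "value_free s" and t: "is_pattern t" "linear_trm t" "value_free t"
    and disj: "vars s \<inter> vars t = {}" and eq: "s \<cdot> \<tau> = t \<cdot> \<tau>"
  obtains \<theta> where "smgu (constructors L - Val L) s t \<theta>"
proof -
  let ?F = "constructors L - Val L"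
  from s(1) obtain f ss \<iota> where s': "s = Fun f ss" "has_sort s \<iota>" "\<forall>u\<in>set ss. funs u \<subseteq> constructors L"
    unfolding is_pattern_def by blast
  from t(1) obtain g ts \<kappa> where t': "t = Fun g ts" "has_sort t \<kappa>" "\<forall>u\<in>set ts. funs u \<subseteq> constructors L"
    unfolding is_pattern_def by blast
  from eq have fg: "g = f" and args: "map (\<lambda>t. t \<cdot> \<tau>) ss = map (\<lambda>t. t \<cdot> \<tau>) ts"
    unfolding s' t' by (simp_all only: app_subst.simps trm.inject)
  note t' = t'[unfolded fg]
  have len: "length ss = length ts" using args by (metis length_map)
  have fs: "funs u \<subseteq> ?F" if "u \<in> set ss" for u
    using s'(3) s(3) that funs_arg[OF that, of f] unfolding value_free_def s'(1) by blast
  have ft: "funs u \<subseteq> ?F" if "u \<in> set ts" for u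
    using t'(3) t(3) that funs_arg[OF that, of f] unfolding value_free_def t'(1) by blast
  have "\<exists>\<theta>. smgu ?F (ss ! i) (ts ! i) \<theta>" if i: "i < length ts" for i
  proof -
    from i len have i': "i < length ss" by simp
    show ?thesis
    proof (rule smgu_exists)
      show "linear_trm (ss ! i)" "linear_trm (ts ! i)"
        using s(2) t(2) i i' unfolding s' t' by (simp_all add: linear_Fun)
      show "vars (ss ! i) \<inter> vars (ts ! i) = {}"
        using disj vars_nth[OF i, of f] vars_nth[OF i', of f] unfolding s' t' by blast
      show "has_sort (ss ! i) (arg_sorts L f ! i)" "has_sort (ts ! i) (arg_sorts L f ! i)"
        using s'(2) t'(2) i i' unfolding s'(1) t'(1) has_sort_Fun by blast+
      show "funs (ss ! i) \<union> funs (ts ! i) \<subseteq> ?F"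
        using fs[OF nth_mem[OF i']] ft[OF nth_mem[OF i]] by blast
      show "ss ! i \<cdot> \<tau> = ts ! i \<cdot> \<tau>"
        using arg_cong[OF args, of "\<lambda>l. l ! i"] i i' by (simp only: nth_map)
    qed
  qed
  then obtain \<Theta> where \<Theta>: "\<And>i. i < length ts \<Longrightarrow> smgu ?F (ss ! i) (ts ! i) (\<Theta> i)" by metis
  obtain \<theta> where "smgu ?F (Fun f ss) (Fun f ts) \<theta>"
    by (rule smgu_Fun[OF s(2)[unfolded s'(1)] t(2)[unfolded t'(1)] disj[unfolded s'(1) t'(1)] len \<Theta>])
  then show thesis by (intro that) (simp only: s'(1) t'(1))
qed

text \<open>Every most general unifier arises from the constructed one by an injective renaming of its range.\<close>

lemma mgu_shape:
  assumes "smgu F s t \<theta>" and "is_mgu \<sigma> s t"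
  shows "linear_trm (s \<cdot> \<sigma>)"
    and "\<And>x. x \<in> vars s \<union> vars t \<Longrightarrow> vars (\<sigma> x) \<subseteq> vars s \<union> vars t \<and> funs (\<sigma> x) \<subseteq> F"
proof -
  have "substitution \<theta>" using smgu_is_mgu[OF assms(1)] unfolding is_mgu_def by blast
  moreover have "s \<cdot> \<theta> = t \<cdot> \<theta>" using assms(1) unfolding smgu_def by blast
  ultimately obtain \<delta> where \<delta>: "\<And>x. \<theta> x = \<sigma> x \<cdot> \<delta>" using assms(2) unfolding is_mgu_def by blast
  have "s \<cdot> \<sigma> = t \<cdot> \<sigma>" using assms(2) unfolding is_mgu_def by blast
  then have \<sigma>: "\<And>x. \<sigma> x = \<theta> x \<cdot> \<sigma>" using assms(1) unfolding smgu_def by blast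
  \<comment> \<open>On the range of \<theta>, \<delta> undoes \<sigma>: applying \<sigma> and then
    \<delta> to \<open>\<theta> x\<close> gives \<open>\<sigma> x \<cdot> \<delta>\<close>, which is
    \<open>\<theta> x\<close>. Hence \<sigma> maps the variables there injectively to
    variables.\<close>
  have ran: "\<exists>w. \<sigma> v = Var w \<and> \<delta> w = Var v" if "v \<in> vars (\<theta> x)" for v x
  proof -
    have "\<theta> x \<cdot> (\<lambda>v. \<sigma> v \<cdot> \<delta>) = \<theta> x \<cdot> \<sigma> \<cdot> \<delta>" by (rule subst_subst[symmetric])
    also have "\<dots> = \<sigma> x \<cdot> \<delta>" by (rule arg_cong[OF \<sigma>[symmetric]])
    also have "\<dots> = \<theta> x" by (rule \<delta>[symmetric])
    finally have "\<theta> x \<cdot> (\<lambda>v. \<sigma> v \<cdot> \<delta>) = \<theta> x \<cdot> Var" by (simp only: subst_Var)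
    then have "\<sigma> v \<cdot> \<delta> = Var v" unfolding subst_eq_iff using that by blast
    then show ?thesis by (cases "\<sigma> v") simp_all
  qed
  have s\<sigma>: "s \<cdot> \<sigma> = s \<cdot> \<theta> \<cdot> \<sigma>"
    unfolding subst_subst \<sigma>[symmetric] ..
  have "linear_trm (s \<cdot> \<theta> \<cdot> \<sigma>)"
  proof (rule linear_subst)
    show "linear_trm (s \<cdot> \<theta>)" using assms(1) unfolding smgu_def by blast
    have r: "\<exists>w. \<sigma> v = Var w \<and> \<delta> w = Var v" if "v \<in> vars (s \<cdot> \<theta>)" for v
      using that ran unfolding vars_subst by blast
    show "linear_trm (\<sigma> v)" if "v \<in> vars (s \<cdot> \<theta>)" for v
      using r[OF that] by auto
    show "vars (\<sigma> v) \<inter> vars (\<sigma> w) = {}" if "v \<in> vars (s \<cdot> \<theta>)" "w \<in> vars (s \<cdot> \<theta>)" "v \<noteq> w" for v w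
      using r[OF that(1)] r[OF that(2)] that(3) by auto
  qed
  then show "linear_trm (s \<cdot> \<sigma>)" by (simp only: s\<sigma>)
  fix x assume x: "x \<in> vars s \<union> vars t"
  have \<theta>x: "vars (\<theta> x) \<subseteq> vars s \<union> vars t" "funs (\<theta> x) \<subseteq> F"
    using assms(1) x unfolding smgu_def by blast+
  have "funs (\<sigma> v) = {}" if "v \<in> vars (\<theta> x)" for v using ran[OF that] by auto
  then have "funs (\<theta> x \<cdot> \<sigma>) \<subseteq> F" using \<theta>x(2) unfolding funs_subst by simp
  \<comment> \<open>A variable z outside \<open>s\<close> and \<open>t\<close> is fixed by \<sigma>
    and \<theta>, hence by \<delta>. If z occurred in \<open>\<sigma> v\<close> for some v in
    \<open>\<theta> x\<close>, then \<delta> would send z to v, so z would be v, a variable of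
    \<open>s\<close> or \<open>t\<close>.\<close>
  moreover have "z \<in> vars s \<union> vars t" if "z \<in> vars (\<theta> x \<cdot> \<sigma>)" for z
  proof (rule ccontr)
    assume z: "z \<notin> vars s \<union> vars t"
    then have "\<sigma> z = Var z" "\<theta> z = Var z"
      using assms unfolding smgu_def is_mgu_def dom_subst_def by blast+
    then have \<delta>z: "\<delta> z = Var z" using ran[of z z] by auto
    from that obtain v where v: "v \<in> vars (\<theta> x)" "z \<in> vars (\<sigma> v)" unfolding vars_subst by blast
    from ran[OF v(1)] v(2) have "\<delta> z = Var v" by auto
    with \<delta>z have "z = v" by simp
    with v(1) \<theta>x(1) z show False by blast
  qed
  ultimately show "vars (\<sigma> x) \<subseteq> vars s \<union> vars t \<and> funs (\<sigma> x) \<subseteq> F"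
    unfolding \<sigma>[symmetric] by blast
qed

end

section \<open>The difference of two overlapping patterns\<close>

text \<open>Only an mgu of the terms is assumed, not unifiability of the constrained terms, so that
  the locale also serves to derive the latter from a common instance.\<close>

locale overlap = lc_signature L for L :: "('s, 'f, 'v, 'u) lc_sig" +
  fixes s \<phi> t \<psi> :: "('f, 'v) trm" and \<sigma> :: "('f, 'v) sbst"
  assumes s: "is_pattern s" "linear_trm s" "value_free s"
    and t: "is_pattern t" "linear_trm t" "value_free t"
    and \<phi>: "is_constraint \<phi>" and \<psi>: "is_constraint \<psi>"
    and disjoint: "(vars s \<union> vars \<phi>) \<inter> (vars t \<union> vars \<psi>) = {}"
    and \<psi>_closed: "vars \<psi> \<subseteq> vars t"
    and mgu: "is_mgu \<sigma> s t"
begin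

text \<open>Literally the set of used variables in \<open>diff_pieces\<close>, so that
  \<open>pieces_eq\<close> holds by unfolding.\<close>

definition "X = vars s \<union> vars \<phi> \<union> vars t \<union> vars \<psi> \<union> (\<Union>x\<in>dom_subst \<sigma>. vars (\<sigma> x))"

section \<open>Behaviour of the mgu on terms and constraints\<close>

lemma unified: "s \<cdot> \<sigma> = t \<cdot> \<sigma>" and \<sigma>_sort: "has_sort (\<sigma> x) (var_sort L x)"
  using mgu unfolding is_mgu_def substitution_def by blast+

lemma linear_\<sigma>: "linear_trm (s \<cdot> \<sigma>)"
  and \<sigma>_range: "x \<in> vars s \<union> vars t \<Longrightarrow> vars (\<sigma> x) \<subseteq> vars s \<union> vars t"
  and \<sigma>_funs: "x \<in> vars s \<union> vars t \<Longrightarrow> funs (\<sigma> x) \<subseteq> constructors L - Val L"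
proof -
  obtain \<theta> where \<theta>: "smgu (constructors L - Val L) s t \<theta>"
  proof (rule pattern_smgu_exists[OF s t _ unified])
    show "vars s \<inter> vars t = {}" using disjoint by blast
  qed (rule that)
  show "linear_trm (s \<cdot> \<sigma>)" by (rule mgu_shape(1)[OF \<theta> mgu])
  show "vars (\<sigma> x) \<subseteq> vars s \<union> vars t" if "x \<in> vars s \<union> vars t"
    using mgu_shape(2)[OF \<theta> mgu that] by (rule conjunct1)
  show "funs (\<sigma> x) \<subseteq> constructors L - Val L" if "x \<in> vars s \<union> vars t"
    using mgu_shape(2)[OF \<theta> mgu that] by (rule conjunct2)
qed

lemma \<sigma>_outside: "x \<notin> vars s \<union> vars t \<Longrightarrow> \<sigma> x = Var x"
  using mgu unfolding is_mgu_def dom_subst_def by blast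

lemma \<sigma>_outside_\<phi>: "x \<in> vars \<phi> \<Longrightarrow> x \<notin> vars s \<Longrightarrow> \<sigma> x = Var x"
  by (rule \<sigma>_outside) (use disjoint in blast)

lemma \<sigma>_constraint_var:
  assumes "x \<in> vars \<phi> \<union> vars \<psi>"
  obtains y where "\<sigma> x = Var y" "var_sort L y = var_sort L x" "var_sort L x \<in> theory_sorts L"
proof (cases "x \<in> vars s \<union> vars t")
  case True
  have th: "var_sort L x \<in> theory_sorts L"
    using assms constraint_vars[OF \<phi>] constraint_vars[OF \<psi>] by blast
  obtain y where y: "\<sigma> x = Var y"
    by (rule theory_sorted_is_Var[OF \<sigma>_sort th \<sigma>_funs[OF True]])
  then show thesis using \<sigma>_sort[of x] th by (intro that[of y]) simp_all
next
  case False
  have th: "var_sort L x \<in> theory_sorts L"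
    using assms constraint_vars[OF \<phi>] constraint_vars[OF \<psi>] by blast
  then show thesis using \<sigma>_outside[OF False] by (intro that[of x]) simp_all
qed

lemma finite_X: "finite X"
proof -
  have "dom_subst \<sigma> \<subseteq> vars s \<union> vars t" using mgu unfolding is_mgu_def by blast
  then have "finite (dom_subst \<sigma>)" by (rule finite_subset) simp
  then show ?thesis unfolding X_def by simp
qed

lemma X_vars: "vars s \<subseteq> X" "vars \<phi> \<subseteq> X" "vars t \<subseteq> X" "vars \<psi> \<subseteq> X"
  unfolding X_def by blast+

lemma \<sigma>_X: "x \<in> vars s \<union> vars t \<Longrightarrow> vars (\<sigma> x) \<subseteq> X"
  using \<sigma>_range X_vars by blast

lemma \<phi>\<sigma>: "is_constraint (\<phi> \<cdot> \<sigma>)" and \<psi>\<sigma>: "is_constraint (\<psi> \<cdot> \<sigma>)"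
proof -
  have "\<exists>y. \<sigma> x = Var y \<and> var_sort L y = var_sort L x" if "x \<in> vars \<phi> \<union> vars \<psi>" for x
    by (rule \<sigma>_constraint_var[OF that]) blast
  then show "is_constraint (\<phi> \<cdot> \<sigma>)" "is_constraint (\<psi> \<cdot> \<sigma>)"
    by (auto intro!: is_constraint_subst \<phi> \<psi>)
qed

lemma vars_\<phi>\<sigma>: "vars (\<phi> \<cdot> \<sigma>) \<subseteq> X"
proof -
  have "vars (\<sigma> x) \<subseteq> X" if x: "x \<in> vars \<phi>" for x
  proof (cases "x \<in> vars s")
    case True
    then show ?thesis by (intro \<sigma>_X) simp
  next
    case False
    show ?thesis using \<sigma>_outside_\<phi>[OF x False] x X_vars(2) by auto
  qed
  then show ?thesis unfolding vars_subst by blast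
qed

lemma vars_\<psi>\<sigma>: "vars (\<psi> \<cdot> \<sigma>) \<subseteq> vars (s \<cdot> \<sigma>)"
  unfolding unified using \<psi>_closed unfolding vars_subst by blast

text \<open>The variables are disjoint, so the two matchers unite to a unifier of \<open>s\<close>
  and \<open>t\<close>, which factors through \<sigma>. Sorts matter because \<open>is_mgu\<close>
  compares with sorted unifiers only.\<close>

lemma common_instance:
  assumes "s \<cdot> \<gamma> = t \<cdot> \<gamma>'"
    and "\<And>x. x \<in> vars s \<Longrightarrow> has_sort (\<gamma> x) (var_sort L x)"
    and "\<And>x. x \<in> vars t \<Longrightarrow> has_sort (\<gamma>' x) (var_sort L x)"
  obtains \<delta> where "\<And>x. x \<in> vars s \<Longrightarrow> \<gamma> x = \<sigma> x \<cdot> \<delta>"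
proof -
  let ?\<tau> = "\<lambda>x. if x \<in> vars s then \<gamma> x else if x \<in> vars t then \<gamma>' x else Var x"
  have "s \<cdot> ?\<tau> = s \<cdot> \<gamma>" by (rule subst_cong) simp
  moreover have "t \<cdot> ?\<tau> = t \<cdot> \<gamma>'" by (rule subst_cong) (use disjoint in auto)
  ultimately have "s \<cdot> ?\<tau> = t \<cdot> ?\<tau>" using assms(1) by (simp only:)
  moreover have "substitution ?\<tau>" unfolding substitution_def using assms(2,3) by simp
  ultimately obtain \<delta> where \<delta>: "\<forall>x. ?\<tau> x = \<sigma> x \<cdot> \<delta>"
    using mgu unfolding is_mgu_def by blast
  show thesis
  proof (rule that)
    show "\<gamma> x = \<sigma> x \<cdot> \<delta>" if "x \<in> vars s" for x
      using \<delta>[rule_format, of x] that by simp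
  qed
qed

text \<open>This covers the members of \<^term>\<open>CoSub X \<sigma>\<close> as well as \<open>\<sigma>\<close> itself, so that all pieces of the
  difference can be treated alike.\<close>

definition admissible :: "('f, 'v) sbst \<Rightarrow> bool" where
  "admissible \<rho> \<longleftrightarrow> (\<forall>x\<in>vars s. \<rho> x \<in> Co X (\<sigma> x) \<union> {\<sigma> x}) \<and>
     (\<forall>x\<in>vars s. \<forall>y\<in>vars s. x \<noteq> y \<longrightarrow> vars (\<rho> x) \<inter> vars (\<rho> y) \<subseteq> X)"

lemma admissible_\<sigma>: "admissible \<sigma>"
  unfolding admissible_def using \<sigma>_X by blast

text \<open>Outside the common domain both substitutions are the identity, so there the freshness
  condition concerns a variable of \<open>s\<close>, which lies in \<open>X\<close>.\<close>

lemma CoSub_admissible: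
  assumes "\<rho> \<in> CoSub X \<sigma>" shows "admissible \<rho>"
proof -
  from assms have dom: "dom_subst \<rho> = dom_subst \<sigma>"
    and Co: "\<And>x. x \<in> dom_subst \<sigma> \<Longrightarrow> \<rho> x \<in> Co X (\<sigma> x) \<union> {\<sigma> x}"
    and fresh: "\<And>x y. x \<in> dom_subst \<sigma> \<Longrightarrow> y \<in> dom_subst \<sigma> \<Longrightarrow> x \<noteq> y \<Longrightarrow> vars (\<rho> x) \<inter> vars (\<rho> y) \<subseteq> X"
    unfolding CoSub_def by blast+
  have out: "\<rho> x = Var x \<and> \<sigma> x = Var x" if "x \<notin> dom_subst \<sigma>" for x
    using that dom unfolding dom_subst_def by blast
  have "\<rho> x \<in> Co X (\<sigma> x) \<union> {\<sigma> x}" for x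
    using Co[of x] out[of x] by (cases "x \<in> dom_subst \<sigma>") auto
  moreover have "vars (\<rho> x) \<inter> vars (\<rho> y) \<subseteq> X" if xy: "x \<in> vars s" "y \<in> vars s" "x \<noteq> y" for x y
  proof (cases "x \<in> dom_subst \<sigma> \<and> y \<in> dom_subst \<sigma>")
    case True
    then show ?thesis using fresh xy(3) by blast
  next
    case False
    then have "vars (\<rho> x) = {x} \<or> vars (\<rho> y) = {y}" using out[of x] out[of y] by auto
    then show ?thesis using xy X_vars(1) by auto
  qed
  ultimately show ?thesis unfolding admissible_def by blast
qed

lemma admissible_wf:
  assumes \<rho>: "admissible \<rho>" and x: "x \<in> vars s"
  shows "has_sort (\<rho> x) (var_sort L x)" "linear_trm (\<rho> x)" "funs (\<rho> x) \<subseteq> constructors L - Val L"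
    "vars (\<rho> x) \<inter> X \<subseteq> vars (\<sigma> x)"
proof -
  have x': "x \<in> vars s \<union> vars t" using x by blast
  have lin: "linear_trm (\<sigma> x)" by (rule linear_subst_D1[OF linear_\<sigma> x])
  have "has_sort (\<rho> x) (var_sort L x) \<and> linear_trm (\<rho> x) \<and> funs (\<rho> x) \<subseteq> constructors L - Val L \<and>
    vars (\<rho> x) \<inter> X \<subseteq> vars (\<sigma> x)"
  proof (cases "\<rho> x = \<sigma> x")
    case True
    show ?thesis unfolding True using \<sigma>_sort lin \<sigma>_funs[OF x'] by blast
  next
    case False
    then have "\<rho> x \<in> Co X (\<sigma> x)" using \<rho> x unfolding admissible_def by blast
    then show ?thesis by (rule Co_wf[OF _ \<sigma>_sort lin \<sigma>_funs[OF x'] \<sigma>_X[OF x']])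
  qed
  then show "has_sort (\<rho> x) (var_sort L x)" "linear_trm (\<rho> x)" "funs (\<rho> x) \<subseteq> constructors L - Val L"
    "vars (\<rho> x) \<inter> X \<subseteq> vars (\<sigma> x)" by blast+
qed

text \<open>A variable shared by \<open>\<rho> x\<close> and \<open>\<rho> y\<close> lies in
  \<open>X\<close>, hence in both \<open>\<sigma> x\<close> and \<open>\<sigma> y\<close>; these are
  disjoint as \<open>s \<cdot> \<sigma>\<close> is linear.\<close>

lemma admissible_linear:
  assumes \<rho>: "admissible \<rho>" shows "linear_trm (s \<cdot> \<rho>)"
proof (rule linear_subst[OF s(2) admissible_wf(2)[OF \<rho>]])
  fix x y assume xy: "x \<in> vars s" "y \<in> vars s" "x \<noteq> y"
  have "vars (\<sigma> x) \<inter> vars (\<sigma> y) = {}" by (rule linear_subst_D2[OF linear_\<sigma> xy])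
  moreover have "vars (\<rho> x) \<inter> vars (\<rho> y) \<subseteq> X" using \<rho> xy unfolding admissible_def by blast
  ultimately show "vars (\<rho> x) \<inter> vars (\<rho> y) = {}"
    using admissible_wf(4)[OF \<rho> xy(1)] admissible_wf(4)[OF \<rho> xy(2)] by blast
qed

lemma admissible_pattern:
  assumes \<rho>: "admissible \<rho>"
  shows "is_pattern (s \<cdot> \<rho>)" "value_free (s \<cdot> \<rho>)"
proof -
  have f: "funs (\<rho> x) \<subseteq> constructors L \<and> funs (\<rho> x) \<inter> Val L = {}" if "x \<in> vars s" for x
    using admissible_wf(3)[OF \<rho> that] by blast
  show "is_pattern (s \<cdot> \<rho>)"
    by (rule is_pattern_subst[OF s(1) admissible_wf(1)[OF \<rho>]]) (use f in blast)+
  show "value_free (s \<cdot> \<rho>)"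
    using f s(3) unfolding value_free_def funs_subst by blast
qed

lemma admissible_cterms: "admissible \<rho> \<Longrightarrow> is_constraint \<chi> \<Longrightarrow> (s \<cdot> \<rho>, \<chi>) \<in> cterms"
  using admissible_pattern(1)[of \<rho>] unfolding cterms_def is_pattern_def by blast

lemma admissible_old_vars:
  assumes \<rho>: "admissible \<rho>" shows "vars (s \<cdot> \<rho>) \<inter> X \<subseteq> vars s \<union> vars t"
proof -
  have "vars (\<rho> x) \<inter> X \<subseteq> vars s \<union> vars t" if x: "x \<in> vars s" for x
    using admissible_wf(4)[OF \<rho> x] \<sigma>_range[of x] x by blast
  then show ?thesis unfolding vars_subst by blast
qed

text \<open>\<sigma> maps a constraint variable to a variable, whose complement is empty. This is
  why the split pieces can carry \<phi>\<sigma> instead of a constraint depending on \<rho>.\<close>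

lemma admissible_constraint_var:
  assumes \<rho>: "admissible \<rho>" and x: "x \<in> vars s" "x \<in> vars \<phi>"
  shows "\<rho> x = \<sigma> x"
proof -
  obtain y where "\<sigma> x = Var y" by (rule \<sigma>_constraint_var[of x]) (use x in blast)
  then have "Co X (\<sigma> x) = {}" by simp
  then show ?thesis using \<rho> x(1) unfolding admissible_def by blast
qed

lemma \<phi>_var_inside:
  assumes \<rho>: "admissible \<rho>" and x: "x \<in> vars s" "x \<in> vars \<phi>" and y: "\<sigma> x = Var y"
  shows "\<rho> x = Var y" "y \<in> vars (s \<cdot> \<rho>)" "y \<in> vars (\<phi> \<cdot> \<sigma>)"
proof -
  show \<rho>x: "\<rho> x = Var y" using admissible_constraint_var[OF \<rho> x] y by simp
  then show "y \<in> vars (s \<cdot> \<rho>)" using x(1) unfolding vars_subst by force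
  show "y \<in> vars (\<phi> \<cdot> \<sigma>)" using x(2) y unfolding vars_subst by force
qed

text \<open>No capture: an implicitly quantified variable of \<phi> lies in \<open>X\<close> but
  neither in \<open>s\<close> nor, by disjointness, in \<open>t\<close>, whereas every old variable
  of \<open>s \<cdot> \<rho>\<close> lies in one of these.\<close>

lemma \<phi>_var_outside:
  assumes \<rho>: "admissible \<rho>" and x: "x \<in> vars \<phi>" "x \<notin> vars s"
  shows "x \<notin> vars (s \<cdot> \<rho>)"
  using admissible_old_vars[OF \<rho>] x X_vars(2) disjoint by blast

lemma gc_subst_universe:
  "gc_subst V \<delta> \<Longrightarrow> y \<in> V \<Longrightarrow> var_sort L y \<in> theory_sorts L \<Longrightarrow>
    ground_eval (\<delta> y) \<in> universe L (var_sort L y)"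
  unfolding gc_subst_def by (rule ground_eval_universe) blast+

lemma piece_complete:
  assumes \<rho>: "admissible \<rho>" and \<gamma>: "gc_subst (vars s) \<gamma>" and \<beta>: "solves s \<phi> \<gamma> \<beta>"
    and inst: "\<And>x. x \<in> vars s \<Longrightarrow> \<exists>d. \<gamma> x = \<rho> x \<cdot> d"
  obtains \<delta> \<beta>' where "s \<cdot> \<gamma> = s \<cdot> \<rho> \<cdot> \<delta>" "gc_subst (vars (s \<cdot> \<rho>)) \<delta>"
    "solves (s \<cdot> \<rho>) (\<phi> \<cdot> \<sigma>) \<delta> \<beta>'" "\<And>y. y \<in> vars (s \<cdot> \<rho>) \<Longrightarrow> \<beta>' y = ground_eval (\<delta> y)"
proof -
  obtain \<delta> where \<delta>: "\<And>x. x \<in> vars s \<Longrightarrow> \<gamma> x = \<rho> x \<cdot> \<delta>"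
    by (rule subst_instance[OF admissible_linear[OF \<rho>] inst]) blast+
  have gc: "gc_subst (vars (s \<cdot> \<rho>)) \<delta>"
    unfolding gc_subst_def
  proof
    fix y assume "y \<in> vars (s \<cdot> \<rho>)"
    then obtain x where x: "x \<in> vars s" "y \<in> vars (\<rho> x)" unfolding vars_subst by blast
    have g: "has_sort (\<rho> x \<cdot> \<delta>) (var_sort L x)" "funs (\<rho> x \<cdot> \<delta>) \<subseteq> constructors L" "vars (\<rho> x \<cdot> \<delta>) = {}"
      using \<gamma> x(1) unfolding gc_subst_def \<delta>[OF x(1), symmetric] by blast+
    show "has_sort (\<delta> y) (var_sort L y) \<and> funs (\<delta> y) \<subseteq> constructors L \<and> vars (\<delta> y) = {}"
      using has_sort_subst_D[OF admissible_wf(1)[OF \<rho> x(1)] g(1) x(2)] g(2,3) x(2)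
      unfolding funs_subst vars_subst by blast
  qed
  \<comment> \<open>Variables of \<open>s \<cdot> \<rho>\<close> get their value from \<delta> even
    if absent from \<phi>\<sigma>, so that \<psi>\<sigma> can be evaluated under the same valuation.
    The other variables of \<phi>\<sigma> are quantified ones, fixed by \<sigma>, and keep their
    witnesses.\<close>
  define \<beta>' where "\<beta>' = (\<lambda>y. if y \<in> vars (s \<cdot> \<rho>) then ground_eval (\<delta> y) else \<beta> y)"
  have \<beta>s: "\<beta> x = ground_eval (\<gamma> x)" if "x \<in> vars s" "x \<in> vars \<phi>" for x
    using \<beta> that unfolding solves_def by blast
  have key: "eval \<beta>' (\<sigma> x) = \<beta> x" if x: "x \<in> vars \<phi>" for x
  proof (cases "x \<in> vars s")
    case True
    obtain y where y: "\<sigma> x = Var y" by (rule \<sigma>_constraint_var[of x]) (use x in blast)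
    have "\<gamma> x = \<delta> y" using \<delta>[OF True] \<phi>_var_inside(1)[OF \<rho> True x y] by simp
    then show ?thesis using \<phi>_var_inside(2)[OF \<rho> True x y] y \<beta>s[OF True x] by (simp add: \<beta>'_def)
  next
    case False
    show ?thesis using \<sigma>_outside_\<phi>[OF x False] \<phi>_var_outside[OF \<rho> x False] by (simp add: \<beta>'_def)
  qed
  have "eval \<beta>' (\<phi> \<cdot> \<sigma>) = eval \<beta> \<phi>"
    unfolding eval_subst by (rule eval_cong) (rule key)
  then have "eval \<beta>' (\<phi> \<cdot> \<sigma>) = truth L True" using \<beta> unfolding solves_def by simp
  moreover have "val_on (vars (\<phi> \<cdot> \<sigma>)) \<beta>'"
    unfolding val_on_def
  proof
    fix y assume "y \<in> vars (\<phi> \<cdot> \<sigma>)"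
    then obtain x where x: "x \<in> vars \<phi>" "y \<in> vars (\<sigma> x)" unfolding vars_subst by blast
    obtain z where z: "\<sigma> x = Var z" "var_sort L z = var_sort L x"
      by (rule \<sigma>_constraint_var[of x]) (use x in blast)+
    have "\<beta>' y = \<beta> x" "var_sort L y = var_sort L x" using key[OF x(1)] x(2) z by auto
    then show "\<beta>' y \<in> universe L (var_sort L y)" using \<beta> x(1) unfolding solves_def val_on_def by simp
  qed
  ultimately have "solves (s \<cdot> \<rho>) (\<phi> \<cdot> \<sigma>) \<delta> \<beta>'" unfolding solves_def by (simp add: \<beta>'_def)
  moreover have "s \<cdot> \<gamma> = s \<cdot> \<rho> \<cdot> \<delta>" unfolding subst_subst by (rule subst_cong) (rule \<delta>)
  moreover have "\<beta>' y = ground_eval (\<delta> y)" if "y \<in> vars (s \<cdot> \<rho>)" for y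
    using that by (simp add: \<beta>'_def)
  ultimately show thesis using gc by (intro that[of \<delta> \<beta>'])
qed

text \<open>The witness for \<phi> is \<beta> read through \<sigma>; it fits the matcher of
  \<open>s\<close> because \<rho> and \<sigma> agree on the variables shared by \<open>s\<close> and
  \<phi>.\<close>

lemma piece_sound:
  assumes \<rho>: "admissible \<rho>" and \<delta>: "gc_subst (vars (s \<cdot> \<rho>)) \<delta>"
    and \<beta>: "solves (s \<cdot> \<rho>) (\<phi> \<cdot> \<sigma>) \<delta> \<beta>"
  shows "gc_subst (vars s) (\<lambda>x. \<rho> x \<cdot> \<delta>)" "s \<cdot> \<rho> \<cdot> \<delta> \<in> GC1 (s, \<phi>)"
proof -
  show gc: "gc_subst (vars s) (\<lambda>x. \<rho> x \<cdot> \<delta>)"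
    unfolding gc_subst_def
  proof
    fix x assume x: "x \<in> vars s"
    have \<delta>': "has_sort (\<delta> y) (var_sort L y) \<and> funs (\<delta> y) \<subseteq> constructors L \<and> vars (\<delta> y) = {}"
      if "y \<in> vars (\<rho> x)" for y
      using \<delta> x that unfolding gc_subst_def vars_subst by blast
    have "has_sort (\<rho> x \<cdot> \<delta>) (var_sort L x)"
      by (rule has_sort_subst[OF admissible_wf(1)[OF \<rho> x]]) (use \<delta>' in blast)
    then show "has_sort (\<rho> x \<cdot> \<delta>) (var_sort L x) \<and> funs (\<rho> x \<cdot> \<delta>) \<subseteq> constructors L \<and> vars (\<rho> x \<cdot> \<delta>) = {}"
      using \<delta>' admissible_wf(3)[OF \<rho> x] unfolding funs_subst vars_subst by blast
  qed
  have "val_on (vars \<phi>) (\<lambda>x. eval \<beta> (\<sigma> x))"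
    unfolding val_on_def
  proof
    fix x assume x: "x \<in> vars \<phi>"
    obtain y where y: "\<sigma> x = Var y" "var_sort L y = var_sort L x"
      by (rule \<sigma>_constraint_var[of x]) (use x in blast)+
    have "y \<in> vars (\<phi> \<cdot> \<sigma>)" using x y(1) unfolding vars_subst by force
    then show "eval \<beta> (\<sigma> x) \<in> universe L (var_sort L x)"
      using \<beta> y unfolding solves_def val_on_def by auto
  qed
  moreover have "eval \<beta> (\<sigma> x) = ground_eval (\<rho> x \<cdot> \<delta>)" if x: "x \<in> vars s" "x \<in> vars \<phi>" for x
  proof -
    obtain y where y: "\<sigma> x = Var y" by (rule \<sigma>_constraint_var[of x]) (use x in blast)
    note in_ = \<phi>_var_inside[OF \<rho> x y]
    have "\<beta> y = ground_eval (\<delta> y)" using \<beta> in_(2,3) unfolding solves_def by blast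
    then show ?thesis by (simp add: y in_(1))
  qed
  moreover have "eval (\<lambda>x. eval \<beta> (\<sigma> x)) \<phi> = truth L True"
    using \<beta> unfolding solves_def eval_subst by blast
  ultimately have "solves s \<phi> (\<lambda>x. \<rho> x \<cdot> \<delta>) (\<lambda>x. eval \<beta> (\<sigma> x))" unfolding solves_def by blast
  then show "s \<cdot> \<rho> \<cdot> \<delta> \<in> GC1 (s, \<phi>)"
    unfolding GC1_iff[OF \<phi>] subst_subst using gc by blast
qed

text \<open>Since \<open>vars \<psi> \<subseteq> vars t\<close>, the instance leaves no variable of
  \<psi>\<sigma> open: \<delta> determines the truth value. This is what lets the negation of
  \<psi>\<sigma> describe exactly the instances outside \<open>GC1 (t, \<psi>)\<close>.\<close>

lemma \<psi>\<sigma>_iff: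
  assumes \<delta>: "gc_subst (vars (s \<cdot> \<sigma>)) \<delta>" and \<beta>: "\<And>y. y \<in> vars (\<psi> \<cdot> \<sigma>) \<Longrightarrow> \<beta> y = ground_eval (\<delta> y)"
  shows "val_on (vars (\<psi> \<cdot> \<sigma>)) \<beta>"
    and "eval \<beta> (\<psi> \<cdot> \<sigma>) = truth L True \<longleftrightarrow> s \<cdot> \<sigma> \<cdot> \<delta> \<in> GC1 (t, \<psi>)"
proof -
  show val: "val_on (vars (\<psi> \<cdot> \<sigma>)) \<beta>"
    unfolding val_on_def
  proof
    fix y assume y: "y \<in> vars (\<psi> \<cdot> \<sigma>)"
    show "\<beta> y \<in> universe L (var_sort L y)"
      unfolding \<beta>[OF y] using \<delta> vars_\<psi>\<sigma> y constraint_vars[OF \<psi>\<sigma> y] by (intro gc_subst_universe) blast+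
  qed
  have key: "eval \<beta> (\<sigma> x) = ground_eval (\<sigma> x \<cdot> \<delta>) \<and> eval \<beta> (\<sigma> x) \<in> universe L (var_sort L x)"
    if x: "x \<in> vars \<psi>" for x
  proof -
    obtain y where y: "\<sigma> x = Var y" "var_sort L y = var_sort L x"
      by (rule \<sigma>_constraint_var[of x]) (use x in blast)+
    have "y \<in> vars (\<psi> \<cdot> \<sigma>)" using x y(1) unfolding vars_subst by force
    then show ?thesis using \<beta> y val unfolding val_on_def by auto
  qed
  have s\<sigma>\<delta>: "s \<cdot> \<sigma> \<cdot> \<delta> = t \<cdot> (\<lambda>x. \<sigma> x \<cdot> \<delta>)" unfolding unified subst_subst ..
  show "eval \<beta> (\<psi> \<cdot> \<sigma>) = truth L True \<longleftrightarrow> s \<cdot> \<sigma> \<cdot> \<delta> \<in> GC1 (t, \<psi>)"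
  proof
    assume ev: "eval \<beta> (\<psi> \<cdot> \<sigma>) = truth L True"
    have "gc_subst (vars t) (\<lambda>x. \<sigma> x \<cdot> \<delta>)"
      unfolding gc_subst_def
    proof
      fix x assume x: "x \<in> vars t"
      have \<delta>': "has_sort (\<delta> y) (var_sort L y) \<and> funs (\<delta> y) \<subseteq> constructors L \<and> vars (\<delta> y) = {}"
        if "y \<in> vars (\<sigma> x)" for y
        using \<delta> x that unfolding gc_subst_def unified vars_subst by blast
      have "has_sort (\<sigma> x \<cdot> \<delta>) (var_sort L x)"
        by (rule has_sort_subst[OF \<sigma>_sort]) (use \<delta>' in blast)
      then show "has_sort (\<sigma> x \<cdot> \<delta>) (var_sort L x) \<and> funs (\<sigma> x \<cdot> \<delta>) \<subseteq> constructors L \<and> vars (\<sigma> x \<cdot> \<delta>) = {}"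
        using \<delta>' \<sigma>_funs[of x] x unfolding funs_subst vars_subst by blast
    qed
    moreover have "solves t \<psi> (\<lambda>x. \<sigma> x \<cdot> \<delta>) (\<lambda>x. eval \<beta> (\<sigma> x))"
      using key ev unfolding solves_def val_on_def eval_subst by blast
    ultimately show "s \<cdot> \<sigma> \<cdot> \<delta> \<in> GC1 (t, \<psi>)" unfolding s\<sigma>\<delta> GC1_iff[OF \<psi>] by blast
  next
    assume "s \<cdot> \<sigma> \<cdot> \<delta> \<in> GC1 (t, \<psi>)"
    then obtain \<gamma> \<beta>' where \<gamma>: "t \<cdot> (\<lambda>x. \<sigma> x \<cdot> \<delta>) = t \<cdot> \<gamma>" and \<beta>': "solves t \<psi> \<gamma> \<beta>'"
      unfolding s\<sigma>\<delta> GC1_iff[OF \<psi>] by blast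
    have "eval \<beta> (\<sigma> x) = \<beta>' x" if x: "x \<in> vars \<psi>" for x
    proof -
      have xt: "x \<in> vars t" using x \<psi>_closed by blast
      have "\<beta>' x = ground_eval (\<gamma> x)" using \<beta>' x xt unfolding solves_def by blast
      moreover have "\<sigma> x \<cdot> \<delta> = \<gamma> x" using \<gamma> xt unfolding subst_eq_iff by blast
      ultimately show ?thesis using key[OF x] by simp
    qed
    then have "eval \<beta> (\<psi> \<cdot> \<sigma>) = eval \<beta>' \<psi>" unfolding eval_subst by (intro eval_cong)
    then show "eval \<beta> (\<psi> \<cdot> \<sigma>) = truth L True" using \<beta>' unfolding solves_def by simp
  qed
qed

section \<open>The pieces and their ground instances\<close>

abbreviation remainder :: "('f, 'v) trm" where
  "remainder \<equiv> Conj (\<phi> \<cdot> \<sigma>) (Neg (\<psi> \<cdot> \<sigma>))"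

abbreviation pieces :: "(('f, 'v) trm \<times> ('f, 'v) trm) set" where
  "pieces \<equiv> diff_pieces \<sigma> (s, \<phi>) (t, \<psi>)"

lemma pieces_eq:
  "pieces = {(s \<cdot> \<rho>, \<phi> \<cdot> \<sigma>) | \<rho>. \<rho> \<in> CoSub X \<sigma> \<and> s \<cdot> \<rho> \<noteq> s \<cdot> \<sigma>} \<union>
     {c. c = (s \<cdot> \<sigma>, remainder) \<and> satisfiable (snd c)}"
  unfolding diff_pieces_def prod.case Let_def X_def ..

lemma piece_cases:
  assumes "c \<in> pieces"
  obtains (split) \<rho> where "c = (s \<cdot> \<rho>, \<phi> \<cdot> \<sigma>)" "\<rho> \<in> CoSub X \<sigma>" "s \<cdot> \<rho> \<noteq> s \<cdot> \<sigma>"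
  | (rest) "c = (s \<cdot> \<sigma>, remainder)"
  using assms unfolding pieces_eq by blast

lemma remainder: "is_constraint remainder"
  by (intro is_constraint_Conj is_constraint_Neg \<phi>\<sigma> \<psi>\<sigma>)

lemma vars_remainder: "vars remainder = vars (\<phi> \<cdot> \<sigma>) \<union> vars (\<psi> \<cdot> \<sigma>)"
  by simp

lemma pieces_cterms: "pieces \<subseteq> cterms"
proof
  fix c assume "c \<in> pieces"
  then show "c \<in> cterms"
  proof (cases rule: piece_cases)
    case (split \<rho>)
    show ?thesis unfolding split(1) by (rule admissible_cterms[OF CoSub_admissible[OF split(2)] \<phi>\<sigma>])
  next
    case rest
    show ?thesis unfolding rest by (rule admissible_cterms[OF admissible_\<sigma> remainder])
  qed
qed

text \<open>All variables of \<psi>\<sigma> occur in \<open>s \<cdot> \<sigma>\<close>, so a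
  solution of the remainder agrees with \<delta> on them, which is the premise of
  \<open>\<psi>\<sigma>_iff\<close>.\<close>

lemma solves_remainder:
  "solves (s \<cdot> \<sigma>) remainder \<delta> \<beta> \<longleftrightarrow> solves (s \<cdot> \<sigma>) (\<phi> \<cdot> \<sigma>) \<delta> \<beta> \<and> val_on (vars (\<psi> \<cdot> \<sigma>)) \<beta> \<and>
     (\<forall>y\<in>vars (\<psi> \<cdot> \<sigma>). \<beta> y = ground_eval (\<delta> y)) \<and> eval \<beta> (\<psi> \<cdot> \<sigma>) \<noteq> truth L True"
proof (cases "val_on (vars (\<phi> \<cdot> \<sigma>) \<union> vars (\<psi> \<cdot> \<sigma>)) \<beta>")
  case True
  then have v: "val_on (vars (\<phi> \<cdot> \<sigma>)) \<beta>" "val_on (vars (\<psi> \<cdot> \<sigma>)) \<beta>" by (simp_all add: val_on_def)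
  have "val_on (vars (\<phi> \<cdot> \<sigma>) \<union> vars (Neg (\<psi> \<cdot> \<sigma>))) \<beta>" using True by simp
  from eval_Conj[OF \<phi>\<sigma> is_constraint_Neg[OF \<psi>\<sigma>] this] eval_Neg[OF \<psi>\<sigma> v(2)]
  have "eval \<beta> remainder = truth L True \<longleftrightarrow>
      eval \<beta> (\<phi> \<cdot> \<sigma>) = truth L True \<and> eval \<beta> (\<psi> \<cdot> \<sigma>) \<noteq> truth L True" by (simp only:)
  then show ?thesis
    unfolding solves_def vars_remainder using True v vars_\<psi>\<sigma> by blast
next
  case False
  then show ?thesis unfolding solves_def vars_remainder val_on_def by blast
qed

lemma neq_on_s:
  assumes "s \<cdot> \<rho> \<noteq> s \<cdot> \<sigma>" "admissible \<rho>"
  obtains x where "x \<in> vars s" "\<rho> x \<in> Co X (\<sigma> x)"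
  using assms unfolding subst_eq_iff admissible_def by blast

text \<open>Complements are chosen one variable at a time, each avoiding the fresh variables of the
  earlier ones, as the last condition of \<open>CoSub\<close> requires.\<close>

lemma choose_complements:
  assumes "finite B"
  shows "B \<subseteq> vars s \<Longrightarrow> gc_subst (vars s) \<gamma> \<Longrightarrow> (\<And>x. x \<in> B \<Longrightarrow> \<nexists>d. \<gamma> x = \<sigma> x \<cdot> d) \<Longrightarrow>
    \<exists>r. (\<forall>x\<in>B. r x \<in> Co X (\<sigma> x) \<and> (\<exists>d. \<gamma> x = r x \<cdot> d)) \<and>
      (\<forall>x\<in>B. \<forall>y\<in>B. x \<noteq> y \<longrightarrow> vars (r x) \<inter> vars (r y) \<subseteq> X)"
  using assms
proof (induction B)
  case (insert b B)
  have "\<exists>r. (\<forall>x\<in>B. r x \<in> Co X (\<sigma> x) \<and> (\<exists>d. \<gamma> x = r x \<cdot> d)) \<and>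
      (\<forall>x\<in>B. \<forall>y\<in>B. x \<noteq> y \<longrightarrow> vars (r x) \<inter> vars (r y) \<subseteq> X)"
    by (rule insert.IH) (use insert.prems in blast)+
  then obtain r where r: "\<And>x. x \<in> B \<Longrightarrow> r x \<in> Co X (\<sigma> x) \<and> (\<exists>d. \<gamma> x = r x \<cdot> d)"
    "\<And>x y. x \<in> B \<Longrightarrow> y \<in> B \<Longrightarrow> x \<noteq> y \<Longrightarrow> vars (r x) \<inter> vars (r y) \<subseteq> X" by blast
  let ?Y = "\<Union>x\<in>B. vars (r x)"
  have b: "b \<in> vars s" "b \<in> vars s \<union> vars t" using insert.prems(1) by auto
  have "\<exists>u'\<in>Co X (\<sigma> b). vars u' \<inter> ?Y \<subseteq> X \<and> (\<exists>d. \<gamma> b = u' \<cdot> d)"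
  proof (rule Co_complete[OF finite_X])
    show "finite ?Y" using insert.hyps(1) by simp
    show "has_sort (\<sigma> b) (var_sort L b)" by (rule \<sigma>_sort)
    show "linear_trm (\<sigma> b)" by (rule linear_subst_D1[OF linear_\<sigma> b(1)])
    show "has_sort (\<gamma> b) (var_sort L b)" "funs (\<gamma> b) \<subseteq> constructors L" "vars (\<gamma> b) = {}"
      using insert.prems(2) b(1) unfolding gc_subst_def by blast+
    show "\<nexists>d. \<gamma> b = \<sigma> b \<cdot> d" using insert.prems(3) by blast
  qed (rule \<sigma>_funs[OF b(2)] \<sigma>_X[OF b(2)])+
  then obtain u where u: "u \<in> Co X (\<sigma> b)" "vars u \<inter> ?Y \<subseteq> X" "\<exists>d. \<gamma> b = u \<cdot> d" by blast
  let ?r = "r(b := u)"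
  have same: "?r x = r x" if "x \<in> B" for x using that insert.hyps(2) by auto
  have "?r x \<in> Co X (\<sigma> x) \<and> (\<exists>d. \<gamma> x = ?r x \<cdot> d)" if "x \<in> insert b B" for x
  proof (cases "x = b")
    case True
    show ?thesis unfolding True fun_upd_same using u by blast
  next
    case False
    then have "x \<in> B" using that by simp
    then show ?thesis unfolding same[OF \<open>x \<in> B\<close>] by (rule r(1))
  qed
  moreover have "vars (?r x) \<inter> vars (?r y) \<subseteq> X"
    if xy: "x \<in> insert b B" "y \<in> insert b B" "x \<noteq> y" for x y
  proof -
    consider "x = b" "y \<in> B" | "y = b" "x \<in> B" | "x \<in> B" "y \<in> B" using xy by blast
    then show ?thesis
    proof cases
      case 1
      show ?thesis unfolding 1(1) fun_upd_same same[OF 1(2)] using u(2) 1(2) by blast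
    next
      case 2
      show ?thesis unfolding 2(1) fun_upd_same same[OF 2(2)] using u(2) 2(2) by blast
    next
      case 3
      show ?thesis unfolding same[OF 3(1)] same[OF 3(2)] using r(2) 3 xy(3) by blast
    qed
  qed
  ultimately show ?case by blast
qed simp

text \<open>\<open>\<rho>\<close> departs from \<sigma> exactly at those variables of
  \<open>s\<close> where \<gamma> is not an instance of \<sigma>; \<open>x0\<close> is one of them,
  so the departure is visible on \<open>s\<close>.\<close>

lemma CoSub_exists:
  assumes \<gamma>: "gc_subst (vars s) \<gamma>" and bad: "x0 \<in> vars s" "\<nexists>d. \<gamma> x0 = \<sigma> x0 \<cdot> d"
  obtains \<rho> where "\<rho> \<in> CoSub X \<sigma>" "s \<cdot> \<rho> \<noteq> s \<cdot> \<sigma>" "\<And>x. x \<in> vars s \<Longrightarrow> \<exists>d. \<gamma> x = \<rho> x \<cdot> d"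
proof -
  let ?B = "{x \<in> vars s. \<nexists>d. \<gamma> x = \<sigma> x \<cdot> d}"
  have "\<exists>r. (\<forall>x\<in>?B. r x \<in> Co X (\<sigma> x) \<and> (\<exists>d. \<gamma> x = r x \<cdot> d)) \<and>
      (\<forall>x\<in>?B. \<forall>y\<in>?B. x \<noteq> y \<longrightarrow> vars (r x) \<inter> vars (r y) \<subseteq> X)"
    by (rule choose_complements[OF _ _ \<gamma>]) simp_all
  then obtain r where r: "\<And>x. x \<in> ?B \<Longrightarrow> r x \<in> Co X (\<sigma> x) \<and> (\<exists>d. \<gamma> x = r x \<cdot> d)"
    "\<And>x y. x \<in> ?B \<Longrightarrow> y \<in> ?B \<Longrightarrow> x \<noteq> y \<Longrightarrow> vars (r x) \<inter> vars (r y) \<subseteq> X" by blast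
  define \<rho> where "\<rho> = (\<lambda>x. if x \<in> ?B then r x else \<sigma> x)"
  have \<rho>B: "\<rho> x = r x" if "x \<in> ?B" for x unfolding \<rho>_def using that by (rule if_P)
  have \<rho>nB: "\<rho> x = \<sigma> x" if "x \<notin> ?B" for x unfolding \<rho>_def using that by (rule if_not_P)
  \<comment> \<open>\<open>CoSub\<close> asks for equal domains. A variable matches everything, so
    \<sigma> fixes no \<open>x\<close> in \<open>?B\<close>; nor does \<rho>, since
    \<open>Var x\<close> would have a common instance with \<open>\<sigma> x\<close>, against
    \<open>Co_no_instance\<close>.\<close>
  have B\<sigma>: "\<sigma> x \<noteq> Var x" if "x \<in> ?B" for x
  proof
    assume "\<sigma> x = Var x"
    then have "\<gamma> x = \<sigma> x \<cdot> \<gamma>" by simp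
    with that show False by blast
  qed
  have B\<rho>: "\<rho> x \<noteq> Var x" if "x \<in> ?B" for x
  proof
    assume "\<rho> x = Var x"
    then have rx: "Var x \<in> Co X (\<sigma> x)" using r(1)[OF that] \<rho>B[OF that] by simp
    have "Var x \<cdot> (\<lambda>_. \<sigma> x) \<noteq> \<sigma> x \<cdot> Var" by (rule Co_no_instance[OF rx])
    then show False by simp
  qed
  have dom: "dom_subst \<rho> = dom_subst \<sigma>"
  proof -
    have "\<rho> x = Var x \<longleftrightarrow> \<sigma> x = Var x" for x
    proof (cases "x \<in> ?B")
      case True
      show ?thesis using B\<sigma>[OF True] B\<rho>[OF True] by (simp only:)
    next
      case False
      show ?thesis unfolding \<rho>nB[OF False] ..
    qed
    then show ?thesis unfolding dom_subst_def by simp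
  qed
  have inst: "\<exists>d. \<gamma> x = \<rho> x \<cdot> d" if "x \<in> vars s" for x
  proof (cases "x \<in> ?B")
    case True
    show ?thesis unfolding \<rho>B[OF True] using r(1)[OF True] by blast
  next
    case False
    show ?thesis unfolding \<rho>nB[OF False] using False that by blast
  qed
  have "\<rho> x0 \<noteq> \<sigma> x0" using inst[OF bad(1)] bad(2) by metis
  then have ne: "s \<cdot> \<rho> \<noteq> s \<cdot> \<sigma>" unfolding subst_eq_iff using bad(1) by blast
  then have "\<rho> \<noteq> \<sigma>" by metis
  moreover have "\<rho> x \<in> Co X (\<sigma> x) \<union> {\<sigma> x}" for x
    using r(1)[of x] \<rho>B[of x] \<rho>nB[of x] by (cases "x \<in> ?B") auto
  moreover have "vars (\<rho> x) \<inter> vars (\<rho> y) \<subseteq> X"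
    if xy: "x \<in> dom_subst \<sigma>" "y \<in> dom_subst \<sigma>" "x \<noteq> y" for x y
  proof -
    have "vars (\<sigma> z) \<subseteq> X" if "z \<in> dom_subst \<sigma>" for z
      unfolding X_def using that by blast
    then have "z \<in> ?B \<or> vars (\<rho> z) \<subseteq> X" if "z \<in> dom_subst \<sigma>" for z
      using that \<rho>nB[of z] by (cases "z \<in> ?B") auto
    then consider "x \<in> ?B" "y \<in> ?B" | "vars (\<rho> x) \<subseteq> X" | "vars (\<rho> y) \<subseteq> X" using xy by blast
    then show ?thesis
    proof cases
      case 1
      show ?thesis unfolding \<rho>B[OF 1(1)] \<rho>B[OF 1(2)] by (rule r(2)[OF 1 xy(3)])
    qed blast+
  qed
  ultimately have "\<rho> \<in> CoSub X \<sigma>" unfolding CoSub_def mem_Collect_eq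
    by (intro conjI ballI impI) (use dom in \<open>simp_all only: not_False_eq_True\<close>)
  then show thesis using ne inst by (rule that)
qed

lemma GC_pieces: "(\<Union>c\<in>pieces. GC1 c) = GC1 (s, \<phi>) - GC1 (t, \<psi>)"
proof (intro equalityI subsetI)
  fix g assume "g \<in> (\<Union>c\<in>pieces. GC1 c)"
  then obtain c where c: "c \<in> pieces" "g \<in> GC1 c" by blast
  from c(1) show "g \<in> GC1 (s, \<phi>) - GC1 (t, \<psi>)"
  proof (cases rule: piece_cases)
    case (split \<rho>)
    have \<rho>: "admissible \<rho>" by (rule CoSub_admissible[OF split(2)])
    from c(2) obtain \<delta> \<beta> where g: "g = s \<cdot> \<rho> \<cdot> \<delta>" and \<delta>: "gc_subst (vars (s \<cdot> \<rho>)) \<delta>"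
      and \<beta>: "solves (s \<cdot> \<rho>) (\<phi> \<cdot> \<sigma>) \<delta> \<beta>" unfolding split(1) GC1_iff[OF \<phi>\<sigma>] by blast
    note sound = piece_sound[OF \<rho> \<delta> \<beta>]
    have "g \<notin> GC1 (t, \<psi>)"
    proof
      assume "g \<in> GC1 (t, \<psi>)"
      then obtain \<gamma> where \<gamma>: "g = t \<cdot> \<gamma>" "gc_subst (vars t) \<gamma>" unfolding GC1_iff[OF \<psi>] by blast
      \<comment> \<open>At this variable \<rho> takes a complement. A common instance with
        \<open>t\<close> factors through \<sigma>, so \<open>\<rho> x\<close> and
        \<open>\<sigma> x\<close> would have a common instance.\<close>
      obtain x where x: "x \<in> vars s" "\<rho> x \<in> Co X (\<sigma> x)" by (rule neq_on_s[OF split(3) \<rho>])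
      have "s \<cdot> (\<lambda>x. \<rho> x \<cdot> \<delta>) = t \<cdot> \<gamma>" using g \<gamma>(1) unfolding subst_subst by (simp only:)
      then obtain \<delta>' where "\<And>x. x \<in> vars s \<Longrightarrow> \<rho> x \<cdot> \<delta> = \<sigma> x \<cdot> \<delta>'"
        by (rule common_instance) (use sound(1) \<gamma>(2) in \<open>unfold gc_subst_def, blast\<close>)+
      then show False using Co_no_instance[OF x(2)] x(1) by blast
    qed
    then show ?thesis using sound(2) unfolding g by blast
  next
    case rest
    from c(2) obtain \<delta> \<beta> where g: "g = s \<cdot> \<sigma> \<cdot> \<delta>" and \<delta>: "gc_subst (vars (s \<cdot> \<sigma>)) \<delta>"
      and \<beta>: "solves (s \<cdot> \<sigma>) remainder \<delta> \<beta>" unfolding rest GC1_iff[OF remainder] by blast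
    from \<beta> have \<beta>': "solves (s \<cdot> \<sigma>) (\<phi> \<cdot> \<sigma>) \<delta> \<beta>" "\<And>y. y \<in> vars (\<psi> \<cdot> \<sigma>) \<Longrightarrow> \<beta> y = ground_eval (\<delta> y)"
      "eval \<beta> (\<psi> \<cdot> \<sigma>) \<noteq> truth L True" unfolding solves_remainder by blast+
    from \<psi>\<sigma>_iff(2)[OF \<delta> \<beta>'(2)] \<beta>'(3) piece_sound(2)[OF admissible_\<sigma> \<delta> \<beta>'(1)]
    show ?thesis unfolding g by blast
  qed
next
  fix g assume g: "g \<in> GC1 (s, \<phi>) - GC1 (t, \<psi>)"
  then have "g \<in> GC1 (s, \<phi>)" by (rule DiffD1)
  then obtain \<gamma> \<beta> where g\<gamma>: "g = s \<cdot> \<gamma>" and \<gamma>: "gc_subst (vars s) \<gamma>" and \<beta>: "solves s \<phi> \<gamma> \<beta>"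
    unfolding GC1_iff[OF \<phi>] by blast
  show "g \<in> (\<Union>c\<in>pieces. GC1 c)"
  proof (cases "\<forall>x\<in>vars s. \<exists>d. \<gamma> x = \<sigma> x \<cdot> d")
    case True
    then have "\<And>x. x \<in> vars s \<Longrightarrow> \<exists>d. \<gamma> x = \<sigma> x \<cdot> d" by blast
    from piece_complete[OF admissible_\<sigma> \<gamma> \<beta> this] obtain \<delta> \<beta>' where
      \<delta>: "s \<cdot> \<gamma> = s \<cdot> \<sigma> \<cdot> \<delta>" "gc_subst (vars (s \<cdot> \<sigma>)) \<delta>" and \<beta>': "solves (s \<cdot> \<sigma>) (\<phi> \<cdot> \<sigma>) \<delta> \<beta>'"
      "\<And>y. y \<in> vars (s \<cdot> \<sigma>) \<Longrightarrow> \<beta>' y = ground_eval (\<delta> y)" by metis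
    have \<beta>\<psi>: "\<beta>' y = ground_eval (\<delta> y)" if "y \<in> vars (\<psi> \<cdot> \<sigma>)" for y
      by (rule \<beta>'(2)) (use that vars_\<psi>\<sigma> in blast)
    have "eval \<beta>' (\<psi> \<cdot> \<sigma>) \<noteq> truth L True"
      using \<psi>\<sigma>_iff(2)[OF \<delta>(2) \<beta>\<psi>] g unfolding g\<gamma> \<delta>(1) by blast
    then have sr: "solves (s \<cdot> \<sigma>) remainder \<delta> \<beta>'"
      unfolding solves_remainder using \<beta>'(1) \<psi>\<sigma>_iff(1)[OF \<delta>(2) \<beta>\<psi>] \<beta>\<psi> by blast
    then have "satisfiable remainder" unfolding satisfiable_iff[OF remainder] solves_def by blast
    then have "(s \<cdot> \<sigma>, remainder) \<in> pieces" unfolding pieces_eq by simp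
    moreover have "g \<in> GC1 (s \<cdot> \<sigma>, remainder)"
      unfolding GC1_iff[OF remainder] g\<gamma> \<delta>(1) using \<delta>(2) sr by blast
    ultimately show ?thesis by blast
  next
    case False
    then obtain x0 where "x0 \<in> vars s" "\<nexists>d. \<gamma> x0 = \<sigma> x0 \<cdot> d" by blast
    from CoSub_exists[OF \<gamma> this] obtain \<rho> where \<rho>: "\<rho> \<in> CoSub X \<sigma>" "s \<cdot> \<rho> \<noteq> s \<cdot> \<sigma>"
      "\<And>x. x \<in> vars s \<Longrightarrow> \<exists>d. \<gamma> x = \<rho> x \<cdot> d" by metis
    from piece_complete[OF CoSub_admissible[OF \<rho>(1)] \<gamma> \<beta> \<rho>(3)] obtain \<delta> \<beta>' where
      \<delta>: "s \<cdot> \<gamma> = s \<cdot> \<rho> \<cdot> \<delta>" "gc_subst (vars (s \<cdot> \<rho>)) \<delta>" and \<beta>': "solves (s \<cdot> \<rho>) (\<phi> \<cdot> \<sigma>) \<delta> \<beta>'"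
      by metis
    have "(s \<cdot> \<rho>, \<phi> \<cdot> \<sigma>) \<in> pieces" unfolding pieces_eq using \<rho>(1,2) by blast
    moreover have "g \<in> GC1 (s \<cdot> \<rho>, \<phi> \<cdot> \<sigma>)"
      unfolding GC1_iff[OF \<phi>\<sigma>] g\<gamma> \<delta>(1) using \<delta>(2) \<beta>' by blast
    ultimately show ?thesis by blast
  qed
qed

section \<open>Overlaps and finiteness of the pieces up to equivalence\<close>

lemma skel_eq_pieces:
  assumes "admissible \<rho>1" "admissible \<rho>2" "\<And>x. x \<in> vars s \<Longrightarrow> skel X (\<rho>1 x) = skel X (\<rho>2 x)"
  shows "((s \<cdot> \<rho>1, \<phi> \<cdot> \<sigma>), (s \<cdot> \<rho>2, \<phi> \<cdot> \<sigma>)) \<in> doteq"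
proof (rule skel_eq_doteq[OF admissible_linear[OF assms(1)] admissible_linear[OF assms(2)]
      admissible_cterms[OF assms(1) \<phi>\<sigma>] finite_X vars_\<phi>\<sigma>])
  show "skel X (s \<cdot> \<rho>1) = skel X (s \<cdot> \<rho>2)"
    unfolding skel_def by (rule map_trm_subst_cong) (use assms(3) in \<open>simp only: skel_def\<close>)
qed

text \<open>If exactly one of the two equals \<open>\<sigma> x\<close>, the other is a complement of
  it and there is no common instance; two complements fall under \<open>Co_skel_eq\<close>.\<close>

lemma admissible_skel_eq:
  assumes \<rho>: "admissible \<rho>1" "admissible \<rho>2" and x: "x \<in> vars s" and eq: "\<rho>1 x \<cdot> \<delta>1 = \<rho>2 x \<cdot> \<delta>2"
  shows "skel X (\<rho>1 x) = skel X (\<rho>2 x)"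
proof -
  from \<rho> x consider "\<rho>1 x = \<sigma> x" "\<rho>2 x = \<sigma> x" | "\<rho>1 x = \<sigma> x" "\<rho>2 x \<in> Co X (\<sigma> x)"
    | "\<rho>1 x \<in> Co X (\<sigma> x)" "\<rho>2 x = \<sigma> x" | "\<rho>1 x \<in> Co X (\<sigma> x)" "\<rho>2 x \<in> Co X (\<sigma> x)"
    unfolding admissible_def by blast
  then show ?thesis
  proof cases
    case 1
    then show ?thesis by (simp only:)
  next
    case 2
    show ?thesis using Co_no_instance[OF 2(2), of \<delta>2 \<delta>1] eq unfolding 2(1) by metis
  next
    case 3
    show ?thesis using Co_no_instance[OF 3(1), of \<delta>1 \<delta>2] eq unfolding 3(2) by metis
  next
    case 4
    show ?thesis by (rule Co_skel_eq[OF 4 eq])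
  qed
qed

lemma split_rest_disjoint:
  assumes "\<rho> \<in> CoSub X \<sigma>" "s \<cdot> \<rho> \<noteq> s \<cdot> \<sigma>"
  shows "s \<cdot> \<rho> \<cdot> \<delta> \<noteq> s \<cdot> \<sigma> \<cdot> \<delta>'"
proof -
  obtain x where x: "x \<in> vars s" "\<rho> x \<in> Co X (\<sigma> x)"
    by (rule neq_on_s[OF assms(2) CoSub_admissible[OF assms(1)]])
  then show ?thesis unfolding subst_subst subst_eq_iff using Co_no_instance by blast
qed

lemma pieces_overlap_doteq:
  assumes c: "c \<in> pieces" and d: "d \<in> pieces" and g: "g \<in> GC1 c" "g \<in> GC1 d"
  shows "(c, d) \<in> doteq"
  using c
proof (cases rule: piece_cases)
  case 1: (split \<rho>1)
  obtain \<delta>1 where g1: "g = s \<cdot> \<rho>1 \<cdot> \<delta>1" using GC1_instance[OF \<phi>\<sigma>] g(1) unfolding 1(1) by blast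
  from d show ?thesis
  proof (cases rule: piece_cases)
    case 2: (split \<rho>2)
    obtain \<delta>2 where g2: "g = s \<cdot> \<rho>2 \<cdot> \<delta>2" using GC1_instance[OF \<phi>\<sigma>] g(2) unfolding 2(1) by blast
    note \<rho>1 = CoSub_admissible[OF 1(2)] and \<rho>2 = CoSub_admissible[OF 2(2)]
    have "s \<cdot> (\<lambda>x. \<rho>1 x \<cdot> \<delta>1) = s \<cdot> (\<lambda>x. \<rho>2 x \<cdot> \<delta>2)" using g1 g2 unfolding subst_subst by (simp only:)
    then have eq: "\<rho>1 x \<cdot> \<delta>1 = \<rho>2 x \<cdot> \<delta>2" if "x \<in> vars s" for x
      unfolding subst_eq_iff using that by blast
    show ?thesis
      unfolding 1(1) 2(1) by (rule skel_eq_pieces[OF \<rho>1 \<rho>2 admissible_skel_eq[OF \<rho>1 \<rho>2 _ eq]])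
  next
    case rest
    obtain \<delta>2 where "g = s \<cdot> \<sigma> \<cdot> \<delta>2" using GC1_instance[OF remainder] g(2) unfolding rest by blast
    then show ?thesis using split_rest_disjoint[OF 1(2,3)] g1 by metis
  qed
next
  case 1: rest
  obtain \<delta>1 where g1: "g = s \<cdot> \<sigma> \<cdot> \<delta>1" using GC1_instance[OF remainder] g(1) unfolding 1 by blast
  from d show ?thesis
  proof (cases rule: piece_cases)
    case 2: (split \<rho>2)
    obtain \<delta>2 where "g = s \<cdot> \<rho>2 \<cdot> \<delta>2" using GC1_instance[OF \<phi>\<sigma>] g(2) unfolding 2(1) by blast
    then show ?thesis using split_rest_disjoint[OF 2(2,3)] g1 by metis
  next
    case rest
    show ?thesis unfolding 1 rest by (rule doteq_refl[OF admissible_cterms[OF admissible_\<sigma> remainder]])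
  qed
qed

lemma pieces_non_overlapping: "pairwise_non_overlapping (pieces // doteq)"
  unfolding pairwise_non_overlapping_def
proof (rule pairwiseI)
  fix p q assume pq: "p \<in> pieces // doteq" "q \<in> pieces // doteq" "p \<noteq> q"
  obtain c where c: "p = doteq `` {c}" "c \<in> pieces" by (rule quotientE[OF pq(1)])
  obtain d where d: "q = doteq `` {d}" "d \<in> pieces" by (rule quotientE[OF pq(2)])
  have "(c, d) \<notin> doteq" using pq(3) equiv_class_eq[OF equiv_doteq] unfolding c(1) d(1) by blast
  then have "GC1 c \<inter> GC1 d = {}" using pieces_overlap_doteq[OF c(2) d(2)] by blast
  moreover have "c \<in> cterms" "d \<in> cterms" using c(2) d(2) pieces_cterms by blast+
  ultimately show "GC {p} \<inter> GC {q} = {}" unfolding c(1) d(1) by (simp only: GC_doteq_class)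
qed

text \<open>The class of a split piece depends only on the skeletons of \<open>\<rho> x\<close> for
  \<open>x\<close> in \<open>s\<close>, a tuple from a finite product; the remainder adds at most
  one class. \<open>restrict\<close> makes these tuples members of \<open>PiE\<close>.\<close>

lemma finite_pieces: "finite (pieces // doteq)"
proof -
  let ?A = "{\<rho> \<in> CoSub X \<sigma>. s \<cdot> \<rho> \<noteq> s \<cdot> \<sigma>}"
  let ?k = "\<lambda>\<rho>. doteq `` {(s \<cdot> \<rho>, \<phi> \<cdot> \<sigma>)}"
  let ?h = "\<lambda>\<rho>. restrict (\<lambda>x. skel X (\<rho> x)) (vars s)"
  let ?S = "\<lambda>x. insert (skel X (\<sigma> x)) (skel X ` Co X (\<sigma> x))"
  have "?h \<rho> \<in> PiE (vars s) ?S" if "\<rho> \<in> ?A" for \<rho>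
  proof (rule restrict_PiE_iff[THEN iffD2], rule ballI)
    fix x assume x: "x \<in> vars s"
    have "\<rho> \<in> CoSub X \<sigma>" using that by simp
    from CoSub_admissible[OF this] x have "\<rho> x \<in> Co X (\<sigma> x) \<union> {\<sigma> x}"
      unfolding admissible_def by (elim conjE) (rule bspec)
    then show "skel X (\<rho> x) \<in> ?S x" by (rule UnE) simp_all
  qed
  then have "?h ` ?A \<subseteq> PiE (vars s) ?S" by (rule image_subsetI)
  moreover have "finite (?S x)" if "x \<in> vars s" for x
    using finite_skel_Co[OF \<sigma>_funs, of x X] that by simp
  then have "finite (PiE (vars s) ?S)" by (intro finite_PiE) simp_all
  ultimately have "finite (?h ` ?A)" by (rule finite_subset)
  then have fin: "finite (?k ` ?A)"
  proof (rule finite_image_factor)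
    fix \<rho>1 \<rho>2 assume \<rho>: "\<rho>1 \<in> ?A" "\<rho>2 \<in> ?A" and eq: "?h \<rho>1 = ?h \<rho>2"
    show "?k \<rho>1 = ?k \<rho>2"
    proof (rule equiv_class_eq[OF equiv_doteq], rule skel_eq_pieces)
      show "admissible \<rho>1" "admissible \<rho>2"
        by (rule CoSub_admissible; use \<rho> in simp)+
      show "skel X (\<rho>1 x) = skel X (\<rho>2 x)" if "x \<in> vars s" for x
        using fun_cong[OF eq, of x] that by (simp only: restrict_apply')
    qed
  qed
  have "pieces // doteq \<subseteq> insert (doteq `` {(s \<cdot> \<sigma>, remainder)}) (?k ` ?A)"
  proof
    fix p assume "p \<in> pieces // doteq"
    then obtain c where c: "p = doteq `` {c}" "c \<in> pieces" by (rule quotientE)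
    from c(2) show "p \<in> insert (doteq `` {(s \<cdot> \<sigma>, remainder)}) (?k ` ?A)"
    proof (cases rule: piece_cases)
      case (split \<rho>)
      then show ?thesis unfolding c(1) by blast
    next
      case rest
      show ?thesis unfolding c(1) rest by (rule insertI1)
    qed
  qed
  then show ?thesis by (rule finite_subset) (simp only: finite_insert fin)
qed

section \<open>Pattern properties and closed representatives of the pieces\<close>

lemma pieces_lin_vf:
  assumes "p \<in> pieces // doteq" shows "lin_vf_cpattern p"
proof -
  obtain c where c: "p = doteq `` {c}" "c \<in> pieces" by (rule quotientE[OF assms])
  have adm: "lin_vf_cpattern (doteq `` {(s \<cdot> \<rho>, \<chi>)})" if "admissible \<rho>" "is_constraint \<chi>" for \<rho> \<chi>
    by (rule lin_vf_cpattern_class[OF admissible_cterms[OF that] admissible_pattern(1)[OF that(1)]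
        admissible_linear[OF that(1)] admissible_pattern(2)[OF that(1)]])
  from c(2) show ?thesis
  proof (cases rule: piece_cases)
    case (split \<rho>)
    show ?thesis unfolding c(1) split(1) by (rule adm[OF CoSub_admissible[OF split(2)] \<phi>\<sigma>])
  next
    case rest
    show ?thesis unfolding c(1) rest by (rule adm[OF admissible_\<sigma> remainder])
  qed
qed

text \<open>Quantified variables of \<phi> are fixed by \<sigma> and not captured by
  \<open>s \<cdot> \<rho>\<close>, so substitution commutes with the implicit quantifiers. The
  valuation is pulled back on \<open>vars \<phi>\<close> only, where \<sigma> yields
  variables.\<close>

lemma holds_piece:
  assumes \<rho>: "admissible \<rho>" and \<alpha>: "valuation \<alpha>"
  shows "holds (s \<cdot> \<rho>) (\<phi> \<cdot> \<sigma>) \<alpha> \<longleftrightarrow> holds s \<phi> (\<lambda>x. if x \<in> vars \<phi> then eval \<alpha> (\<sigma> x) else \<alpha> x)"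
    (is "_ \<longleftrightarrow> holds s \<phi> ?\<alpha>")
proof
  assume "holds (s \<cdot> \<rho>) (\<phi> \<cdot> \<sigma>) \<alpha>"
  then obtain \<beta> where \<beta>: "val_on (vars (\<phi> \<cdot> \<sigma>)) \<beta>" "\<And>y. y \<in> vars (s \<cdot> \<rho>) \<Longrightarrow> y \<in> vars (\<phi> \<cdot> \<sigma>) \<Longrightarrow> \<beta> y = \<alpha> y"
    "eval \<beta> (\<phi> \<cdot> \<sigma>) = truth L True" unfolding holds_def by blast
  have "val_on (vars \<phi>) (\<lambda>x. eval \<beta> (\<sigma> x))"
    unfolding val_on_def
  proof
    fix x assume x: "x \<in> vars \<phi>"
    obtain y where y: "\<sigma> x = Var y" "var_sort L y = var_sort L x"
      by (rule \<sigma>_constraint_var[of x]) (use x in blast)+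
    have "y \<in> vars (\<phi> \<cdot> \<sigma>)" using x y(1) unfolding vars_subst by force
    then show "eval \<beta> (\<sigma> x) \<in> universe L (var_sort L x)" using \<beta>(1) y unfolding val_on_def by auto
  qed
  moreover have "eval \<beta> (\<sigma> x) = ?\<alpha> x" if x: "x \<in> vars s \<inter> vars \<phi>" for x
  proof -
    obtain y where y: "\<sigma> x = Var y" by (rule \<sigma>_constraint_var[of x]) (use x in blast)
    have x': "x \<in> vars s" "x \<in> vars \<phi>" using x by blast+
    show ?thesis using \<beta>(2)[OF \<phi>_var_inside(2,3)[OF \<rho> x' y]] y x' by simp
  qed
  ultimately show "holds s \<phi> ?\<alpha>" unfolding holds_def using \<beta>(3) unfolding eval_subst by blast
next
  assume "holds s \<phi> ?\<alpha>"
  then obtain \<beta> where \<beta>: "val_on (vars \<phi>) \<beta>" "\<forall>x\<in>vars s \<inter> vars \<phi>. \<beta> x = ?\<alpha> x"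
    "eval \<beta> \<phi> = truth L True" unfolding holds_def by (elim exE conjE)
  define \<beta>' where "\<beta>' = (\<lambda>y. if y \<in> vars (s \<cdot> \<rho>) then \<alpha> y else \<beta> y)"
  have key: "eval \<beta>' (\<sigma> x) = \<beta> x" if x: "x \<in> vars \<phi>" for x
  proof (cases "x \<in> vars s")
    case True
    obtain y where y: "\<sigma> x = Var y" by (rule \<sigma>_constraint_var[of x]) (use x in blast)
    have "\<beta> x = ?\<alpha> x" using \<beta>(2) True x by blast
    then show ?thesis using \<phi>_var_inside(2)[OF \<rho> True x y] y x by (simp add: \<beta>'_def)
  next
    case False
    show ?thesis using \<sigma>_outside_\<phi>[OF x False] \<phi>_var_outside[OF \<rho> x False] by (simp add: \<beta>'_def)
  qed
  have "eval \<beta>' (\<phi> \<cdot> \<sigma>) = eval \<beta> \<phi>"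
    unfolding eval_subst by (rule eval_cong) (rule key)
  moreover have "val_on (vars (\<phi> \<cdot> \<sigma>)) \<beta>'"
    unfolding val_on_def
  proof
    fix y assume "y \<in> vars (\<phi> \<cdot> \<sigma>)"
    then obtain x where x: "x \<in> vars \<phi>" "y \<in> vars (\<sigma> x)" unfolding vars_subst by blast
    obtain z where z: "\<sigma> x = Var z" "var_sort L z = var_sort L x"
      by (rule \<sigma>_constraint_var[of x]) (use x in blast)+
    have "\<beta>' y = \<beta> x" "var_sort L y = var_sort L x" using key[OF x(1)] x(2) z by auto
    then show "\<beta>' y \<in> universe L (var_sort L y)" using \<beta>(1) x(1) unfolding val_on_def by simp
  qed
  moreover have "\<beta>' y = \<alpha> y" if "y \<in> vars (s \<cdot> \<rho>)" for y using that by (simp add: \<beta>'_def)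
  ultimately show "holds (s \<cdot> \<rho>) (\<phi> \<cdot> \<sigma>) \<alpha>" unfolding holds_def using \<beta>(3) by auto
qed

text \<open>Closing and substituting commute by \<open>holds_piece\<close>. The shared variables are
  the right ones because \<rho> and \<sigma> agree where \<open>s\<close> and \<phi> meet, and
  quantified variables stay outside \<open>s \<cdot> \<rho>\<close>.\<close>

lemma closure_piece:
  assumes cl: "closure_of s \<phi> \<chi>" and \<rho>: "admissible \<rho>"
  shows "closure_of (s \<cdot> \<rho>) (\<phi> \<cdot> \<sigma>) (\<chi> \<cdot> \<sigma>)"
proof -
  from cl have \<chi>: "is_constraint \<chi>" "vars \<chi> = vars s \<inter> vars \<phi>"
    and h: "\<And>\<alpha>. valuation \<alpha> \<Longrightarrow> holds s \<phi> \<alpha> = (eval \<alpha> \<chi> = truth L True)"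
    unfolding closure_of_def by blast+
  show ?thesis
    unfolding closure_of_def
  proof (intro conjI allI impI)
    show "is_constraint (\<chi> \<cdot> \<sigma>)"
    proof (rule is_constraint_subst[OF \<chi>(1)])
      fix x assume "x \<in> vars \<chi>"
      then have x: "x \<in> vars \<phi> \<union> vars \<psi>" using \<chi>(2) by blast
      show "\<exists>y. \<sigma> x = Var y \<and> var_sort L y = var_sort L x" by (rule \<sigma>_constraint_var[OF x]) blast
    qed
    show "vars (\<chi> \<cdot> \<sigma>) = vars (s \<cdot> \<rho>) \<inter> vars (\<phi> \<cdot> \<sigma>)"
    proof (intro equalityI subsetI)
      fix y assume "y \<in> vars (\<chi> \<cdot> \<sigma>)"
      then obtain x where x: "x \<in> vars s" "x \<in> vars \<phi>" "y \<in> vars (\<sigma> x)" unfolding vars_subst \<chi>(2) by blast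
      then show "y \<in> vars (s \<cdot> \<rho>) \<inter> vars (\<phi> \<cdot> \<sigma>)"
        using admissible_constraint_var[OF \<rho> x(1,2)] unfolding vars_subst by (metis IntI UN_I)
    next
      fix y assume y: "y \<in> vars (s \<cdot> \<rho>) \<inter> vars (\<phi> \<cdot> \<sigma>)"
      then obtain x where x: "x \<in> vars \<phi>" "y \<in> vars (\<sigma> x)" unfolding vars_subst by blast
      have "x \<in> vars s"
      proof (rule ccontr)
        assume nx: "x \<notin> vars s"
        have "y = x" using \<sigma>_outside_\<phi>[OF x(1) nx] x(2) by simp
        then show False using \<phi>_var_outside[OF \<rho> x(1) nx] y by blast
      qed
      then show "y \<in> vars (\<chi> \<cdot> \<sigma>)" unfolding vars_subst \<chi>(2) using x by blast
    qed
    fix \<alpha> assume \<alpha>: "valuation \<alpha>"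
    let ?\<alpha> = "\<lambda>x. if x \<in> vars \<phi> then eval \<alpha> (\<sigma> x) else \<alpha> x"
    have "valuation ?\<alpha>"
      unfolding valuation_def
    proof (intro allI impI)
      fix x assume th: "var_sort L x \<in> theory_sorts L"
      show "?\<alpha> x \<in> universe L (var_sort L x)"
      proof (cases "x \<in> vars \<phi>")
        case True
        obtain y where "\<sigma> x = Var y" "var_sort L y = var_sort L x"
          by (rule \<sigma>_constraint_var[of x]) (use True in blast)+
        then show ?thesis using True \<alpha> th unfolding valuation_def by (metis eval.simps(1))
      next
        case False
        then show ?thesis using \<alpha> th unfolding valuation_def by simp
      qed
    qed
    from h[OF this] holds_piece[OF \<rho> \<alpha>]
    have "holds (s \<cdot> \<rho>) (\<phi> \<cdot> \<sigma>) \<alpha> = (eval ?\<alpha> \<chi> = truth L True)" by (simp only:)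
    moreover have "eval \<alpha> (\<chi> \<cdot> \<sigma>) = eval ?\<alpha> \<chi>"
      unfolding eval_subst by (rule eval_cong) (simp add: \<chi>(2))
    ultimately show "holds (s \<cdot> \<rho>) (\<phi> \<cdot> \<sigma>) \<alpha> = (eval \<alpha> (\<chi> \<cdot> \<sigma>) = truth L True)" by (simp only:)
  qed
qed

text \<open>Pieces enter the next step of the difference of sets, where their constraints may be
  negated in turn.\<close>

lemma pieces_closed_rep:
  assumes "p \<in> pieces // doteq" and cl: "closure_of s \<phi> \<chi>"
  shows "has_closed_rep p"
proof -
  obtain c where c: "p = doteq `` {c}" "c \<in> pieces" by (rule quotientE[OF assms(1)])
  from c(2) show ?thesis
  proof (cases rule: piece_cases)
    case (split \<rho>)
    note \<rho> = CoSub_admissible[OF split(2)]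
    show ?thesis
      unfolding c(1) split(1) by (rule has_closed_rep_class[OF admissible_cterms[OF \<rho> \<phi>\<sigma>] closure_piece[OF cl \<rho>]])
  next
    case rest
    have "closure_of (s \<cdot> \<sigma>) remainder (Conj (\<chi> \<cdot> \<sigma>) (Neg (\<psi> \<cdot> \<sigma>)))"
      by (rule closure_Conj[OF \<phi>\<sigma> closure_piece[OF cl admissible_\<sigma>] is_constraint_Neg[OF \<psi>\<sigma>]])
        (use vars_\<psi>\<sigma> in simp)
    then show ?thesis
      unfolding c(1) rest by (rule has_closed_rep_class[OF admissible_cterms[OF admissible_\<sigma> remainder]])
  qed
qed

end

section \<open>Differences of sets\<close>

context lc_signature
begin

lemma lin_vf_cpatternD:
  assumes "lin_vf_cpattern p" "(t, \<psi>) \<in> p"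
  shows "is_pattern t" "linear_trm t" "value_free t" "is_constraint \<psi>" "(t, \<psi>) \<in> cterms"
proof -
  from assms show "is_pattern t" "linear_trm t" "value_free t" unfolding lin_vf_cpattern_def by blast+
  have p: "p \<in> cterms // doteq" using assms(1) unfolding lin_vf_cpattern_def by blast
  show ct: "(t, \<psi>) \<in> cterms"
    using in_quotient_imp_subset[OF equiv_doteq p] assms(2) by blast
  then show "is_constraint \<psi>" by (simp add: cterms_def)
qed

lemma overlapI:
  assumes p: "lin_vf_cpattern p" "(s, \<phi>) \<in> p" and q: "lin_vf_cpattern q" "(t, \<psi>) \<in> q"
    and "(vars s \<union> vars \<phi>) \<inter> (vars t \<union> vars \<psi>) = {}" "vars \<psi> \<subseteq> vars t" "is_mgu \<sigma> s t"
  shows "overlap L s \<phi> t \<psi> \<sigma>"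
  by (intro overlap.intro[OF lc_signature_axioms] overlap_axioms.intro
      lin_vf_cpatternD[OF p] lin_vf_cpatternD[OF q] assms(5-7))

text \<open>A common instance supplies all that unifiability asks for: a unifier, hence an mgu, and
  a valuation making both constraints true.\<close>

lemma not_unifiable_disjoint:
  assumes p: "lin_vf_cpattern p" "(s, \<phi>) \<in> p" and q: "lin_vf_cpattern q" "(t, \<psi>) \<in> q"
    and disj: "(vars s \<union> vars \<phi>) \<inter> (vars t \<union> vars \<psi>) = {}" and closed: "vars \<psi> \<subseteq> vars t"
    and nu: "\<not> unifiable (s, \<phi>) (t, \<psi>)"
  shows "GC1 (s, \<phi>) \<inter> GC1 (t, \<psi>) = {}"
proof (rule ccontr)
  assume "GC1 (s, \<phi>) \<inter> GC1 (t, \<psi>) \<noteq> {}"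
  then obtain g where g: "g \<in> GC1 (s, \<phi>)" "g \<in> GC1 (t, \<psi>)" by blast
  note s = lin_vf_cpatternD[OF p] and t = lin_vf_cpatternD[OF q]
  obtain \<gamma> \<beta> where \<gamma>: "g = s \<cdot> \<gamma>" "gc_subst (vars s) \<gamma>" and \<beta>: "solves s \<phi> \<gamma> \<beta>"
    using g(1) unfolding GC1_iff[OF s(4)] by blast
  obtain \<gamma>' where \<gamma>': "g = t \<cdot> \<gamma>'" "gc_subst (vars t) \<gamma>'"
    using g(2) unfolding GC1_iff[OF t(4)] by blast
  let ?\<tau> = "\<lambda>x. if x \<in> vars s then \<gamma> x else \<gamma>' x"
  have "s \<cdot> ?\<tau> = s \<cdot> \<gamma>" by (rule subst_cong) simp
  moreover have "t \<cdot> ?\<tau> = t \<cdot> \<gamma>'" by (rule subst_cong) (use disj in auto)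
  ultimately have uni: "s \<cdot> ?\<tau> = t \<cdot> ?\<tau>" using \<gamma>(1) \<gamma>'(1) by (simp only:)
  obtain \<theta> where "smgu (constructors L - Val L) s t \<theta>"
  proof (rule pattern_smgu_exists[OF s(1-3) t(1-3) _ uni])
    show "vars s \<inter> vars t = {}" using disj by blast
  qed (rule that)
  then have mgu: "is_mgu \<theta> s t" by (rule smgu_is_mgu)
  interpret overlap L s \<phi> t \<psi> \<theta>
    by (rule overlapI[OF p q disj closed mgu])
  have st: "s \<cdot> \<gamma> = t \<cdot> \<gamma>'" using \<gamma>(1) \<gamma>'(1) by (simp only:)
  obtain d where d: "\<And>x. x \<in> vars s \<Longrightarrow> \<gamma> x = \<theta> x \<cdot> d"
    by (rule common_instance[OF st]) (use \<gamma>(2) \<gamma>'(2) in \<open>unfold gc_subst_def, blast\<close>)+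
  have inst: "\<exists>d. \<gamma> x = \<theta> x \<cdot> d" if "x \<in> vars s" for x using d[OF that] by blast
  from piece_complete[OF admissible_\<sigma> \<gamma>(2) \<beta> inst] obtain \<delta> \<beta>' where
    \<delta>: "s \<cdot> \<gamma> = s \<cdot> \<theta> \<cdot> \<delta>" "gc_subst (vars (s \<cdot> \<theta>)) \<delta>" and \<beta>': "solves (s \<cdot> \<theta>) (\<phi> \<cdot> \<theta>) \<delta> \<beta>'"
    "\<And>y. y \<in> vars (s \<cdot> \<theta>) \<Longrightarrow> \<beta>' y = ground_eval (\<delta> y)" by metis
  have \<beta>\<psi>: "\<beta>' y = ground_eval (\<delta> y)" if "y \<in> vars (\<psi> \<cdot> \<theta>)" for y
    by (rule \<beta>'(2)) (use that vars_\<psi>\<sigma> in blast)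
  have "eval \<beta>' (\<psi> \<cdot> \<theta>) = truth L True"
    using \<psi>\<sigma>_iff(2)[OF \<delta>(2) \<beta>\<psi>] g(2) unfolding \<gamma>(1) \<delta>(1) by blast
  moreover have val: "val_on (vars (\<phi> \<cdot> \<theta>) \<union> vars (\<psi> \<cdot> \<theta>)) \<beta>'"
    using \<beta>'(1) \<psi>\<sigma>_iff(1)[OF \<delta>(2) \<beta>\<psi>] unfolding solves_def val_on_def by blast
  moreover have "eval \<beta>' (\<phi> \<cdot> \<theta>) = truth L True" using \<beta>'(1) unfolding solves_def by blast
  ultimately have "eval \<beta>' (Conj (\<phi> \<cdot> \<theta>) (\<psi> \<cdot> \<theta>)) = truth L True"
    using eval_Conj[OF \<phi>\<sigma> \<psi>\<sigma> val] by blast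
  moreover have "val_on (vars (Conj (\<phi> \<cdot> \<theta>) (\<psi> \<cdot> \<theta>))) \<beta>'" using val by simp
  ultimately have "satisfiable (Conj (\<phi> \<cdot> \<theta>) (\<psi> \<cdot> \<theta>))"
    unfolding satisfiable_iff[OF is_constraint_Conj[OF \<phi>\<sigma> \<psi>\<sigma>]] by blast
  moreover have "\<forall>x\<in>vars \<phi> \<union> vars \<psi>. is_value (\<theta> x) \<or> (\<exists>y. \<theta> x = Var y)"
  proof
    fix x assume "x \<in> vars \<phi> \<union> vars \<psi>"
    then obtain y where "\<theta> x = Var y" by (rule \<sigma>_constraint_var)
    then show "is_value (\<theta> x) \<or> (\<exists>y. \<theta> x = Var y)" by blast
  qed
  ultimately have "unifiable (s, \<phi>) (t, \<psi>)"
    unfolding unifiable_def prod.case using mgu by blast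
  with nu show False by blast
qed

lemma diff_two_correct:
  assumes diff: "diff_two p q D" and p: "lin_vf_cpattern p" "has_closed_rep p" and q: "lin_vf_cpattern q"
  shows "finite D" "\<forall>d\<in>D. lin_vf_cpattern d \<and> has_closed_rep d" "pairwise_non_overlapping D"
    "GC D = GC {p} - GC {q}"
proof -
  from diff obtain s \<phi> t \<psi> where sp: "(s, \<phi>) \<in> p" and tq: "(t, \<psi>) \<in> q"
    and disj: "(vars s \<union> vars \<phi>) \<inter> (vars t \<union> vars \<psi>) = {}" and closed: "vars \<psi> \<subseteq> vars t"
    and D: "if unifiable (s, \<phi>) (t, \<psi>) then \<exists>\<sigma>. is_mgu \<sigma> s t \<and> D = diff_pieces \<sigma> (s, \<phi>) (t, \<psi>) // doteq
      else D = {p}"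
    unfolding diff_two_def by blast
  have pc: "p \<in> cterms // doteq" and qc: "q \<in> cterms // doteq"
    using p(1) q unfolding lin_vf_cpattern_def by blast+
  have "finite D \<and> (\<forall>d\<in>D. lin_vf_cpattern d \<and> has_closed_rep d) \<and> pairwise_non_overlapping D \<and>
    GC D = GC {p} - GC {q}"
  proof (cases "unifiable (s, \<phi>) (t, \<psi>)")
    case True
    with D obtain \<sigma> where mgu: "is_mgu \<sigma> s t" and D: "D = diff_pieces \<sigma> (s, \<phi>) (t, \<psi>) // doteq" by auto
    interpret overlap L s \<phi> t \<psi> \<sigma>
      by (rule overlapI[OF p(1) sp q tq disj closed mgu])
    obtain \<chi> where cl: "closure_of s \<phi> \<chi>" using closure_exists[OF pc p(2) sp] by blast
    have "GC D = GC {p} - GC {q}"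
      unfolding D GC_quotient[OF pieces_cterms] GC_pieces GC_class[OF pc sp] GC_class[OF qc tq] ..
    then show ?thesis
      unfolding D using finite_pieces pieces_lin_vf pieces_closed_rep[OF _ cl] pieces_non_overlapping
      by blast
  next
    case False
    with D have D: "D = {p}" by simp
    have "GC {p} \<inter> GC {q} = {}"
      unfolding GC_class[OF pc sp] GC_class[OF qc tq]
      by (rule not_unifiable_disjoint[OF p(1) sp q tq disj closed False])
    then have "GC D = GC {p} - GC {q}" unfolding D by blast
    moreover have "pairwise_non_overlapping D" unfolding D pairwise_non_overlapping_def by simp
    ultimately show ?thesis using p unfolding D by blast
  qed
  then show "finite D" "\<forall>d\<in>D. lin_vf_cpattern d \<and> has_closed_rep d" "pairwise_non_overlapping D"
    "GC D = GC {p} - GC {q}" by blast+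
qed

text \<open>Ensures that the premise of \<open>stop\<close> is not vacuously true. A closed
  representative of \<open>q\<close> is fixed and one of \<open>p\<close> is renamed away from it;
  in the unifiable case the mgu is part of unifiability.\<close>

lemma diff_two_exists:
  assumes p: "lin_vf_cpattern p" and q: "lin_vf_cpattern q" "has_closed_rep q"
  obtains D where "diff_two p q D"
proof -
  from q(2) obtain t \<psi> where t: "(t, \<psi>) \<in> q" "vars \<psi> \<subseteq> vars t" unfolding has_closed_rep_def by blast
  have pc: "p \<in> cterms // doteq" using p unfolding lin_vf_cpattern_def by blast
  then obtain c where "c \<in> p" using in_quotient_imp_non_empty[OF equiv_doteq] by blast
  then obtain s \<phi> where sp: "(s, \<phi>) \<in> p" by (cases c) blast
  have ct: "(s, \<phi>) \<in> cterms" by (rule lin_vf_cpatternD(5)[OF p sp])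
  obtain \<delta> where \<delta>: "renaming \<delta>" "\<delta> ` (vars s \<union> vars \<phi>) \<inter> (vars t \<union> vars \<psi>) = {}"
    by (rule fresh_renaming[of "vars s \<union> vars \<phi>" "vars t \<union> vars \<psi>"]) simp_all
  let ?s = "s \<cdot> (Var \<circ> \<delta>)" and ?\<phi> = "\<phi> \<cdot> (Var \<circ> \<delta>)"
  have inj: "inj \<delta>" using \<delta>(1) unfolding renaming_def bij_def by blast
  have "(?s, ?\<phi>) \<in> cterms"
    using ct has_sort_rename[OF _ \<delta>(1)] is_constraint_rename[OF _ \<delta>(1)] unfolding cterms_def by blast
  moreover have "vars ?s \<inter> vars ?\<phi> = \<delta> ` (vars s \<inter> vars \<phi>)"
    unfolding vars_rename by (rule image_Int[OF inj, symmetric])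
  ultimately have "((?s, ?\<phi>), (s, \<phi>)) \<in> doteq"
    unfolding doteq_iff using ct \<delta>(1) holds_rename[OF \<delta>(1)] by blast
  then have "(?s, ?\<phi>) \<in> p"
    using in_quotient_imp_closed[OF equiv_doteq pc sp] doteq_sym by blast
  moreover have "(vars ?s \<union> vars ?\<phi>) \<inter> (vars t \<union> vars \<psi>) = {}"
    using \<delta>(2) unfolding vars_rename image_Un .
  moreover have "\<exists>D. if unifiable (?s, ?\<phi>) (t, \<psi>)
      then \<exists>\<sigma>. is_mgu \<sigma> ?s t \<and> D = diff_pieces \<sigma> (?s, ?\<phi>) (t, \<psi>) // doteq else D = {p}"
  proof (cases "unifiable (?s, ?\<phi>) (t, \<psi>)")
    case True
    then obtain \<sigma> where "is_mgu \<sigma> ?s t" unfolding unifiable_def by blast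
    then show ?thesis using True by auto
  qed simp
  ultimately show thesis using that t unfolding diff_two_def by blast
qed

lemma pairwise_non_overlappingD:
  "pairwise_non_overlapping P \<Longrightarrow> p \<in> P \<Longrightarrow> q \<in> P \<Longrightarrow> p \<noteq> q \<Longrightarrow> GC {p} \<inter> GC {q} = {}"
  unfolding pairwise_non_overlapping_def pairwise_def by blast

lemma GC_Un: "GC (A \<union> B) = GC A \<union> GC B"
  by (simp add: GC_def)

text \<open>Closed representatives are carried along for both arguments because a step subtracts in
  both directions.\<close>

lemma diff_sets_correct:
  assumes "diff_sets P Q R"
  shows "finite P \<Longrightarrow> finite Q \<Longrightarrow> (\<And>p. p \<in> P \<union> Q \<Longrightarrow> lin_vf_cpattern p \<and> has_closed_rep p) \<Longrightarrow>
    pairwise_non_overlapping P \<Longrightarrow>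
    finite R \<and> (\<forall>r\<in>R. lin_vf_cpattern r) \<and> pairwise_non_overlapping R \<and> GC R = GC P - GC Q"
  using assms
proof (induction rule: diff_sets.induct)
  case (step p P' q Q' D E R)
  have p: "lin_vf_cpattern p" "has_closed_rep p" and q: "lin_vf_cpattern q" "has_closed_rep q"
    using step.prems(3) by blast+
  note D = diff_two_correct[OF step.hyps(3) p q(1)] and E = diff_two_correct[OF step.hyps(5) q p(1)]
  have P': "GC P' \<inter> GC {p} = {}"
  proof -
    have "GC {r} \<inter> GC {p} = {}" if "r \<in> P'" for r
      by (rule pairwise_non_overlappingD[OF step.prems(4)]) (use that step.hyps(1) in auto)
    then show ?thesis by (subst GC_Union) blast
  qed
  have "pairwise_non_overlapping (P' \<union> D)"
    unfolding pairwise_non_overlapping_def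
  proof (rule pairwiseI)
    have sub: "GC {r} \<subseteq> GC A" if "r \<in> A" for r A
      by (subst (2) GC_Union) (use that in blast)
    have mixed: "GC {r} \<inter> GC {r'} = {}" if "r \<in> P'" "r' \<in> D" for r r'
      using sub[OF that(1)] sub[OF that(2)] P' D(4) by blast
    fix r r' assume "r \<in> P' \<union> D" "r' \<in> P' \<union> D" and ne: "r \<noteq> r'"
    then consider "r \<in> P'" "r' \<in> P'" | "r \<in> P'" "r' \<in> D" | "r \<in> D" "r' \<in> P'" | "r \<in> D" "r' \<in> D"
      by blast
    then show "GC {r} \<inter> GC {r'} = {}"
    proof cases
      case 1
      show ?thesis by (rule pairwise_non_overlappingD[OF step.prems(4) _ _ ne]) (use 1 in simp_all)
    next
      case 2
      then show ?thesis by (rule mixed)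
    next
      case 3
      show ?thesis using mixed[OF 3(2,1)] by blast
    next
      case 4
      show ?thesis by (rule pairwise_non_overlappingD[OF D(3) 4 ne])
    qed
  qed
  moreover have "finite (P' \<union> D)" "finite (Q' \<union> E)" using step.prems(1,2) D(1) E(1) by simp_all
  moreover have "lin_vf_cpattern r \<and> has_closed_rep r" if "r \<in> (P' \<union> D) \<union> (Q' \<union> E)" for r
    using that step.prems(3)[of r] D(2) E(2) by blast
  ultimately have R: "finite R \<and> (\<forall>r\<in>R. lin_vf_cpattern r) \<and> pairwise_non_overlapping R \<and>
      GC R = GC (P' \<union> D) - GC (Q' \<union> E)"
    by (intro step.IH)
  have "GC (P' \<union> D) - GC (Q' \<union> E) = GC (P' \<union> {p}) - GC (Q' \<union> {q})"
    unfolding GC_Un D(4) E(4) using P' by blast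
  from R[unfolded this] show ?case .
next
  case (stop P Q)
  have disj: "GC {p} \<inter> GC {q} = {}" if pq: "p \<in> P" "q \<in> Q" for p q
  proof -
    have p: "lin_vf_cpattern p" "has_closed_rep p" and q: "lin_vf_cpattern q" "has_closed_rep q"
      using stop.prems(3) pq by blast+
    obtain D where D: "diff_two p q D" by (rule diff_two_exists[OF p(1) q])
    \<comment> \<open>Some difference exists, so stopping forces it to be the singleton of
      \<open>p\<close>; its correctness then reads \<open>GC {p} = GC {p} - GC {q}\<close>.\<close>
    then have "D = {p}" using stop.hyps pq by blast
    then show ?thesis using diff_two_correct(4)[OF D p q(1)] by blast
  qed
  have "GC P \<inter> GC Q = {}"
    unfolding GC_Union[of P] GC_Union[of Q] using disj by blast
  then have "GC P = GC P - GC Q" by blast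
  then show ?case using stop.prems by blast
qed

end

theorem theorem2:
  fixes L :: "('s, 'f, 'v, 'u) lc_sig"
    and P Q R :: "(('f, 'v) trm \<times> ('f, 'v) trm) set set"
  assumes "lc_signature L"
    and "finite P" and "finite Q"
    and "\<forall>p\<in>P \<union> Q. lc_signature.lin_vf_cpattern L p"
    and "\<forall>p\<in>P \<union> Q. has_closed_rep p"
    and "lc_signature.pairwise_non_overlapping L P"
    and "lc_signature.diff_sets L P Q R"
  shows "finite R \<and>
    (\<forall>r\<in>R. lc_signature.lin_vf_cpattern L r) \<and>
    lc_signature.pairwise_non_overlapping L R \<and>
    lc_signature.GC L R = lc_signature.GC L P - lc_signature.GC L Q"
proof -
  interpret lc_signature L by fact
  show ?thesis
    by (rule diff_sets_correct[OF assms(7,2,3) _ assms(6)]) (use assms(4,5) in blast)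
qed

end
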